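(* Every Exel–Renault interaction group has a minimal faithful dilation, unique up to isomorphism.
   Context: Ore semigroup: a cancellative monoid $P$ with $Pr\cap Ps\neq\emptyset$ for all $r,s\in P$. Its enveloping group is the group $G$ (unique up to canonical isomorphism) containing $P$ with $G=P^{-1}P$. Let $X$ be a compact Hausdorff space and $\theta:P\times X\to X$ a right action of an Ore semigroup $P$ (so $\theta_e=\mathrm{id}$, $\theta_{rs}=\theta_s\circ\theta_r$) such that each $\theta_t:X\to X$ is a covering map, meaning an onto local homeomorphism. Let $A=C(X)$ and let $\alpha_t(a)=a\circ\theta_t$, an action of $P$ by injective unital endomorphisms of $A$. A normalized coherent cocycle for $\theta$ is a continuous map $\omega:P\times X\to[0,1]$ with $\omega(t,y)>0$ for all $(t,y)\in P\times X$ such that: (i) $\sum_{y\in\theta_t^{-1}(x)}\omega(t,y)=1$ for all $t\in P$, $x\in X$; (ii) $\omega(rs,x)=\omega(r,x)\,\omega(s,\theta_r(x))$ for all $r,s\in P$, $x\in X$; (iii) $\omega(s,x)W_r(C_x^s\cap C_y^r)=\omega(r,x)W_s(C_x^r\cap C_y^s)$ for all $r,s\in P$, $x,y\in X$, where $C_x^s=\theta_s^{-1}(\theta_s(x))$ and $W_r(S)=\sum_{u\in S}\omega(r,u)$ for $S\subseteq X$. Interaction group: a map $V:G\to B(A)$ (bounded linear operators on the unital $C^*$-algebra $A$) such that (1) each $V_t$ is positive and unital; (2) $V_e=\mathrm{Id}$, $V_{s^{-1}}V_sV_t=V_{s^{-1}}V_{st}$ and $V_sV_tV_{t^{-1}}=V_{st}V_{t^{-1}}$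 for all $s,t\in G$; (3) $V_t(ab)=V_t(a)V_t(b)$ whenever $a$ or $b$ belongs to $V_{t^{-1}}(A)$. Known theorem of Exel and Renault: for each normalized coherent cocycle $\omega$, the formula $V^\omega_{t}(a)(x)=\sum_{y\in\theta_r^{-1}(x)}\omega(r,y)\,a(\theta_s(y))$ for $t=r^{-1}s$, $r,s\in P$, defines an interaction group $V^\omega:G\to B(A)$ extending $\alpha$ ($V^\omega_t=\alpha_t$ for $t\in P$). Such a $V^\omega$ is called an Exel–Renault interaction group. A dilation of an interaction group $V:G\to B(A)$ is a pair $(i,(B,\beta,F))$, where $\beta$ is an action of $G$ on a unital $C^*$-algebra $B$, $F:B\to B$ is a conditional expectation (a norm one idempotent whose range is a $C^*$-subalgebra of $B$), and $i:A\to B$ is a homomorphism of $C^*$-algebras with $iV_t=F\beta_ti$ for all $t\in G$. It is minimal if $B=\overline{\mathrm{span}}\{\beta_t(i(a)):a\in A,t\in G\}$, and faithful if $F$ is faithful ($b\neq0$ implies $F(b^*b)\neq0$). An isomorphism between dilations $(i,(B,\beta,F))$ and $(i',(B',\beta',F'))$ is an isomorphism of $C^*$-algebras $\phi:B\to B'$ with $\phi F=F'\phi$, $\phi\beta_t=\beta'_t\phi$ for all $t\in G$, and $\phi i=i'$.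
   Formalization: The homomorphism i of a dilation is required to be injective, and X to be nonempty: for trivial G and X two points, evaluation at one point gives a second, non-isomorphic minimal faithful dilation, and for empty X none exists. *)

theory Defs
  imports
    "HOL-Analysis.Analysis"
    "HOL-Algebra.Coset"
    "HOL-Algebra.Module"
    "HOL-Algebra.Algebraic_Closure_Type"
begin

section \<open>C*-algebras with explicit carriers\<close>

text \<open>
  The dilating algebra is built from the data of a theorem, so it cannot be a type of a type
  class; C*-algebras are therefore records, extending the modules of HOL-Algebra (over the
  ring of complex numbers) by an adjoint and a norm. Nothing is required of the operations
  outside the carrier.
\<close>

abbreviation complex_ring :: "complex ring"
  where "complex_ring \<equiv> ring_of_type_algebra"

record 'b cstar = "(complex, 'b) module" +
  adj :: "'b \<Rightarrow> 'b"
  nrm :: "'b \<Rightarrow> real"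

locale unital_cstar_algebra =
  M: Module.module complex_ring B + ring B for B :: "('b, 'm) cstar_scheme" (structure) +
  assumes smult_mult_left:
      "\<lbrakk>x \<in> carrier B; y \<in> carrier B\<rbrakk> \<Longrightarrow> (c \<odot> x) \<otimes> y = c \<odot> (x \<otimes> y)"
    and smult_mult_right:
      "\<lbrakk>x \<in> carrier B; y \<in> carrier B\<rbrakk> \<Longrightarrow> x \<otimes> (c \<odot> y) = c \<odot> (x \<otimes> y)"
    and adj_closed: "x \<in> carrier B \<Longrightarrow> adj B x \<in> carrier B"
    and adj_adj: "x \<in> carrier B \<Longrightarrow> adj B (adj B x) = x"
    and adj_add: "\<lbrakk>x \<in> carrier B; y \<in> carrier B\<rbrakk> \<Longrightarrow> adj B (x \<oplus> y) = adj B x \<oplus> adj B y"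
    and adj_smult: "x \<in> carrier B \<Longrightarrow> adj B (c \<odot> x) = cnj c \<odot> adj B x"
    and adj_mult: "\<lbrakk>x \<in> carrier B; y \<in> carrier B\<rbrakk> \<Longrightarrow> adj B (x \<otimes> y) = adj B y \<otimes> adj B x"
    and nrm_nonneg: "x \<in> carrier B \<Longrightarrow> 0 \<le> nrm B x"
    and nrm_eq_0_iff: "x \<in> carrier B \<Longrightarrow> nrm B x = 0 \<longleftrightarrow> x = \<zero>"
    and nrm_triangle: "\<lbrakk>x \<in> carrier B; y \<in> carrier B\<rbrakk> \<Longrightarrow> nrm B (x \<oplus> y) \<le> nrm B x + nrm B y"
    and nrm_smult: "x \<in> carrier B \<Longrightarrow> nrm B (c \<odot> x) = cmod c * nrm B x"
    and nrm_mult: "\<lbrakk>x \<in> carrier B; y \<in> carrier B\<rbrakk> \<Longrightarrow> nrm B (x \<otimes> y) \<le> nrm B x * nrm B y"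
    and cstar_identity: "x \<in> carrier B \<Longrightarrow> nrm B (adj B x \<otimes> x) = (nrm B x)\<^sup>2"
    and complete:
      "\<lbrakk>\<forall>n. s n \<in> carrier B;
        \<forall>e>0. \<exists>N. \<forall>m\<ge>N. \<forall>n\<ge>N. nrm B (s m \<ominus> s n) < e\<rbrakk>
       \<Longrightarrow> \<exists>l\<in>carrier B. (\<lambda>n::nat. nrm B (s n \<ominus> l)) \<longlonglongrightarrow> 0"

definition positive :: "('b, 'm) cstar_scheme \<Rightarrow> 'b \<Rightarrow> bool"
  where "positive B a \<longleftrightarrow> (\<exists>b\<in>carrier B. a = adj B b \<otimes>\<^bsub>B\<^esub> b)"

definition cstar_closure :: "('b, 'm) cstar_scheme \<Rightarrow> 'b set \<Rightarrow> 'b set"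
  where "cstar_closure B S = {b \<in> carrier B. \<forall>e>0. \<exists>s\<in>S. nrm B (b \<ominus>\<^bsub>B\<^esub> s) < e}"

definition cstar_span :: "('b, 'm) cstar_scheme \<Rightarrow> 'b set \<Rightarrow> 'b set"
  where "cstar_span B S = (\<lambda>H. submodule H complex_ring B) hull S"

definition cstar_subalgebra :: "'b set \<Rightarrow> ('b, 'm) cstar_scheme \<Rightarrow> bool"
  where "cstar_subalgebra S B \<longleftrightarrow>
    submodule S complex_ring B \<and>
    (\<forall>x\<in>S. \<forall>y\<in>S. x \<otimes>\<^bsub>B\<^esub> y \<in> S) \<and>
    (\<forall>x\<in>S. adj B x \<in> S) \<and>
    cstar_closure B S \<subseteq> S"

definition linear_maps ::
    "('b, 'm) cstar_scheme \<Rightarrow> ('c, 'n) cstar_scheme \<Rightarrow> ('b \<Rightarrow> 'c) set"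
  where "linear_maps B C = {T \<in> carrier B \<rightarrow> carrier C.
    (\<forall>x\<in>carrier B. \<forall>y\<in>carrier B. T (x \<oplus>\<^bsub>B\<^esub> y) = T x \<oplus>\<^bsub>C\<^esub> T y) \<and>
    (\<forall>c. \<forall>x\<in>carrier B. T (c \<odot>\<^bsub>B\<^esub> x) = c \<odot>\<^bsub>C\<^esub> T x)}"

definition bounded_linear_maps ::
    "('b, 'm) cstar_scheme \<Rightarrow> ('c, 'n) cstar_scheme \<Rightarrow> ('b \<Rightarrow> 'c) set"
  where "bounded_linear_maps B C =
    {T \<in> linear_maps B C. \<exists>K. \<forall>x\<in>carrier B. nrm C (T x) \<le> K * nrm B x}"

text \<open>The analogue of \<^const>\<open>onorm\<close>; meaningful for bounded maps.\<close>

definition op_norm :: "('b, 'm) cstar_scheme \<Rightarrow> ('c, 'n) cstar_scheme \<Rightarrow> ('b \<Rightarrow> 'c) \<Rightarrow> real"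
  where "op_norm B C T = (SUP x\<in>carrier B. nrm C (T x) / nrm B x)"

text \<open>Homomorphisms of C*-algebras need not be unital.\<close>

definition cstar_hom ::
    "('b, 'm) cstar_scheme \<Rightarrow> ('c, 'n) cstar_scheme \<Rightarrow> ('b \<Rightarrow> 'c) set"
  where "cstar_hom B C = {h \<in> linear_maps B C.
    (\<forall>x\<in>carrier B. \<forall>y\<in>carrier B. h (x \<otimes>\<^bsub>B\<^esub> y) = h x \<otimes>\<^bsub>C\<^esub> h y) \<and>
    (\<forall>x\<in>carrier B. h (adj B x) = adj C (h x))}"

definition cstar_iso ::
    "('b, 'm) cstar_scheme \<Rightarrow> ('c, 'n) cstar_scheme \<Rightarrow> ('b \<Rightarrow> 'c) set"
  where "cstar_iso B C = {h \<in> cstar_hom B C. bij_betw h (carrier B) (carrier C)}"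

definition cstar_action ::
    "('g, 'k) monoid_scheme \<Rightarrow> ('b, 'm) cstar_scheme \<Rightarrow> ('g \<Rightarrow> 'b \<Rightarrow> 'b) \<Rightarrow> bool"
  where "cstar_action G B \<beta> \<longleftrightarrow>
    (\<forall>t\<in>carrier G. \<beta> t \<in> cstar_iso B B) \<and>
    (\<forall>b\<in>carrier B. \<beta> \<one>\<^bsub>G\<^esub> b = b) \<and>
    (\<forall>s\<in>carrier G. \<forall>t\<in>carrier G. \<forall>b\<in>carrier B. \<beta> (s \<otimes>\<^bsub>G\<^esub> t) b = \<beta> s (\<beta> t b))"

definition conditional_expectation :: "('b, 'm) cstar_scheme \<Rightarrow> ('b \<Rightarrow> 'b) \<Rightarrow> bool"
  where "conditional_expectation B F \<longleftrightarrow>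
    F \<in> bounded_linear_maps B B \<and>
    op_norm B B F = 1 \<and>
    (\<forall>b\<in>carrier B. F (F b) = F b) \<and>
    cstar_subalgebra (F ` carrier B) B"

definition faithful_map :: "('b, 'm) cstar_scheme \<Rightarrow> ('b \<Rightarrow> 'b) \<Rightarrow> bool"
  where "faithful_map B F \<longleftrightarrow>
    (\<forall>b\<in>carrier B. b \<noteq> \<zero>\<^bsub>B\<^esub> \<longrightarrow> F (adj B b \<otimes>\<^bsub>B\<^esub> b) \<noteq> \<zero>\<^bsub>B\<^esub>)"

text \<open>$C(X)$, for $X$ a compact space given as a type.\<close>

definition C_alg :: "('x::topological_space \<Rightarrow> complex) cstar"
  where "C_alg = \<lparr>
    carrier = {f. continuous_on UNIV f},
    monoid.mult = (\<lambda>f g x. f x * g x),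
    one = (\<lambda>x. 1),
    ring.zero = (\<lambda>x. 0),
    add = (\<lambda>f g x. f x + g x),
    smult = (\<lambda>c f x. c * f x),
    adj = (\<lambda>f x. cnj (f x)),
    nrm = (\<lambda>f. SUP x. cmod (f x))\<rparr>"


section \<open>Ore semigroups, actions by covering maps and cocycles\<close>

definition ore_semigroup :: "('g, 'k) monoid_scheme \<Rightarrow> bool"
  where "ore_semigroup M \<longleftrightarrow>
    monoid M \<and>
    (\<forall>r\<in>carrier M. \<forall>s\<in>carrier M. \<forall>t\<in>carrier M.
      (r \<otimes>\<^bsub>M\<^esub> s = r \<otimes>\<^bsub>M\<^esub> t \<longrightarrow> s = t) \<and> (s \<otimes>\<^bsub>M\<^esub> r = t \<otimes>\<^bsub>M\<^esub> r \<longrightarrow> s = t)) \<and>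
    (\<forall>r\<in>carrier M. \<forall>s\<in>carrier M. (carrier M #>\<^bsub>M\<^esub> r) \<inter> (carrier M #>\<^bsub>M\<^esub> s) \<noteq> {})"

definition enveloping_group :: "('g, 'k) monoid_scheme \<Rightarrow> 'g set \<Rightarrow> bool"
  where "enveloping_group G P \<longleftrightarrow>
    group G \<and> submonoid P G \<and> carrier G = set_inv\<^bsub>G\<^esub> P <#>\<^bsub>G\<^esub> P"

definition local_homeomorphism ::
    "('x::topological_space \<Rightarrow> 'y::topological_space) \<Rightarrow> bool"
  where "local_homeomorphism f \<longleftrightarrow>
    (\<forall>x. \<exists>U g. open U \<and> x \<in> U \<and> open (f ` U) \<and> homeomorphism U (f ` U) f g)"

definition covering_action ::
    "('g, 'k) monoid_scheme \<Rightarrow> ('g \<Rightarrow> 'x::topological_space \<Rightarrow> 'x) \<Rightarrow> bool"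
  where "covering_action M \<theta> \<longleftrightarrow>
    \<theta> \<one>\<^bsub>M\<^esub> = id \<and>
    (\<forall>r\<in>carrier M. \<forall>s\<in>carrier M. \<theta> (r \<otimes>\<^bsub>M\<^esub> s) = \<theta> s \<circ> \<theta> r) \<and>
    (\<forall>t\<in>carrier M. surj (\<theta> t) \<and> local_homeomorphism (\<theta> t))"

text \<open>
  For compact Hausdorff \<open>X\<close> the fibres of a local homeomorphism are finite, so the sums over
  (subsets of) fibres below are genuine finite sums. The semigroup is discrete, hence
  continuity of \<open>\<omega>\<close> on \<open>P \<times> X\<close> is continuity of every \<open>\<omega> t\<close>.
\<close>

definition fibre :: "('g \<Rightarrow> 'x \<Rightarrow> 'x) \<Rightarrow> 'g \<Rightarrow> 'x \<Rightarrow> 'x set"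
  where "fibre \<theta> s x = \<theta> s -` {\<theta> s x}"

definition normalized_coherent_cocycle ::
    "('g, 'k) monoid_scheme \<Rightarrow> ('g \<Rightarrow> 'x::topological_space \<Rightarrow> 'x) \<Rightarrow> ('g \<Rightarrow> 'x \<Rightarrow> real) \<Rightarrow> bool"
  where "normalized_coherent_cocycle M \<theta> \<omega> \<longleftrightarrow>
    (\<forall>t\<in>carrier M. continuous_on UNIV (\<omega> t) \<and> range (\<omega> t) \<subseteq> {0..1} \<and> (\<forall>y. \<omega> t y > 0)) \<and>
    (\<forall>t\<in>carrier M. \<forall>x. (\<Sum>y\<in>\<theta> t -` {x}. \<omega> t y) = 1) \<and>
    (\<forall>r\<in>carrier M. \<forall>s\<in>carrier M. \<forall>x. \<omega> (r \<otimes>\<^bsub>M\<^esub> s) x = \<omega> r x * \<omega> s (\<theta> r x)) \<and>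
    (\<forall>r\<in>carrier M. \<forall>s\<in>carrier M. \<forall>x y.
      \<omega> s x * (\<Sum>u\<in>fibre \<theta> s x \<inter> fibre \<theta> r y. \<omega> r u) =
      \<omega> r x * (\<Sum>u\<in>fibre \<theta> r x \<inter> fibre \<theta> s y. \<omega> s u))"


section \<open>Interaction groups and their dilations\<close>

definition interaction_group ::
    "('g, 'k) monoid_scheme \<Rightarrow> ('a, 'm) cstar_scheme \<Rightarrow> ('g \<Rightarrow> 'a \<Rightarrow> 'a) \<Rightarrow> bool"
  where "interaction_group G A V \<longleftrightarrow>
    (\<forall>t\<in>carrier G. V t \<in> bounded_linear_maps A A \<and>
      (\<forall>a\<in>carrier A. positive A a \<longrightarrow> positive A (V t a)) \<and> V t \<one>\<^bsub>A\<^esub> = \<one>\<^bsub>A\<^esub>) \<and>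
    (\<forall>a\<in>carrier A. V \<one>\<^bsub>G\<^esub> a = a) \<and>
    (\<forall>s\<in>carrier G. \<forall>t\<in>carrier G. \<forall>a\<in>carrier A.
      V (inv\<^bsub>G\<^esub> s) (V s (V t a)) = V (inv\<^bsub>G\<^esub> s) (V (s \<otimes>\<^bsub>G\<^esub> t) a) \<and>
      V s (V t (V (inv\<^bsub>G\<^esub> t) a)) = V (s \<otimes>\<^bsub>G\<^esub> t) (V (inv\<^bsub>G\<^esub> t) a)) \<and>
    (\<forall>t\<in>carrier G. \<forall>a\<in>carrier A. \<forall>b\<in>carrier A.
      a \<in> V (inv\<^bsub>G\<^esub> t) ` carrier A \<or> b \<in> V (inv\<^bsub>G\<^esub> t) ` carrier A \<longrightarrow>
      V t (a \<otimes>\<^bsub>A\<^esub> b) = V t a \<otimes>\<^bsub>A\<^esub> V t b)"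

text \<open>
  By a theorem of Exel and Renault, the formula for \<open>V\<close> below is consistent for every normalized
  coherent cocycle and always defines an interaction group.
\<close>

definition exel_renault_interaction_group ::
    "('g, 'k) monoid_scheme \<Rightarrow> 'g set \<Rightarrow> ('g \<Rightarrow> 'x::topological_space \<Rightarrow> 'x) \<Rightarrow>
     ('g \<Rightarrow> ('x \<Rightarrow> complex) \<Rightarrow> ('x \<Rightarrow> complex)) \<Rightarrow> bool"
  where "exel_renault_interaction_group G P \<theta> V \<longleftrightarrow>
    interaction_group G C_alg V \<and>
    (\<exists>\<omega>. normalized_coherent_cocycle (G\<lparr>carrier := P\<rparr>) \<theta> \<omega> \<and>
      (\<forall>r\<in>P. \<forall>s\<in>P. \<forall>a\<in>carrier C_alg. \<forall>x.
        V (inv\<^bsub>G\<^esub> r \<otimes>\<^bsub>G\<^esub> s) a x =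
          (\<Sum>y\<in>\<theta> r -` {x}. complex_of_real (\<omega> r y) * a (\<theta> s y))))"

text \<open>
  A proposition cannot quantify existentially over types, so an existence claim for dilations
  has to name the type \<open>'b\<close> of the elements of \<open>B\<close>. When \<open>A\<close> is $C(X)$ with \<open>X\<close> the type
  \<open>'x\<close>, the type \<open>('g \<Rightarrow> 'x) \<Rightarrow> complex\<close> is large enough: it can hold the functions on a
  projective limit of copies of \<open>X\<close> indexed by \<open>P\<close>.
\<close>

type_synonym ('a, 'g, 'b) dilation =
  "('a \<Rightarrow> 'b) \<times> 'b cstar \<times> ('g \<Rightarrow> 'b \<Rightarrow> 'b) \<times> ('b \<Rightarrow> 'b)"

text \<open>
  The homomorphism \<open>i\<close> is taken to be injective, so that \<open>A\<close> is a C*-subalgebra of \<open>B\<close>. Without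
  this, minimal faithful dilations are not unique: for the trivial group acting on a two-point
  space \<open>X\<close>, both the identity of $C(X)$ and the evaluation of $C(X)$ at one of the points
  (with \<open>\<beta>\<close> and \<open>F\<close> identities) would be minimal faithful dilations of the identity.
\<close>

fun is_dilation ::
    "('g, 'k) monoid_scheme \<Rightarrow> ('a, 'm) cstar_scheme \<Rightarrow> ('g \<Rightarrow> 'a \<Rightarrow> 'a) \<Rightarrow>
     ('a, 'g, 'b) dilation \<Rightarrow> bool"
  where "is_dilation G A V (i, B, \<beta>, F) \<longleftrightarrow>
    unital_cstar_algebra B \<and>
    cstar_action G B \<beta> \<and>
    conditional_expectation B F \<and>
    i \<in> cstar_hom A B \<and> inj_on i (carrier A) \<and>
    (\<forall>t\<in>carrier G. \<forall>a\<in>carrier A. i (V t a) = F (\<beta> t (i a)))"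

fun minimal_dilation ::
    "('g, 'k) monoid_scheme \<Rightarrow> ('a, 'm) cstar_scheme \<Rightarrow> ('a, 'g, 'b) dilation \<Rightarrow> bool"
  where "minimal_dilation G A (i, B, \<beta>, F) \<longleftrightarrow>
    carrier B = cstar_closure B (cstar_span B {\<beta> t (i a) | a t. a \<in> carrier A \<and> t \<in> carrier G})"

fun faithful_dilation :: "('a, 'g, 'b) dilation \<Rightarrow> bool"
  where "faithful_dilation (i, B, \<beta>, F) \<longleftrightarrow> faithful_map B F"

fun isomorphic_dilations ::
    "('g, 'k) monoid_scheme \<Rightarrow> ('a, 'm) cstar_scheme \<Rightarrow>
     ('a, 'g, 'b) dilation \<Rightarrow> ('a, 'g, 'c) dilation \<Rightarrow> bool"
  where "isomorphic_dilations G A (i, B, \<beta>, F) (i', B', \<beta>', F') \<longleftrightarrow>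
    (\<exists>\<phi>\<in>cstar_iso B B'.
      (\<forall>b\<in>carrier B. \<phi> (F b) = F' (\<phi> b)) \<and>
      (\<forall>t\<in>carrier G. \<forall>b\<in>carrier B. \<phi> (\<beta> t b) = \<beta>' t (\<phi> b)) \<and>
      (\<forall>a\<in>carrier A. \<phi> (i a) = i' a))"

definition minimal_faithful_dilation ::
    "('g, 'k) monoid_scheme \<Rightarrow> ('a, 'm) cstar_scheme \<Rightarrow> ('g \<Rightarrow> 'a \<Rightarrow> 'a) \<Rightarrow>
     ('a, 'g, 'b) dilation \<Rightarrow> bool"
  where "minimal_faithful_dilation G A V D \<longleftrightarrow>
    is_dilation G A V D \<and> minimal_dilation G A D \<and> faithful_dilation D"

end

theory Submission
  imports Defs
begin

text \<open>
  The dilating algebra consists of the continuous functions on the projective limit \<open>Y\<close> of the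
  maps \<open>\<theta>\<^sub>t\<close>, realised as the uniform closure of the functions that depend on one coordinate;
  \<open>G\<close> acts by shifting coordinates, and \<open>F\<close> is the continuous extension of the maps
  \<open>V\<^bsub>q\<^sup>-\<^sup>1\<^esub>\<close>. It is faithful since the weights \<open>\<omega>\<close> are positive.

  For uniqueness, let \<open>(i, B, \<beta>, F)\<close> be any minimal faithful dilation. A projection of norm one
  onto a subalgebra is a module map over \<open>i(A)\<close> (Tomiyama), so \<open>F(c\<^sup>* c) = 0\<close> for
  \<open>c = \<beta>\<^sub>t(i(a)) - i(a \<circ> \<theta>\<^sub>t)\<close>, \<open>t \<in> P\<close>, and faithfulness gives covariance. Hence \<open>B\<close> is the
  closure of an increasing union of copies of $C(X)$ with the same connecting maps as in the
  canonical dilation, and injective homomorphisms from $C(X)$ are isometric.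
\<close>

section \<open>Norms, bounded maps and extension by continuity\<close>

text \<open>C*-algebras enter through their axioms alone. Spectral theory and the bidual, on which
  the usual proofs of Tomiyama's theorem and of the isometry of injective homomorphisms rest, are
  replaced by norm estimates. Spectral projections of i(A) give way to chains of continuous cut-offs
  with h_n h_(n+1) = h_n, and positivity to a Pythagoras bound for elements with adj(x) y = 0. Two
  complications shape that part: \<open>i\<close> may miss the unit of \<open>B\<close>, so
  constants already need an argument, and \<open>F\<close> is not given as compatible with adjoints,
  so left and right module property are obtained separately. The limit space is indexed by all of
  \<open>G\<close>, so that \<open>G\<close> acts by plain translation and no \<theta> has to be
  inverted. A function on it has a name at every sufficiently high level, so maps are extended from
  relations instead of functions. Two dilations may have different element types; each is compared
  with the canonical one.\<close>

context unital_cstar_algebra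
begin

lemma smult_closed [simp, intro]: "x \<in> carrier B \<Longrightarrow> c \<odot> x \<in> carrier B"
  using M.smult_closed by (simp add: ring_of_type_algebra_def)

lemma smult_add_left: "x \<in> carrier B \<Longrightarrow> (c + d) \<odot> x = c \<odot> x \<oplus> d \<odot> x"
  using M.smult_l_distr[of c d x] by (simp add: ring_of_type_algebra_def)

lemma smult_add_right:
  "\<lbrakk>x \<in> carrier B; y \<in> carrier B\<rbrakk> \<Longrightarrow> c \<odot> (x \<oplus> y) = c \<odot> x \<oplus> c \<odot> y"
  using M.smult_r_distr[of c x y] by (simp add: ring_of_type_algebra_def)

lemma smult_smult: "x \<in> carrier B \<Longrightarrow> c \<odot> (d \<odot> x) = (c * d) \<odot> x"
  using M.smult_assoc1[of c d x] by (simp add: ring_of_type_algebra_def)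

lemma smult_1: "x \<in> carrier B \<Longrightarrow> 1 \<odot> x = x"
  using M.smult_one[of x] by (simp add: ring_of_type_algebra_def)

lemma smult_0: "x \<in> carrier B \<Longrightarrow> 0 \<odot> x = \<zero>"
  using M.smult_l_null[of x] by (simp add: ring_of_type_algebra_def)

lemma smult_zero [simp]: "c \<odot> \<zero> = \<zero>"
  using M.smult_r_null[of c] by (simp add: ring_of_type_algebra_def)

lemma smult_minus_1:
  assumes "x \<in> carrier B"
  shows "(-1) \<odot> x = \<ominus> x"
proof -
  have "x \<oplus> (-1) \<odot> x = \<zero>"
    using smult_add_left[OF assms, of 1 "-1"] smult_1[OF assms] smult_0[OF assms] by simp
  then show ?thesis
    using assms by (metis M.M.minus_equality M.M.a_comm smult_closed)
qed

lemma diff_eq_smult: "\<lbrakk>x \<in> carrier B; y \<in> carrier B\<rbrakk> \<Longrightarrow> x \<ominus> y = x \<oplus> (-1) \<odot> y"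
  by (simp add: smult_minus_1 a_minus_def)

lemma diff_closed [simp, intro]: "\<lbrakk>x \<in> carrier B; y \<in> carrier B\<rbrakk> \<Longrightarrow> x \<ominus> y \<in> carrier B"
  by (rule M.M.minus_closed)

lemma smult_diff:
  "\<lbrakk>x \<in> carrier B; y \<in> carrier B\<rbrakk> \<Longrightarrow> c \<odot> (x \<ominus> y) = c \<odot> x \<ominus> c \<odot> y"
  by (simp add: diff_eq_smult smult_add_right smult_smult)

lemma nrm_zero [simp]: "nrm B \<zero> = 0"
  using nrm_eq_0_iff by simp

lemma nrm_minus: "x \<in> carrier B \<Longrightarrow> nrm B (\<ominus> x) = nrm B x"
  using nrm_smult[of x "-1"] by (simp add: smult_minus_1)

lemma nrm_diff_commute:
  assumes "x \<in> carrier B" "y \<in> carrier B"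
  shows "nrm B (x \<ominus> y) = nrm B (y \<ominus> x)"
proof -
  have "x \<ominus> y = \<ominus> (y \<ominus> x)" using assms by algebra
  then show ?thesis using assms by (simp add: nrm_minus)
qed

lemma nrm_diff_triangle:
  assumes "x \<in> carrier B" "y \<in> carrier B" "z \<in> carrier B"
  shows "nrm B (x \<ominus> z) \<le> nrm B (x \<ominus> y) + nrm B (y \<ominus> z)"
proof -
  have "x \<ominus> z = (x \<ominus> y) \<oplus> (y \<ominus> z)" using assms by algebra
  then show ?thesis using assms nrm_triangle[of "x \<ominus> y" "y \<ominus> z"] by simp
qed

lemma nrm_diff_le: "\<lbrakk>x \<in> carrier B; y \<in> carrier B\<rbrakk> \<Longrightarrow> nrm B (x \<ominus> y) \<le> nrm B x + nrm B y"
  using nrm_triangle[of x "\<ominus> y"] by (simp add: a_minus_def nrm_minus)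

lemma nrm_add_diff_le:
  assumes "x \<in> carrier B" "y \<in> carrier B" "x' \<in> carrier B" "y' \<in> carrier B"
  shows "nrm B ((x \<oplus> y) \<ominus> (x' \<oplus> y')) \<le> nrm B (x \<ominus> x') + nrm B (y \<ominus> y')"
proof -
  have "(x \<oplus> y) \<ominus> (x' \<oplus> y') = (x \<ominus> x') \<oplus> (y \<ominus> y')" using assms by algebra
  then show ?thesis using assms nrm_triangle[of "x \<ominus> x'" "y \<ominus> y'"] by simp
qed

lemma diff_eq_zero_iff: "\<lbrakk>x \<in> carrier B; y \<in> carrier B\<rbrakk> \<Longrightarrow> x \<ominus> y = \<zero> \<longleftrightarrow> x = y"
  by (simp add: r_right_minus_eq)

lemma diff_mult_distrib:
  "\<lbrakk>x \<in> carrier B; y \<in> carrier B; z \<in> carrier B\<rbrakk> \<Longrightarrow> (x \<ominus> y) \<otimes> z = x \<otimes> z \<ominus> y \<otimes> z"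
  by algebra

lemma mult_diff_distrib:
  "\<lbrakk>x \<in> carrier B; y \<in> carrier B; z \<in> carrier B\<rbrakk> \<Longrightarrow> z \<otimes> (x \<ominus> y) = z \<otimes> x \<ominus> z \<otimes> y"
  by algebra

lemma diff_zero [simp]: "x \<in> carrier B \<Longrightarrow> x \<ominus> \<zero> = x"
  by algebra

lemma diff_self [simp]: "x \<in> carrier B \<Longrightarrow> x \<ominus> x = \<zero>"
  by algebra

lemma zero_if_nrm_small:
  assumes "x \<in> carrier B" "\<And>e. e > 0 \<Longrightarrow> nrm B x \<le> e"
  shows "x = \<zero>"
  using assms field_le_epsilon[of "nrm B x" 0] nrm_nonneg[of x] nrm_eq_0_iff[of x] by fastforce

lemma eq_if_nrm_small:
  assumes "x \<in> carrier B" "y \<in> carrier B" "\<And>e. e > 0 \<Longrightarrow> nrm B (x \<ominus> y) \<le> e"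
  shows "x = y"
  using assms zero_if_nrm_small[of "x \<ominus> y"] diff_eq_zero_iff by simp

lemma adj_zero [simp]: "adj B \<zero> = \<zero>"
  using adj_smult[of \<zero> 0] by (simp add: smult_0 adj_closed)

lemma adj_minus: "x \<in> carrier B \<Longrightarrow> adj B (\<ominus> x) = \<ominus> adj B x"
  using adj_smult[of x "-1"] by (simp add: smult_minus_1 adj_closed)

lemma adj_diff: "\<lbrakk>x \<in> carrier B; y \<in> carrier B\<rbrakk> \<Longrightarrow> adj B (x \<ominus> y) = adj B x \<ominus> adj B y"
  by (simp add: a_minus_def adj_add adj_minus)

lemma nrm_adj:
  assumes "x \<in> carrier B"
  shows "nrm B (adj B x) = nrm B x"
proof -
  have le: "nrm B y \<le> nrm B (adj B y)" if y: "y \<in> carrier B" for y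
  proof (cases "nrm B y = 0")
    case False
    have "nrm B y * nrm B y \<le> nrm B (adj B y) * nrm B y"
      using cstar_identity[OF y] nrm_mult[of "adj B y" y] y
      by (simp add: power2_eq_square adj_closed)
    then show ?thesis using False nrm_nonneg[OF y] by simp
  qed (simp add: nrm_nonneg adj_closed y)
  show ?thesis
    using le[OF assms] le[of "adj B x"] assms by (simp add: adj_closed adj_adj)
qed

text \<open>Taking adjoints shows that the second cross term of adj(x + y)(x + y) vanishes too; the
  C*-identity turns the rest into norms. All later uses of orthogonality go through this
  bound.\<close>

lemma nrm_add_orthogonal:
  assumes "x \<in> carrier B" "y \<in> carrier B" "adj B x \<otimes> y = \<zero>"
  shows "(nrm B (x \<oplus> y))\<^sup>2 \<le> (nrm B x)\<^sup>2 + (nrm B y)\<^sup>2"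
proof -
  have yx: "adj B y \<otimes> x = \<zero>"
    using adj_mult[of "adj B x" y] assms by (simp add: adj_closed adj_adj)
  have "adj B (x \<oplus> y) \<otimes> (x \<oplus> y)
      = (adj B x \<otimes> x \<oplus> adj B y \<otimes> y) \<oplus> (adj B x \<otimes> y \<oplus> adj B y \<otimes> x)"
    using assms(1,2) adj_closed[OF assms(1)] adj_closed[OF assms(2)]
    unfolding adj_add[OF assms(1,2)] by algebra
  also have "\<dots> = adj B x \<otimes> x \<oplus> adj B y \<otimes> y"
    using assms yx by (simp add: adj_closed)
  finally have "(nrm B (x \<oplus> y))\<^sup>2 = nrm B (adj B x \<otimes> x \<oplus> adj B y \<otimes> y)"
    using cstar_identity[of "x \<oplus> y"] assms by simp
  also have "\<dots> \<le> (nrm B x)\<^sup>2 + (nrm B y)\<^sup>2"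
    using nrm_triangle[of "adj B x \<otimes> x" "adj B y \<otimes> y"] assms cstar_identity
    by (simp add: adj_closed)
  finally show ?thesis .
qed

end

section \<open>Linear maps on dense subsets: uniqueness and extension\<close>

lemma linear_mapsD:
  assumes "T \<in> linear_maps B C"
  shows "x \<in> carrier B \<Longrightarrow> T x \<in> carrier C"
    and "\<lbrakk>x \<in> carrier B; y \<in> carrier B\<rbrakk> \<Longrightarrow> T (x \<oplus>\<^bsub>B\<^esub> y) = T x \<oplus>\<^bsub>C\<^esub> T y"
    and "x \<in> carrier B \<Longrightarrow> T (c \<odot>\<^bsub>B\<^esub> x) = c \<odot>\<^bsub>C\<^esub> T x"
  using assms by (auto simp: linear_maps_def)

lemma linear_maps_diff:
  assumes "unital_cstar_algebra B" "unital_cstar_algebra C" "T \<in> linear_maps B C"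
    "x \<in> carrier B" "y \<in> carrier B"
  shows "T (x \<ominus>\<^bsub>B\<^esub> y) = T x \<ominus>\<^bsub>C\<^esub> T y"
proof -
  interpret B: unital_cstar_algebra B by fact
  interpret C: unital_cstar_algebra C by fact
  show ?thesis
    using assms(3-5) by (simp add: B.diff_eq_smult C.diff_eq_smult linear_mapsD)
qed

lemma bounded_linear_maps_agree:
  assumes B: "unital_cstar_algebra B" and C: "unital_cstar_algebra C"
    and T: "T \<in> bounded_linear_maps B C" and T': "T' \<in> bounded_linear_maps B C"
    and S: "S \<subseteq> carrier B" "cstar_closure B S = carrier B"
    and agree: "\<And>s. s \<in> S \<Longrightarrow> T s = T' s"
    and b: "b \<in> carrier B"
  shows "T b = T' b"
proof -
  interpret B: unital_cstar_algebra B by fact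
  interpret C: unital_cstar_algebra C by fact
  obtain K where K: "\<And>x. x \<in> carrier B \<Longrightarrow> nrm C (T x) \<le> K * nrm B x"
    and TL: "T \<in> linear_maps B C" using T by (auto simp: bounded_linear_maps_def)
  obtain K' where K': "\<And>x. x \<in> carrier B \<Longrightarrow> nrm C (T' x) \<le> K' * nrm B x"
    and TL': "T' \<in> linear_maps B C" using T' by (auto simp: bounded_linear_maps_def)
  show ?thesis
  proof (rule C.eq_if_nrm_small)
    fix e :: real assume "e > 0"
    \<comment> \<open>Nothing makes \<open>K\<close> and \<open>K'\<close> nonnegative, hence the
      absolute values; the \<open>+ 1\<close> keeps the denominator positive.\<close>
    define d where "d = e / (\<bar>K\<bar> + \<bar>K'\<bar> + 1)"
    have d: "d > 0" "(\<bar>K\<bar> + \<bar>K'\<bar>) * d \<le> e"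
      using \<open>e > 0\<close> by (auto simp: d_def field_simps)
    then obtain s where s: "s \<in> S" "nrm B (b \<ominus>\<^bsub>B\<^esub> s) < d"
      using S b by (fastforce simp: cstar_closure_def)
    note sB = subsetD[OF S(1) s(1)]
    have "nrm C (T b \<ominus>\<^bsub>C\<^esub> T' b)
        \<le> nrm C (T b \<ominus>\<^bsub>C\<^esub> T s) + nrm C (T' s \<ominus>\<^bsub>C\<^esub> T' b)"
      using C.nrm_diff_triangle[of "T b" "T s" "T' b"] agree[OF s(1)] b sB TL TL'
      by (simp add: linear_mapsD)
    also have "\<dots> = nrm C (T (b \<ominus>\<^bsub>B\<^esub> s)) + nrm C (T' (b \<ominus>\<^bsub>B\<^esub> s))"
      using b sB TL TL' C.nrm_diff_commute[of "T' s" "T' b"]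
      by (simp add: linear_mapsD linear_maps_diff[OF B C])
    also have "\<dots> \<le> \<bar>K\<bar> * nrm B (b \<ominus>\<^bsub>B\<^esub> s) + \<bar>K'\<bar> * nrm B (b \<ominus>\<^bsub>B\<^esub> s)"
      using K[of "b \<ominus>\<^bsub>B\<^esub> s"] K'[of "b \<ominus>\<^bsub>B\<^esub> s"] b sB B.nrm_nonneg[of "b \<ominus>\<^bsub>B\<^esub> s"]
      by (intro add_mono order.trans[OF K] order.trans[OF K'] mult_right_mono) auto
    also have "\<dots> \<le> (\<bar>K\<bar> + \<bar>K'\<bar>) * d"
      using s(2) by (simp add: distrib_right add_mono mult_left_mono)
    also have "\<dots> \<le> e" by fact
    finally show "nrm C (T b \<ominus>\<^bsub>C\<^esub> T' b) \<le> e" .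
  qed (use b TL TL' in \<open>auto intro: linear_mapsD\<close>)
qed

text \<open>Stability under the operations turns the norm bound into a bound on differences, which
  makes \<open>R\<close> single-valued and uniformly continuous at once. Starting from a relation
  spares a separate proof of well-definedness when the elements of the dense domain have several
  names, as cylinder functions do.\<close>

lemma contractive_relation_extend:
  assumes B: "unital_cstar_algebra B" and C: "unital_cstar_algebra C"
    and R: "R \<subseteq> carrier B \<times> carrier C"
    and R_add: "\<And>x y x' y'. (x, y) \<in> R \<Longrightarrow> (x', y') \<in> R \<Longrightarrow> (x \<oplus>\<^bsub>B\<^esub> x', y \<oplus>\<^bsub>C\<^esub> y') \<in> R"
    and R_smult: "\<And>x y c. (x, y) \<in> R \<Longrightarrow> (c \<odot>\<^bsub>B\<^esub> x, c \<odot>\<^bsub>C\<^esub> y) \<in> R"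
    and R_nrm: "\<And>x y. (x, y) \<in> R \<Longrightarrow> nrm C y \<le> nrm B x"
    and dense: "cstar_closure B (Domain R) = carrier B"
  obtains T where "T \<in> linear_maps B C" "\<And>x. x \<in> carrier B \<Longrightarrow> nrm C (T x) \<le> nrm B x"
    "\<And>x y. (x, y) \<in> R \<Longrightarrow> T x = y"
proof -
  interpret B: unital_cstar_algebra B by fact
  interpret C: unital_cstar_algebra C by fact
  \<comment> \<open>The graph of the extension: the closure of \<open>R\<close> in the product of
    the two algebras. Completeness of \<open>C\<close> makes it total, contractivity makes it
    single-valued.\<close>
  define Q where "Q b l \<longleftrightarrow> b \<in> carrier B \<and> l \<in> carrier C \<and>
    (\<forall>e>0. \<exists>(x, y)\<in>R. nrm B (b \<ominus>\<^bsub>B\<^esub> x) < e \<and> nrm C (l \<ominus>\<^bsub>C\<^esub> y) < e)" for b l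
  have QD: "\<exists>x y. (x, y) \<in> R \<and> nrm B (b \<ominus>\<^bsub>B\<^esub> x) < e \<and> nrm C (l \<ominus>\<^bsub>C\<^esub> y) < e"
    if "Q b l" "e > 0" for b l e using that by (auto simp: Q_def)
  have R_diff: "nrm C (y \<ominus>\<^bsub>C\<^esub> y') \<le> nrm B (x \<ominus>\<^bsub>B\<^esub> x')" if "(x, y) \<in> R" "(x', y') \<in> R" for x y x' y'
  proof -
    have "x \<in> carrier B" "x' \<in> carrier B" "y \<in> carrier C" "y' \<in> carrier C" using that R by auto
    then show ?thesis
      using R_nrm[OF R_add[OF that(1) R_smult[OF that(2), of "-1"]]]
      by (simp add: B.diff_eq_smult C.diff_eq_smult)
  qed
  have Q_ex: "\<exists>l. Q b l" if b: "b \<in> carrier B" for b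
  proof -
    have "\<exists>z\<in>R. nrm B (b \<ominus>\<^bsub>B\<^esub> fst z) < inverse (Suc n)" for n
    proof -
      have "b \<in> cstar_closure B (Domain R)" using dense b by simp
      moreover have "inverse (real (Suc n)) > 0" by simp
      ultimately obtain x where "x \<in> Domain R" "nrm B (b \<ominus>\<^bsub>B\<^esub> x) < inverse (Suc n)"
        unfolding cstar_closure_def by blast
      then show ?thesis by (metis DomainE fst_conv)
    qed
    then obtain z where z: "\<And>n. z n \<in> R" "\<And>n. nrm B (b \<ominus>\<^bsub>B\<^esub> fst (z n)) < inverse (Suc n)"
      by metis
    have zc: "fst (z n) \<in> carrier B" "snd (z n) \<in> carrier C" for n
      using z(1)[of n] R by auto
    have cauchy: "\<exists>N. \<forall>m\<ge>N. \<forall>n\<ge>N. nrm C (snd (z m) \<ominus>\<^bsub>C\<^esub> snd (z n)) < e" if "e > 0" for e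
    proof -
      obtain N where N: "inverse (Suc N) < e / 2" using \<open>e > 0\<close> reals_Archimedean[of "e/2"] by auto
      have "nrm C (snd (z m) \<ominus>\<^bsub>C\<^esub> snd (z n)) < e" if "m \<ge> N" "n \<ge> N" for m n
      proof -
        have mon: "inverse (real (Suc k)) \<le> inverse (real (Suc N))" if "k \<ge> N" for k
          using that by (intro le_imp_inverse_le) auto
        have "nrm C (snd (z m) \<ominus>\<^bsub>C\<^esub> snd (z n)) \<le> nrm B (fst (z m) \<ominus>\<^bsub>B\<^esub> fst (z n))"
          using R_diff[of "fst (z m)" "snd (z m)" "fst (z n)" "snd (z n)"] z(1) by simp
        also have "\<dots> \<le> nrm B (b \<ominus>\<^bsub>B\<^esub> fst (z m)) + nrm B (b \<ominus>\<^bsub>B\<^esub> fst (z n))"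
          using B.nrm_diff_triangle[of "fst (z m)" b "fst (z n)"] zc b
            B.nrm_diff_commute[of "fst (z m)" b] by simp
        also have "\<dots> < e" using z(2)[of m] z(2)[of n] N mon[OF that(1)] mon[OF that(2)] by linarith
        finally show ?thesis .
      qed
      then show ?thesis by blast
    qed
    obtain l where l: "l \<in> carrier C" "(\<lambda>n. nrm C (snd (z n) \<ominus>\<^bsub>C\<^esub> l)) \<longlonglongrightarrow> 0"
      using C.complete[of "\<lambda>n. snd (z n)"] zc cauchy by blast
    have "Q b l"
      unfolding Q_def
    proof (intro conjI allI impI)
      fix e :: real assume "e > 0"
      then obtain N1 where N1: "\<And>n. n \<ge> N1 \<Longrightarrow> nrm C (snd (z n) \<ominus>\<^bsub>C\<^esub> l) < e"
        using order_tendstoD(2)[OF l(2), of e] by (auto simp: eventually_sequentially)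
      obtain N2 where N2: "inverse (Suc N2) < e" using \<open>e > 0\<close> reals_Archimedean by auto
      define n where "n = max N1 N2"
      have "inverse (real (Suc n)) \<le> inverse (real (Suc N2))"
        by (intro le_imp_inverse_le) (auto simp: n_def)
      then have "nrm B (b \<ominus>\<^bsub>B\<^esub> fst (z n)) < e" using z(2)[of n] N2 by linarith
      moreover have "nrm C (l \<ominus>\<^bsub>C\<^esub> snd (z n)) < e"
        using N1[of n] l(1) zc C.nrm_diff_commute[of l "snd (z n)"] by (simp add: n_def)
      ultimately show "\<exists>(x, y)\<in>R. nrm B (b \<ominus>\<^bsub>B\<^esub> x) < e \<and> nrm C (l \<ominus>\<^bsub>C\<^esub> y) < e"
        using z(1)[of n] by (intro bexI[of _ "z n"]) (auto simp: case_prod_unfold)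
    qed (use b l in auto)
    then show ?thesis by blast
  qed
  have Q_contr: "nrm C (l \<ominus>\<^bsub>C\<^esub> l') \<le> nrm B (b \<ominus>\<^bsub>B\<^esub> b')" if Q: "Q b l" "Q b' l'" for b l b' l'
  proof (rule field_le_epsilon)
    fix e :: real assume "e > 0"
    obtain x y where xy: "(x, y) \<in> R" "nrm B (b \<ominus>\<^bsub>B\<^esub> x) < e/4" "nrm C (l \<ominus>\<^bsub>C\<^esub> y) < e/4"
      using QD[OF Q(1), of "e/4"] \<open>e > 0\<close> by auto
    obtain x' y' where xy': "(x', y') \<in> R" "nrm B (b' \<ominus>\<^bsub>B\<^esub> x') < e/4" "nrm C (l' \<ominus>\<^bsub>C\<^esub> y') < e/4"
      using QD[OF Q(2), of "e/4"] \<open>e > 0\<close> by auto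
    have c: "x \<in> carrier B" "x' \<in> carrier B" "y \<in> carrier C" "y' \<in> carrier C"
      "b \<in> carrier B" "b' \<in> carrier B" "l \<in> carrier C" "l' \<in> carrier C"
      using xy xy' R Q by (auto simp: Q_def)
    have "nrm C (l \<ominus>\<^bsub>C\<^esub> l') \<le> nrm C (l \<ominus>\<^bsub>C\<^esub> y) + (nrm C (y \<ominus>\<^bsub>C\<^esub> y') + nrm C (l' \<ominus>\<^bsub>C\<^esub> y'))"
      using C.nrm_diff_triangle[of l y l'] C.nrm_diff_triangle[of y y' l']
        C.nrm_diff_commute[of l' y'] c by simp
    also have "nrm C (y \<ominus>\<^bsub>C\<^esub> y') \<le> nrm B (x \<ominus>\<^bsub>B\<^esub> x')" using R_diff xy xy' by blast
    also have "nrm B (x \<ominus>\<^bsub>B\<^esub> x')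
        \<le> nrm B (b \<ominus>\<^bsub>B\<^esub> x) + (nrm B (b \<ominus>\<^bsub>B\<^esub> b') + nrm B (b' \<ominus>\<^bsub>B\<^esub> x'))"
      using B.nrm_diff_triangle[of x b x'] B.nrm_diff_triangle[of b b' x']
        B.nrm_diff_commute[of x b] c by simp
    finally show "nrm C (l \<ominus>\<^bsub>C\<^esub> l') \<le> nrm B (b \<ominus>\<^bsub>B\<^esub> b') + e" using xy xy' by simp
  qed
  have Q_unique: "l = l'" if "Q b l" "Q b l'" for b l l'
    using Q_contr[OF that] that C.eq_if_nrm_small[of l l']
    by (auto simp: Q_def B.diff_eq_zero_iff[THEN iffD2])
  have Q_R: "Q x y" if "(x, y) \<in> R" for x y
    unfolding Q_def using that R
    by (auto intro!: bexI[OF _ that] simp: B.diff_eq_zero_iff[THEN iffD2] C.diff_eq_zero_iff[THEN iffD2])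
  have Q_add: "Q (b \<oplus>\<^bsub>B\<^esub> b') (l \<oplus>\<^bsub>C\<^esub> l')" if Q: "Q b l" "Q b' l'" for b l b' l'
    unfolding Q_def
  proof (intro conjI allI impI)
    fix e :: real assume "e > 0"
    obtain x y where xy: "(x, y) \<in> R" "nrm B (b \<ominus>\<^bsub>B\<^esub> x) < e/2" "nrm C (l \<ominus>\<^bsub>C\<^esub> y) < e/2"
      using QD[OF Q(1), of "e/2"] \<open>e > 0\<close> by auto
    obtain x' y' where xy': "(x', y') \<in> R" "nrm B (b' \<ominus>\<^bsub>B\<^esub> x') < e/2" "nrm C (l' \<ominus>\<^bsub>C\<^esub> y') < e/2"
      using QD[OF Q(2), of "e/2"] \<open>e > 0\<close> by auto
    have c: "x \<in> carrier B" "x' \<in> carrier B" "y \<in> carrier C" "y' \<in> carrier C"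
      "b \<in> carrier B" "b' \<in> carrier B" "l \<in> carrier C" "l' \<in> carrier C"
      using xy xy' R Q by (auto simp: Q_def)
    show "\<exists>(x, y)\<in>R. nrm B (b \<oplus>\<^bsub>B\<^esub> b' \<ominus>\<^bsub>B\<^esub> x) < e \<and> nrm C (l \<oplus>\<^bsub>C\<^esub> l' \<ominus>\<^bsub>C\<^esub> y) < e"
      using B.nrm_add_diff_le[of b b' x x'] C.nrm_add_diff_le[of l l' y y'] xy(2,3) xy'(2,3) c
      by (intro bexI[OF _ R_add[OF xy(1) xy'(1)]]) simp
  qed (use Q in \<open>auto simp: Q_def\<close>)
  have Q_smult: "Q (c \<odot>\<^bsub>B\<^esub> b) (c \<odot>\<^bsub>C\<^esub> l)" if Q: "Q b l" for b l c
    unfolding Q_def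
  proof (intro conjI allI impI)
    fix e :: real assume "e > 0"
    have d: "e / (cmod c + 1) > 0" using \<open>e > 0\<close> by (auto simp: add_nonneg_pos)
    have scale: "cmod c * t < e" if "t < e / (cmod c + 1)" "t \<ge> 0" for t
    proof -
      have "cmod c + 1 > 0" by (simp add: add_nonneg_pos)
      then have "(cmod c + 1) * t < e" using that by (simp add: pos_less_divide_eq mult.commute)
      then show ?thesis using that(2) by (simp add: distrib_right)
    qed
    obtain x y where xy: "(x, y) \<in> R" "nrm B (b \<ominus>\<^bsub>B\<^esub> x) < e / (cmod c + 1)"
      "nrm C (l \<ominus>\<^bsub>C\<^esub> y) < e / (cmod c + 1)"
      using QD[OF Q d] by auto
    have c: "x \<in> carrier B" "y \<in> carrier C" "b \<in> carrier B" "l \<in> carrier C"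
      using xy R Q by (auto simp: Q_def)
    show "\<exists>(x, y)\<in>R. nrm B (c \<odot>\<^bsub>B\<^esub> b \<ominus>\<^bsub>B\<^esub> x) < e \<and> nrm C (c \<odot>\<^bsub>C\<^esub> l \<ominus>\<^bsub>C\<^esub> y) < e"
      using scale[OF xy(2)] scale[OF xy(3)] c
      by (intro bexI[OF _ R_smult[OF xy(1), of c]])
        (auto simp: B.nrm_nonneg C.nrm_nonneg B.nrm_smult C.nrm_smult
          simp flip: B.smult_diff C.smult_diff)
  qed (use Q in \<open>auto simp: Q_def\<close>)
  define T where "T b = (THE l. Q b l)" for b
  have T: "T b = l" if "Q b l" for b l
    unfolding T_def using that Q_unique by blast
  have TQ: "Q b (T b)" if "b \<in> carrier B" for b using Q_ex[OF that] T by metis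
  have Tc: "T b \<in> carrier C" if "b \<in> carrier B" for b using TQ[OF that] by (simp add: Q_def)
  have TL: "T \<in> linear_maps B C"
    unfolding linear_maps_def using Tc TQ by (auto intro!: T Q_add Q_smult)
  show ?thesis
  proof (rule that[OF TL])
    fix b assume b: "b \<in> carrier B"
    \<comment> \<open>The pair of zeros lies in the graph, being 0 times any pair; comparing with it
      turns the estimate for differences into the norm bound.\<close>
    have "Q \<zero>\<^bsub>B\<^esub> (0 \<odot>\<^bsub>C\<^esub> T b)"
      using Q_smult[OF TQ[OF b], of 0] b by (simp add: B.smult_0)
    then show "nrm C (T b) \<le> nrm B b"
      using Q_contr[OF TQ[OF b], of "\<zero>\<^bsub>B\<^esub>" "\<zero>\<^bsub>C\<^esub>"] b Tc[OF b]
      by (simp add: C.smult_0 a_minus_def)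
  qed (use T Q_R in auto)
qed

section \<open>Algebras of functions and their homomorphisms\<close>

text \<open>The space \<open>S\<close> may be a proper subset of its type, as \<open>Y\<close> will
  be. Functions are extended by zero, so the unit is the indicator of \<open>S\<close> and norms can
  be taken over the whole type.\<close>

definition fun_cstar :: "'s set \<Rightarrow> ('s \<Rightarrow> complex) set \<Rightarrow> ('s \<Rightarrow> complex) cstar"
  where "fun_cstar S K = \<lparr>
    carrier = K,
    monoid.mult = (\<lambda>f g x. f x * g x),
    one = (\<lambda>x. of_bool (x \<in> S)),
    ring.zero = (\<lambda>x. 0),
    add = (\<lambda>f g x. f x + g x),
    smult = (\<lambda>c f x. c * f x),
    adj = (\<lambda>f x. cnj (f x)),
    nrm = (\<lambda>f. SUP x. cmod (f x))\<rparr>"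

lemma fun_cstar_simps [simp]:
  "carrier (fun_cstar S K) = K"
  "f \<otimes>\<^bsub>fun_cstar S K\<^esub> g = (\<lambda>x. f x * g x)"
  "\<one>\<^bsub>fun_cstar S K\<^esub> = (\<lambda>x. of_bool (x \<in> S))"
  "\<zero>\<^bsub>fun_cstar S K\<^esub> = (\<lambda>x. 0)"
  "f \<oplus>\<^bsub>fun_cstar S K\<^esub> g = (\<lambda>x. f x + g x)"
  "c \<odot>\<^bsub>fun_cstar S K\<^esub> f = (\<lambda>x. c * f x)"
  "adj (fun_cstar S K) f = (\<lambda>x. cnj (f x))"
  "nrm (fun_cstar S K) f = (SUP x. cmod (f x))"
  by (simp_all add: fun_cstar_def)

text \<open>Common frame for C(X) and for the algebra on the projective limit.
  \<open>K_limit\<close> is the source of completeness; \<open>K_sqrt\<close> makes the unitaries k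
  + i sqrt(1 - k^2) available for real k bounded by 1.\<close>

locale function_algebra =
  fixes S :: "'s set" and K :: "('s \<Rightarrow> complex) set"
  assumes nonempty: "S \<noteq> {}"
    and vanish: "\<lbrakk>f \<in> K; x \<notin> S\<rbrakk> \<Longrightarrow> f x = 0"
    and bounded: "f \<in> K \<Longrightarrow> \<exists>M. \<forall>x. cmod (f x) \<le> M"
    and K_one: "(\<lambda>x. of_bool (x \<in> S)) \<in> K"
    and K_add: "\<lbrakk>f \<in> K; g \<in> K\<rbrakk> \<Longrightarrow> (\<lambda>x. f x + g x) \<in> K"
    and K_mult: "\<lbrakk>f \<in> K; g \<in> K\<rbrakk> \<Longrightarrow> (\<lambda>x. f x * g x) \<in> K"
    and K_cnj: "f \<in> K \<Longrightarrow> (\<lambda>x. cnj (f x)) \<in> K"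
    and K_smult: "f \<in> K \<Longrightarrow> (\<lambda>x. c * f x) \<in> K"
    and K_limit: "(\<And>e. e > 0 \<Longrightarrow> \<exists>g\<in>K. \<forall>x. cmod (f x - g x) \<le> e) \<Longrightarrow> f \<in> K"
    and K_sqrt: "f \<in> K \<Longrightarrow> (\<lambda>x. of_real (of_bool (x \<in> S) * sqrt (max 0 (1 - (cmod (f x))\<^sup>2)))) \<in> K"
begin

abbreviation "A \<equiv> fun_cstar S K"

lemma K_zero: "(\<lambda>x. 0) \<in> K"
  using K_smult[OF K_one, of 0] by simp

lemma K_diff: "\<lbrakk>f \<in> K; g \<in> K\<rbrakk> \<Longrightarrow> (\<lambda>x. f x - g x) \<in> K"
  using K_add[OF _ K_smult[of g "-1"]] by simp

lemma cmod_le_nrm: "f \<in> K \<Longrightarrow> cmod (f x) \<le> (SUP x. cmod (f x))"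
  using bounded by (intro cSUP_upper) (auto simp: bdd_above_def)

lemma nrm_ge_0: "f \<in> K \<Longrightarrow> 0 \<le> (SUP x. cmod (f x))"
  by (rule order.trans[OF norm_ge_zero cmod_le_nrm])

lemma nrm_le: "(\<And>x. cmod (f x) \<le> c) \<Longrightarrow> (SUP x. cmod (f x)) \<le> c"
  by (intro cSUP_least) auto

lemma abelian_group: "abelian_group A"
proof (rule abelian_groupI)
  fix f assume "f \<in> carrier A"
  then have "(\<lambda>x. (-1) * f x) \<in> K" by (intro K_smult) simp
  then show "\<exists>g\<in>carrier A. g \<oplus>\<^bsub>A\<^esub> f = \<zero>\<^bsub>A\<^esub>"
    by (intro bexI[of _ "\<lambda>x. (-1) * f x"]) simp_all
qed (auto intro: K_zero K_add simp: add_ac)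

lemma minus_eq: "f \<in> K \<Longrightarrow> g \<in> K \<Longrightarrow> f \<ominus>\<^bsub>A\<^esub> g = (\<lambda>x. f x - g x)"
proof -
  assume fg: "f \<in> K" "g \<in> K"
  interpret abelian_group A by (rule abelian_group)
  have "\<ominus>\<^bsub>A\<^esub> g = (\<lambda>x. (-1) * g x)"
    by (rule minus_equality) (simp_all add: fg K_smult[OF fg(2), of "-1", simplified])
  then show ?thesis by (simp add: a_minus_def)
qed

lemma complete:
  fixes s :: "nat \<Rightarrow> 's \<Rightarrow> complex"
  assumes s: "\<And>n. s n \<in> K"
    and cauchy: "\<forall>e>0. \<exists>N. \<forall>m\<ge>N. \<forall>n\<ge>N. (SUP x. cmod (s m x - s n x)) < e"
  obtains l where "l \<in> K" "(\<lambda>n. SUP x. cmod (s n x - l x)) \<longlonglongrightarrow> 0"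
proof -
  have *: "\<exists>N. \<forall>m\<ge>N. \<forall>n\<ge>N. \<forall>x. cmod (s m x - s n x) < e" if "e > 0" for e
  proof -
    obtain N where "\<forall>m\<ge>N. \<forall>n\<ge>N. (SUP x. cmod (s m x - s n x)) < e" using cauchy \<open>e > 0\<close> by blast
    then show ?thesis
      by (intro exI[of _ N]) (auto intro: order.strict_trans1[OF cmod_le_nrm[OF K_diff[OF s s]]])
  qed
  have "Cauchy (\<lambda>n. s n x)" for x
    unfolding Cauchy_def dist_norm using * by metis
  then have "\<forall>x. \<exists>l. (\<lambda>n. s n x) \<longlonglongrightarrow> l"
    using Cauchy_convergent by (auto simp: convergent_def)
  then obtain l where l: "\<And>x. (\<lambda>n. s n x) \<longlonglongrightarrow> l x"
    by metis
  have unif: "\<exists>N. \<forall>n\<ge>N. \<forall>x. cmod (s n x - l x) \<le> e" if "e > 0" for e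
  proof -
    obtain N where N: "\<And>m n x. m \<ge> N \<Longrightarrow> n \<ge> N \<Longrightarrow> cmod (s m x - s n x) < e" using *[OF \<open>e > 0\<close>] by blast
    have "cmod (s n x - l x) \<le> e" if "n \<ge> N" for n x
    proof (rule LIMSEQ_le_const2)
      show "(\<lambda>m. cmod (s n x - s m x)) \<longlonglongrightarrow> cmod (s n x - l x)"
        by (intro tendsto_intros l)
      show "\<exists>M. \<forall>m\<ge>M. cmod (s n x - s m x) \<le> e"
        using N that less_imp_le by blast
    qed
    then show ?thesis by blast
  qed
  have "l \<in> K"
  proof (rule K_limit)
    fix e :: real assume "e > 0"
    then obtain N where "\<forall>x. cmod (s N x - l x) \<le> e" using unif by blast
    then show "\<exists>g\<in>K. \<forall>x. cmod (l x - g x) \<le> e"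
      using s by (intro bexI[of _ "s N"]) (auto simp: norm_minus_commute)
  qed
  moreover have "(\<lambda>n. SUP x. cmod (s n x - l x)) \<longlonglongrightarrow> 0"
  proof (rule LIMSEQ_I)
    fix e :: real assume "e > 0"
    then obtain N where N: "\<forall>n\<ge>N. \<forall>x. cmod (s n x - l x) \<le> e/2" using unif[of "e/2"] by auto
    have "norm ((SUP x. cmod (s n x - l x)) - 0) < e" if "n \<ge> N" for n
    proof -
      have "0 \<le> (SUP x. cmod (s n x - l x))"
        by (rule nrm_ge_0[OF K_diff[OF s \<open>l \<in> K\<close>]])
      moreover have "(SUP x. cmod (s n x - l x)) \<le> e/2"
        using N that by (intro nrm_le) auto
      ultimately show ?thesis using \<open>e > 0\<close> by simp
    qed
    then show "\<exists>N. \<forall>n\<ge>N. norm ((SUP x. cmod (s n x - l x)) - 0) < e" by blast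
  qed
  ultimately show ?thesis using that by blast
qed

lemma cstar: "unital_cstar_algebra A"
proof -
  have cring: "cring complex_ring"
    by (rule cring_from_type_algebra)
  have M: "Module.module complex_ring A"
    by (rule moduleI[OF cring abelian_group])
      (auto intro: K_smult simp: ring_of_type_algebra_def algebra_simps)
  have R: "ring A"
  proof (rule ringI[OF abelian_group])
    show "Group.monoid A"
    proof (rule monoidI)
      fix f assume "f \<in> carrier A"
      then have "of_bool (x \<in> S) * f x = f x" "f x * of_bool (x \<in> S) = f x" for x
        by (cases "x \<in> S"; simp add: vanish)+
      then show "\<one>\<^bsub>A\<^esub> \<otimes>\<^bsub>A\<^esub> f = f" "f \<otimes>\<^bsub>A\<^esub> \<one>\<^bsub>A\<^esub> = f"
        by (simp_all only: fun_cstar_simps)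
    qed (auto intro: K_mult K_one simp: mult_ac)
  qed (auto simp: algebra_simps)
  show ?thesis
  proof (intro unital_cstar_algebra.intro unital_cstar_algebra_axioms.intro M R)
    fix f assume f: "f \<in> carrier A"
    show "(nrm A f = 0) = (f = \<zero>\<^bsub>A\<^esub>)"
    proof
      assume "nrm A f = 0"
      then have "cmod (f x) \<le> 0" for x using cmod_le_nrm[of f x] f by simp
      then show "f = \<zero>\<^bsub>A\<^esub>" by auto
    qed simp
    show "nrm A (c \<odot>\<^bsub>A\<^esub> f) = cmod c * nrm A f" for c
    proof (cases "c = 0")
      case False
      have "(SUP x. cmod (c * f x)) \<le> cmod c * (SUP x. cmod (f x))"
        using f by (intro nrm_le) (auto simp: norm_mult intro!: mult_left_mono cmod_le_nrm)
      moreover have "(SUP x. cmod (f x)) \<le> (SUP x. cmod (c * f x)) / cmod c"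
        using f False cmod_le_nrm[OF K_smult[of f c]]
        by (intro nrm_le) (auto simp: norm_mult field_simps)
      ultimately show ?thesis using False by (simp add: field_simps)
    qed simp
    show "nrm A (adj A f \<otimes>\<^bsub>A\<^esub> f) = (nrm A f)\<^sup>2"
    proof (rule antisym)
      have "(SUP x. cmod (cnj (f x) * f x)) \<le> (SUP x. cmod (f x))\<^sup>2"
        using f by (intro nrm_le) (auto simp: norm_mult power2_eq_square intro!: mult_mono cmod_le_nrm nrm_ge_0)
      then show "nrm A (adj A f \<otimes>\<^bsub>A\<^esub> f) \<le> (nrm A f)\<^sup>2" by simp
      have sq: "(cmod (f x))\<^sup>2 \<le> (SUP x. cmod (cnj (f x) * f x))" for x
        using cmod_le_nrm[OF K_mult[OF K_cnj], of f f x] f by (simp add: norm_mult power2_eq_square)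
      have "(SUP x. cmod (f x)) \<le> sqrt (SUP x. cmod (cnj (f x) * f x))"
        by (rule nrm_le, rule real_le_rsqrt, rule sq)
      then have "(SUP x. cmod (f x))\<^sup>2 \<le> (SUP x. cmod (cnj (f x) * f x))"
        using f by (intro sqrt_ge_absD) (simp add: nrm_ge_0)
      then show "(nrm A f)\<^sup>2 \<le> nrm A (adj A f \<otimes>\<^bsub>A\<^esub> f)" by simp
    qed
    fix g assume g: "g \<in> carrier A"
    have "(SUP x. cmod (f x + g x)) \<le> (SUP x. cmod (f x)) + (SUP x. cmod (g x))"
      using f g by (intro nrm_le order.trans[OF norm_triangle_ineq] add_mono cmod_le_nrm) auto
    then show "nrm A (f \<oplus>\<^bsub>A\<^esub> g) \<le> nrm A f + nrm A g" by simp
    have "(SUP x. cmod (f x * g x)) \<le> (SUP x. cmod (f x)) * (SUP x. cmod (g x))"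
      using f g
      by (intro nrm_le) (auto simp: norm_mult intro!: mult_mono cmod_le_nrm nrm_ge_0)
    then show "nrm A (f \<otimes>\<^bsub>A\<^esub> g) \<le> nrm A f * nrm A g" by simp
  next
    fix s :: "nat \<Rightarrow> 's \<Rightarrow> complex"
    assume s: "\<forall>n. s n \<in> carrier A"
      and cauchy: "\<forall>e>0. \<exists>N. \<forall>m\<ge>N. \<forall>n\<ge>N. nrm A (s m \<ominus>\<^bsub>A\<^esub> s n) < e"
    have sK: "s n \<in> K" for n using s by simp
    have "\<forall>e>0. \<exists>N. \<forall>m\<ge>N. \<forall>n\<ge>N. (SUP x. cmod (s m x - s n x)) < e"
      using cauchy s by (simp add: minus_eq)
    then obtain l where "l \<in> K" "(\<lambda>n. SUP x. cmod (s n x - l x)) \<longlonglongrightarrow> 0"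
      using complete[of s, OF sK] by blast
    then show "\<exists>l\<in>carrier A. (\<lambda>n. nrm A (s n \<ominus>\<^bsub>A\<^esub> l)) \<longlonglongrightarrow> 0"
      using s by (intro bexI[of _ l]) (auto simp: minus_eq)
  qed (use nrm_ge_0 in \<open>auto intro: K_cnj simp: algebra_simps\<close>)
qed

text \<open>Unitaries suffice: a real \<open>k\<close> bounded by 1 is the mean of the unitaries k +
  i sqrt(1 - k^2) and k - i sqrt(1 - k^2), and the C*-identity reduces a general function to the
  real function |f|^2. This replaces the comparison of spectra.\<close>

lemma hom_contractive:
  assumes B: "unital_cstar_algebra B" and J: "J \<in> cstar_hom A B" and f: "f \<in> K"
  shows "nrm B (J f) \<le> nrm A f"
proof -
  interpret B: unital_cstar_algebra B by fact
  have JL: "J \<in> linear_maps A B" using J by (simp add: cstar_hom_def)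
  have Jc: "J g \<in> carrier B" if "g \<in> K" for g using linear_mapsD(1)[OF JL] that by simp
  have J_add: "J (\<lambda>x. g x + h x) = J g \<oplus>\<^bsub>B\<^esub> J h" if "g \<in> K" "h \<in> K" for g h
    using linear_mapsD(2)[OF JL] that by simp
  have J_smult: "J (\<lambda>x. c * g x) = c \<odot>\<^bsub>B\<^esub> J g" if "g \<in> K" for g c
    using linear_mapsD(3)[OF JL] that by simp
  have J_star: "(nrm B (J g))\<^sup>2 = nrm B (J (\<lambda>x. cnj (g x) * g x))" if "g \<in> K" for g
    using J that B.cstar_identity[OF Jc[OF that]] K_cnj by (simp add: cstar_hom_def)
  \<comment> \<open>\<open>J\<close> need not preserve units, but J(1) is a self-adjoint idempotent,
    so by the C*-identity its norm is 0 or 1.\<close>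
  have unit: "nrm B (J g) \<le> 1" if "g \<in> K" "(\<lambda>x. cnj (g x) * g x) = (\<lambda>x. of_bool (x \<in> S))" for g
  proof -
    let ?p = "nrm B (J (\<lambda>x. of_bool (x \<in> S)))"
    have "(\<lambda>x. cnj (of_bool (x \<in> S)) * of_bool (x \<in> S)) = (\<lambda>x. of_bool (x \<in> S) :: complex)"
      by auto
    then have "?p\<^sup>2 = ?p" using J_star[OF K_one] by simp
    then have "?p = 0 \<or> ?p = 1" by (simp add: power2_eq_square)
    then have "?p \<le> 1" by linarith
    then have "(nrm B (J g))\<^sup>2 \<le> 1\<^sup>2" using J_star[OF that(1)] that(2) by simp
    then show ?thesis by (rule power2_le_imp_le) simp
  qed
  have real: "nrm B (J k) \<le> 1" if k: "k \<in> K" "\<And>x. k x \<in> \<real>" "\<And>x. cmod (k x) \<le> 1" for k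
  proof -
    define w where "w = (\<lambda>x. of_real (of_bool (x \<in> S) * sqrt (max 0 (1 - (cmod (k x))\<^sup>2))) :: complex)"
    have w: "w \<in> K" unfolding w_def by (rule K_sqrt[OF k(1)])
    have sq: "k x * k x + w x * w x = of_bool (x \<in> S)" for x
    proof (cases "x \<in> S")
      case True
      obtain r where r: "k x = of_real r" using k(2) by (auto elim: Reals_cases)
      have "\<bar>r\<bar> \<le> 1" using k(3)[of x] r by simp
      then have "r\<^sup>2 \<le> 1" by (simp add: abs_square_le_1)
      then show ?thesis using True r
        by (simp add: w_def power2_eq_square flip: of_real_mult of_real_add)
    qed (simp add: w_def vanish k)
    have cnj: "cnj (k x) = k x" "cnj (w x) = w x" for x
      using k(2) by (auto simp: w_def Reals_cnj_iff)
    define u where "u c = (\<lambda>x. k x + c * w x)" for c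
    have u: "u c \<in> K" for c unfolding u_def by (intro K_add K_smult k w)
    \<comment> \<open>For c = i or c = -i the cross terms of |k + c w|^2 cancel, because k and w are
      real, and k^2 + w^2 is the unit.\<close>
    have u1: "nrm B (J (u c)) \<le> 1" if c: "c = \<i> \<or> c = - \<i>" for c
    proof (intro unit u)
      have "cnj (u c x) * u c x = k x * k x + w x * w x" for x
        using c by (auto simp: u_def cnj algebra_simps)
      then show "(\<lambda>x. cnj (u c x) * u c x) = (\<lambda>x. of_bool (x \<in> S))" by (simp add: sq)
    qed
    have Jk: "J k = (1/2) \<odot>\<^bsub>B\<^esub> (J (u \<i>) \<oplus>\<^bsub>B\<^esub> J (u (-\<i>)))"
    proof -
      have "k = (\<lambda>x. (1/2) * (u \<i> x + u (-\<i>) x))" by (auto simp: u_def)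
      then have "J k = J (\<lambda>x. (1/2) * (u \<i> x + u (-\<i>) x))" by simp
      also have "\<dots> = (1/2) \<odot>\<^bsub>B\<^esub> J (\<lambda>x. u \<i> x + u (-\<i>) x)" by (rule J_smult[OF K_add[OF u u]])
      also have "J (\<lambda>x. u \<i> x + u (-\<i>) x) = J (u \<i>) \<oplus>\<^bsub>B\<^esub> J (u (-\<i>))" by (rule J_add[OF u u])
      finally show ?thesis .
    qed
    have "nrm B (J (u \<i>) \<oplus>\<^bsub>B\<^esub> J (u (-\<i>))) \<le> nrm B (J (u \<i>)) + nrm B (J (u (-\<i>)))"
      by (intro B.nrm_triangle Jc u)
    moreover have "nrm B (J k) = (1/2) * nrm B (J (u \<i>) \<oplus>\<^bsub>B\<^esub> J (u (-\<i>)))"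
      using Jk Jc[OF u] by (simp add: B.nrm_smult)
    ultimately show ?thesis using u1[of \<i>] u1[of "- \<i>"] by simp
  qed
  have le1: "nrm B (J g) \<le> 1" if g: "g \<in> K" "\<And>x. cmod (g x) \<le> 1" for g
  proof -
    have "(nrm B (J g))\<^sup>2 \<le> 1\<^sup>2"
      unfolding J_star[OF g(1)] power_one
    proof (rule real)
      show "cnj (g x) * g x \<in> \<real>" for x
        by (simp add: Reals_cnj_iff mult.commute)
      show "cmod (cnj (g x) * g x) \<le> 1" for x
        using g(2)[of x] by (simp add: norm_mult mult_le_one)
    qed (intro K_mult K_cnj g)
    then show ?thesis by (rule power2_le_imp_le) simp
  qed
  show ?thesis
  proof (rule field_le_epsilon)
    fix e :: real assume "e > 0"
    \<comment> \<open>The added \<open>e\<close> makes the divisor positive even if \<open>f\<close>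
      is zero.\<close>
    define M where "M = nrm A f + e"
    have "0 \<le> nrm A f" using nrm_ge_0[OF f] by simp
    then have M: "M > 0" using \<open>e > 0\<close> by (simp add: M_def)
    have "nrm B (J (\<lambda>x. complex_of_real (1 / M) * f x)) \<le> 1"
    proof (rule le1)
      show "cmod (complex_of_real (1 / M) * f x) \<le> 1" for x
      proof -
        have "cmod (f x) \<le> M" using cmod_le_nrm[OF f, of x] \<open>e > 0\<close> by (simp add: M_def)
        then show ?thesis unfolding norm_mult norm_of_real using M by simp
      qed
    qed (rule K_smult[OF f])
    then have "nrm B (J f) \<le> M"
      unfolding J_smult[OF f] B.nrm_smult[OF Jc[OF f]] norm_of_real using M by simp
    then show "nrm B (J f) \<le> nrm A f + e" unfolding M_def .
  qed
qed

end

section \<open>The algebra C(X) and its injective homomorphisms\<close>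

lemma C_alg_eq: "C_alg = fun_cstar UNIV {f. continuous_on UNIV f}"
  by (simp add: C_alg_def fun_cstar_def)

lemma function_algebra_continuous:
  assumes "compact (UNIV :: 'x::topological_space set)"
  shows "function_algebra (UNIV :: 'x set) {f. continuous_on UNIV f}"
proof
  fix f :: "'x \<Rightarrow> complex" assume f: "f \<in> {f. continuous_on UNIV f}"
  then have "compact (range f)" using assms by (intro compact_continuous_image) auto
  then show "\<exists>M. \<forall>x. cmod (f x) \<le> M"
    using compact_imp_bounded by (fastforce simp: bounded_iff)
next
  fix f :: "'x \<Rightarrow> complex"
  assume *: "\<And>e. e > 0 \<Longrightarrow> \<exists>g\<in>{f. continuous_on UNIV f}. \<forall>x. cmod (f x - g x) \<le> e"
  have "\<exists>g. continuous_on UNIV g \<and> (\<forall>x. cmod (f x - g x) \<le> inverse (Suc n))" for n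
    using *[of "inverse (Suc n)"] by auto
  then obtain g where g: "\<And>n. continuous_on UNIV (g n)"
    "\<And>n x. cmod (f x - g n x) \<le> inverse (real (Suc n))" by metis
  have "continuous_on UNIV f"
  proof (rule uniform_limit_theorem)
    show "uniform_limit UNIV g f sequentially"
    proof (rule uniform_limitI)
      fix e :: real assume "e > 0"
      have "eventually (\<lambda>n. inverse (real (Suc n)) < e) sequentially"
        using LIMSEQ_inverse_real_of_nat \<open>e > 0\<close> by (rule order_tendstoD)
      then show "\<forall>\<^sub>F n in sequentially. \<forall>x\<in>UNIV. dist (g n x) (f x) < e"
        by eventually_elim (metis dist_norm g(2) norm_minus_commute order.strict_trans1)
    qed
  qed (use g in auto)
  then show "f \<in> {f. continuous_on UNIV f}" by simp
qed (auto intro!: continuous_intros)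

text \<open>If J shrinks f, there is a c with |J(H)| < c < sup H for H = |f|^2. The nonzero function
  G = max(0, H - c) can be divided by any power of H, at the price of a factor c^-n, so |J(G)| <=
  (|J(H)| / c)^n |G| for all n. Hence J(G) = 0, against injectivity.\<close>

lemma C_alg_hom_isometric:
  fixes J :: "('x::topological_space \<Rightarrow> complex) \<Rightarrow> 'b"
  assumes X: "compact (UNIV :: 'x set)" and B: "unital_cstar_algebra B"
    and J: "J \<in> cstar_hom C_alg B" and inj: "inj_on J (carrier C_alg)"
    and f: "continuous_on UNIV f"
  shows "nrm B (J f) = nrm C_alg f"
proof -
  interpret function_algebra "UNIV :: 'x set" "{f. continuous_on UNIV f}"
    by (rule function_algebra_continuous[OF X])
  interpret B: unital_cstar_algebra B by fact
  note C_alg_eq [simp]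
  have JL: "J \<in> linear_maps A B" using J by (simp add: cstar_hom_def)
  have Jc: "J g \<in> carrier B" if "continuous_on UNIV g" for g using linear_mapsD(1)[OF JL] that by simp
  have J_mult: "J (\<lambda>x. g x * h x) = J g \<otimes>\<^bsub>B\<^esub> J h"
    if "continuous_on UNIV g" "continuous_on UNIV h" for g h
    using J that by (simp add: cstar_hom_def)
  have J_star: "(nrm B (J g))\<^sup>2 = nrm B (J (\<lambda>x. cnj (g x) * g x))" if "continuous_on UNIV g" for g
    using J that B.cstar_identity[OF Jc[OF that]]
    by (simp add: cstar_hom_def continuous_on_cnj)
  have contr: "nrm B (J g) \<le> nrm A g" if "continuous_on UNIV g" for g
    using hom_contractive[OF B] J that by simp
  define h where "h x = (cmod (f x))\<^sup>2" for x
  have hc: "continuous_on UNIV h" unfolding h_def by (intro continuous_intros f)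
  define H where "H x = complex_of_real (h x)" for x
  have Hc: "continuous_on UNIV H" unfolding H_def by (intro continuous_intros hc)
  have H: "(\<lambda>x. cnj (f x) * f x) = H"
    by (simp add: H_def h_def fun_eq_iff complex_norm_square mult.commute del: of_real_power)
  have "\<not> nrm B (J f) < nrm A f"
  proof
    assume less: "nrm B (J f) < nrm A f"
    \<comment> \<open>The square of the midpoint of the two norms lies strictly between |J(H)| =
      |J(f)|^2 and sup H = |f|^2.\<close>
    define c where "c = ((nrm B (J f) + nrm A f) / 2)\<^sup>2"
    have JH: "nrm B (J H) < c"
      unfolding J_star[OF f, unfolded H, symmetric] c_def
      by (rule power_strict_mono) (use less B.nrm_nonneg[OF Jc[OF f]] in auto)
    have c0: "c > 0" using JH B.nrm_nonneg[OF Jc[OF Hc]] by linarith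
    obtain x0 where x0: "h x0 > c"
    proof -
      have "(nrm B (J f) + nrm A f) / 2 < nrm A f" using less by simp
      then obtain x0 where "(nrm B (J f) + nrm A f) / 2 < cmod (f x0)"
        using nrm_le[of f "(nrm B (J f) + nrm A f) / 2"] unfolding fun_cstar_simps
        by (meson not_le)
      then have "c < (cmod (f x0))\<^sup>2"
        unfolding c_def using less B.nrm_nonneg[OF Jc[OF f]] by (intro power_strict_mono) auto
      then show ?thesis using that by (simp add: h_def)
    qed
    define g where "g x = max 0 (h x - c)" for x
    define G where "G x = complex_of_real (g x)" for x
    have gc: "continuous_on UNIV g" unfolding g_def by (intro continuous_intros hc)
    have Gc: "continuous_on UNIV G" unfolding G_def by (intro continuous_intros gc)
    \<comment> \<open>The quotient g / h^n. Replacing \<open>h\<close> by its maximum with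
      \<open>c\<close> changes nothing where \<open>g\<close> is nonzero, and makes the quotient
      continuous with denominator at least c^n.\<close>
    define q where "q n x = complex_of_real (g x / max (h x) c ^ n)" for n x
    have qc: "continuous_on UNIV (q n)" for n
      unfolding q_def using c0 by (intro continuous_intros gc hc) (auto simp: max_def)
    have Gq: "G = (\<lambda>x. H x ^ n * q n x)" for n
    proof
      fix x
      show "G x = H x ^ n * q n x"
      proof (cases "h x \<le> c")
        case False
        then have "max (h x) c = h x" "h x \<noteq> 0" using c0 by auto
        then show ?thesis by (simp add: G_def H_def q_def)
      qed (simp add: G_def H_def q_def g_def)
    qed
    have q_le: "nrm A (q n) \<le> nrm A G / c ^ n" for n
      unfolding fun_cstar_simps
    proof (rule nrm_le)
      fix x
      have "\<bar>g x / max (h x) c ^ n\<bar> \<le> \<bar>g x\<bar> / c ^ n"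
        unfolding abs_divide using c0
        by (intro divide_left_mono) (auto simp: power_abs intro!: power_mono mult_pos_pos)
      also have "\<bar>g x\<bar> = cmod (G x)" by (simp add: G_def)
      also have "cmod (G x) \<le> (SUP x. cmod (G x))" using cmod_le_nrm[of G] Gc by simp
      finally show "cmod (q n x) \<le> (SUP x. cmod (G x)) / c ^ n"
        using c0 unfolding q_def norm_of_real by (simp add: divide_right_mono)
    qed
    have J_pow: "nrm B (J (\<lambda>x. H x ^ n * k x)) \<le> nrm B (J H) ^ n * nrm B (J k)"
      if k: "continuous_on UNIV k" for n k
    proof (induction n)
      case (Suc n)
      have c: "continuous_on UNIV (\<lambda>x. H x ^ n * k x)" by (intro continuous_intros Hc k)
      have "J (\<lambda>x. H x ^ Suc n * k x) = J H \<otimes>\<^bsub>B\<^esub> J (\<lambda>x. H x ^ n * k x)"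
        using J_mult[OF Hc c] by (simp add: mult.assoc)
      then have "nrm B (J (\<lambda>x. H x ^ Suc n * k x)) \<le> nrm B (J H) * nrm B (J (\<lambda>x. H x ^ n * k x))"
        using B.nrm_mult[OF Jc[OF Hc] Jc[OF c]] by simp
      also have "\<dots> \<le> nrm B (J H) * (nrm B (J H) ^ n * nrm B (J k))"
        by (intro mult_left_mono Suc B.nrm_nonneg Jc Hc)
      finally show ?case by (simp add: mult.assoc)
    qed simp
    have bound: "nrm B (J G) \<le> (nrm B (J H) / c) ^ n * nrm A G" for n
    proof -
      have "nrm B (J G) \<le> nrm B (J H) ^ n * nrm B (J (q n))"
        using J_pow[OF qc, of n n] by (subst Gq[of n])
      also have "\<dots> \<le> nrm B (J H) ^ n * (nrm A G / c ^ n)"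
        using contr[OF qc, of n] q_le[of n]
        by (intro mult_left_mono zero_le_power B.nrm_nonneg Jc Hc) simp
      finally show ?thesis by (simp add: power_divide)
    qed
    have "(\<lambda>n. (nrm B (J H) / c) ^ n * nrm A G) \<longlonglongrightarrow> 0 * nrm A G"
      using JH c0 B.nrm_nonneg[OF Jc[OF Hc]] by (intro tendsto_intros LIMSEQ_power_zero) simp
    then have "nrm B (J G) \<le> 0"
      by (intro LIMSEQ_le_const[of _ 0]) (use bound in auto)
    then have "J G = \<zero>\<^bsub>B\<^esub>"
      using B.nrm_nonneg[OF Jc[OF Gc]] B.nrm_eq_0_iff[OF Jc[OF Gc]] by simp
    also have "\<dots> = J (\<lambda>x. 0 * G x)"
      using linear_mapsD(3)[OF JL, of G 0] Gc B.smult_0[OF Jc[OF Gc]] by simp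
    finally have "J G = J (\<lambda>x. 0)" by simp
    then have "G = (\<lambda>x. 0)" by (rule inj_onD[OF inj]) (use Gc in simp_all)
    then have "G x0 = 0" by simp
    then show False using x0 by (simp add: G_def g_def)
  qed
  then show ?thesis using contr[OF f] by simp
qed

section \<open>Projections of norm one are module maps\<close>

text \<open>The numerical end of the amplification argument in \<open>E_local\<close>. Passing to
  the supremum M absorbs the shift of the index and leaves (1 + 2 t) M <= c for every t >= 0, which
  only M = 0 satisfies.\<close>

lemma sum_sq_bound_imp_zero:
  fixes N :: "nat \<Rightarrow> real"
  assumes N0: "\<And>n. 0 \<le> N n" and bd: "\<And>n. N n \<le> K"
    and le: "\<And>n t. t \<ge> 0 \<Longrightarrow> (1 + t)\<^sup>2 * N n \<le> c + t\<^sup>2 * N (Suc n)"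
  shows "N n = 0"
proof -
  define M where "M = (SUP n. N n)"
  have bdd: "bdd_above (range N)" using bd by (auto simp: bdd_above_def)
  have NM: "N n \<le> M" for n unfolding M_def by (intro cSUP_upper bdd) simp
  have M0: "M \<ge> 0" using NM[of 0] N0[of 0] by simp
  have "(1 + 2 * t) * M \<le> c" if t: "t \<ge> 0" for t
  proof -
    have "N n \<le> (c + t\<^sup>2 * M) / (1 + t)\<^sup>2" for n
    proof -
      have "(1 + t)\<^sup>2 * N n \<le> c + t\<^sup>2 * M"
        using le[OF t, of n] NM[of "Suc n"] by (smt (verit) mult_left_mono zero_le_power2)
      then show ?thesis using t by (simp add: pos_le_divide_eq mult.commute)
    qed
    then have "M \<le> (c + t\<^sup>2 * M) / (1 + t)\<^sup>2" unfolding M_def by (intro cSUP_least) auto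
    then have "M * (1 + t)\<^sup>2 \<le> c + t\<^sup>2 * M" using t by (simp add: pos_le_divide_eq)
    then show ?thesis by (simp add: power2_eq_square algebra_simps)
  qed
  \<comment> \<open>For M > 0 this t gives 2 t M = |c| + 1, more than the bound c allows.\<close>
  from this[of "(\<bar>c\<bar> + 1) / (2 * M)"] M0 have "M = 0"
    by (cases "M = 0") (auto simp: field_simps split: abs_split)
  then show ?thesis using NM[of n] N0[of n] by simp
qed

locale norm_one_projection = unital_cstar_algebra B for B :: "('b, 'm) cstar_scheme" (structure) +
  fixes E :: "'b \<Rightarrow> 'b"
  assumes E_linear: "E \<in> linear_maps B B"
    and E_contr: "x \<in> carrier B \<Longrightarrow> nrm B (E x) \<le> nrm B x"
    and E_idem: "x \<in> carrier B \<Longrightarrow> E (E x) = E x"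
    and E_range_mult: "\<lbrakk>x \<in> carrier B; y \<in> carrier B\<rbrakk> \<Longrightarrow> E (E x \<otimes> E y) = E x \<otimes> E y"
begin

lemma E_closed [simp, intro]: "x \<in> carrier B \<Longrightarrow> E x \<in> carrier B"
  by (rule linear_mapsD(1)[OF E_linear])

lemma E_add: "\<lbrakk>x \<in> carrier B; y \<in> carrier B\<rbrakk> \<Longrightarrow> E (x \<oplus> y) = E x \<oplus> E y"
  by (rule linear_mapsD(2)[OF E_linear])

lemma E_smult: "x \<in> carrier B \<Longrightarrow> E (c \<odot> x) = c \<odot> E x"
  by (rule linear_mapsD(3)[OF E_linear])

lemma E_diff: "\<lbrakk>x \<in> carrier B; y \<in> carrier B\<rbrakk> \<Longrightarrow> E (x \<ominus> y) = E x \<ominus> E y"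
  by (simp add: diff_eq_smult E_add E_smult)

text \<open>
  Amplifying the component of \<^term>\<open>E (f \<otimes> x)\<close> that \<^term>\<open>h\<close> cuts out multiplies its norm
  by \<open>1 + t\<close>, whereas by orthogonality the argument of \<^term>\<open>E\<close> only grows in the mean square.
\<close>

lemma E_local:
  assumes h: "\<And>n::nat. h n \<in> carrier B" "\<And>n. nrm B (h n) \<le> 1" "\<And>n. h n \<otimes> h (Suc n) = h n"
    and h_range: "\<And>n y. y \<in> carrier B \<Longrightarrow> E (h n \<otimes> E y) = h n \<otimes> E y"
    and f: "f \<in> carrier B" "\<And>n. adj B f \<otimes> h n = \<zero>" and x: "x \<in> carrier B"
  shows "h 0 \<otimes> E (f \<otimes> x) = \<zero>"
proof -
  define u where "u = E (f \<otimes> x)"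
  have u: "u \<in> carrier B" unfolding u_def using f x by simp
  define N where "N n = (nrm B (h n \<otimes> u))\<^sup>2" for n
  have hu: "h n \<otimes> u \<in> carrier B" for n using h u by simp
  have "N n = 0" for n
  proof (rule sum_sq_bound_imp_zero)
    show "N n \<le> (nrm B u)\<^sup>2" for n
    proof -
      have "nrm B (h n \<otimes> u) \<le> 1 * nrm B u"
        by (rule order.trans[OF nrm_mult[OF h(1) u]], rule mult_right_mono[OF h(2)])
          (rule nrm_nonneg[OF u])
      then show ?thesis unfolding N_def using nrm_nonneg[OF hu] by (intro power_mono) simp_all
    qed
    fix n and t :: real assume t: "t \<ge> 0"
    \<comment> \<open>By \<open>h_range\<close>, \<open>E\<close> fixes \<open>z\<close>, so it maps
      f x + z to u + z. Cutting with \<open>h n\<close>, which absorbs \<open>h (Suc n)\<close>,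
      leaves (1 + t) times \<open>h n \<otimes> u\<close>.\<close>
    define z where "z = complex_of_real t \<odot> (h (Suc n) \<otimes> u)"
    have z: "z \<in> carrier B" unfolding z_def using hu by simp
    have fx: "f \<otimes> x \<in> carrier B" using f x by simp
    have "E (h (Suc n) \<otimes> u) = h (Suc n) \<otimes> u" unfolding u_def by (rule h_range[OF fx])
    then have "E z = z" unfolding z_def E_smult[OF hu] by simp
    then have Ez: "E (f \<otimes> x \<oplus> z) = u \<oplus> z" using fx z by (simp add: E_add u_def)
    have "h n \<otimes> (u \<oplus> z) = h n \<otimes> u \<oplus> complex_of_real t \<odot> (h n \<otimes> (h (Suc n) \<otimes> u))"
      unfolding z_def using h(1) u hu by (simp add: r_distr smult_mult_right)
    also have "h n \<otimes> (h (Suc n) \<otimes> u) = h n \<otimes> u"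
      using h(1,3) u by (simp flip: m_assoc)
    also have "h n \<otimes> u \<oplus> complex_of_real t \<odot> (h n \<otimes> u) = complex_of_real (1 + t) \<odot> (h n \<otimes> u)"
      using hu by (simp add: smult_add_left smult_1)
    finally have "(1 + t) * nrm B (h n \<otimes> u) = nrm B (h n \<otimes> E (f \<otimes> x \<oplus> z))"
      using t unfolding Ez by (simp only: nrm_smult[OF hu] norm_of_real)
    also have "\<dots> \<le> nrm B (h n) * nrm B (E (f \<otimes> x \<oplus> z))"
      using h fx z by (intro nrm_mult) simp_all
    also have "\<dots> \<le> 1 * nrm B (f \<otimes> x \<oplus> z)"
      using h fx z by (intro mult_mono E_contr nrm_nonneg) simp_all
    finally have "((1 + t) * nrm B (h n \<otimes> u))\<^sup>2 \<le> (nrm B (f \<otimes> x \<oplus> z))\<^sup>2"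
      using t nrm_nonneg[OF hu] by (intro power_mono) simp_all
    also have "\<dots> \<le> (nrm B (f \<otimes> x))\<^sup>2 + (nrm B z)\<^sup>2"
    proof (rule nrm_add_orthogonal[OF fx z])
      have "adj B (f \<otimes> x) \<otimes> (h (Suc n) \<otimes> u) = adj B x \<otimes> (adj B f \<otimes> h (Suc n)) \<otimes> u"
        using f(1) x h(1) u adj_closed by (simp add: adj_mult m_assoc)
      also have "\<dots> = \<zero>" using f(2) x u adj_closed by simp
      finally show "adj B (f \<otimes> x) \<otimes> z = \<zero>"
        unfolding z_def using fx hu adj_closed by (simp add: smult_mult_right)
    qed
    also have "(nrm B z)\<^sup>2 = t\<^sup>2 * N (Suc n)"
      unfolding z_def N_def using hu by (simp add: nrm_smult power_mult_distrib)
    finally show "(1 + t)\<^sup>2 * N n \<le> (nrm B (f \<otimes> x))\<^sup>2 + t\<^sup>2 * N (Suc n)"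
      by (simp add: N_def power_mult_distrib)
  qed (simp add: N_def)
  then have "nrm B (h 0 \<otimes> u) = 0" by (simp add: N_def)
  then show ?thesis using nrm_eq_0_iff[OF hu] by (simp add: u_def)
qed

end

text \<open>Entered twice: for \<open>F\<close> and \<open>i\<close> of a dilation, and for the
  conjugate of \<open>E\<close> by the adjoint, which yields the right module property.\<close>

locale projection_onto_functions = norm_one_projection B E
  for B :: "('b, 'm) cstar_scheme" (structure) and E +
  fixes J :: "('x::topological_space \<Rightarrow> complex) \<Rightarrow> 'b"
  assumes X: "compact (UNIV :: 'x set)"
    and J_hom: "J \<in> cstar_hom C_alg B"
    and E_J: "continuous_on UNIV a \<Longrightarrow> E (J a) = J a"
begin

interpretation C: function_algebra "UNIV :: 'x set" "{f. continuous_on UNIV f}"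
  by (rule function_algebra_continuous[OF X])

lemma J_linear: "J \<in> linear_maps C_alg B"
  using J_hom by (simp add: cstar_hom_def)

lemma J_closed: "continuous_on UNIV a \<Longrightarrow> J a \<in> carrier B"
  using linear_mapsD(1)[OF J_linear] by (simp add: C_alg_eq)

lemma J_add: "\<lbrakk>continuous_on UNIV a; continuous_on UNIV b\<rbrakk> \<Longrightarrow> J (\<lambda>x. a x + b x) = J a \<oplus> J b"
  using linear_mapsD(2)[OF J_linear] by (simp add: C_alg_eq)

lemma J_smult: "continuous_on UNIV a \<Longrightarrow> J (\<lambda>x. c * a x) = c \<odot> J a"
  using linear_mapsD(3)[OF J_linear] by (simp add: C_alg_eq)

text \<open>Real functions carry the argument, since they can be truncated with max and min and have
  self-adjoint images.\<close>

definition JR :: "('x \<Rightarrow> real) \<Rightarrow> 'b"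
  where "JR b = J (\<lambda>x. complex_of_real (b x))"

lemma JR_closed [simp, intro]: "continuous_on UNIV b \<Longrightarrow> JR b \<in> carrier B"
  unfolding JR_def by (intro J_closed continuous_intros)

lemma JR_mult:
  "\<lbrakk>continuous_on UNIV a; continuous_on UNIV b\<rbrakk> \<Longrightarrow> JR a \<otimes> JR b = JR (\<lambda>x. a x * b x)"
  using J_hom by (simp add: JR_def cstar_hom_def C_alg_eq continuous_on_of_real)

lemma JR_adj:
  assumes "continuous_on UNIV b"
  shows "adj B (JR b) = JR b"
proof -
  have "adj B (J a) = J (\<lambda>x. cnj (a x))" if "continuous_on UNIV a" for a
    using J_hom that by (simp add: cstar_hom_def C_alg_eq)
  from this[of "\<lambda>x. of_real (b x)"] show ?thesis
    using assms by (simp add: JR_def continuous_on_of_real)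
qed

lemma JR_add:
  "\<lbrakk>continuous_on UNIV a; continuous_on UNIV b\<rbrakk> \<Longrightarrow> JR (\<lambda>x. a x + b x) = JR a \<oplus> JR b"
  by (simp add: JR_def J_add continuous_on_of_real)

lemma JR_smult: "continuous_on UNIV b \<Longrightarrow> JR (\<lambda>x. c * b x) = complex_of_real c \<odot> JR b"
  by (simp add: JR_def J_smult continuous_on_of_real)

lemma JR_diff:
  "\<lbrakk>continuous_on UNIV a; continuous_on UNIV b\<rbrakk> \<Longrightarrow> JR (\<lambda>x. a x - b x) = JR a \<ominus> JR b"
  using JR_add[of a "\<lambda>x. (-1) * b x"] JR_smult[of b "-1"]
  by (simp add: diff_eq_smult continuous_on_minus)

lemma JR_zero [simp]: "JR (\<lambda>x. 0) = \<zero>"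
  using JR_smult[of "\<lambda>x. 0" 0] by (simp add: smult_0)

lemma JR_nrm:
  assumes "continuous_on UNIV b" "\<And>x. \<bar>b x\<bar> \<le> c"
  shows "nrm B (JR b) \<le> c"
proof -
  have "nrm B (JR b) \<le> (SUP x. cmod (complex_of_real (b x)))"
    using C.hom_contractive[OF unital_cstar_algebra_axioms, of J "\<lambda>x. of_real (b x)"] J_hom assms(1)
    by (simp add: JR_def C_alg_eq continuous_on_of_real)
  also have "\<dots> \<le> c" by (intro C.nrm_le) (simp add: assms)
  finally show ?thesis .
qed

lemma E_JR: "continuous_on UNIV b \<Longrightarrow> E (JR b) = JR b"
  unfolding JR_def by (intro E_J continuous_intros)

lemma E_JR_mult: "\<lbrakk>continuous_on UNIV b; y \<in> carrier B\<rbrakk> \<Longrightarrow> E (JR b \<otimes> E y) = JR b \<otimes> E y"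
  using E_range_mult[of "JR b" y] by (simp add: E_JR)

text \<open>\<open>E_local\<close> applies to cut-offs \<open>h m\<close> of \<open>g\<close>, which
  live where \<open>g\<close> exceeds a threshold and hence where \<open>f\<close> vanishes. As the
  threshold tends to 0, g h_m tends uniformly to g.\<close>

lemma E_JR_zero:
  assumes f: "continuous_on UNIV f" and g: "continuous_on UNIV g" "\<And>x. 0 \<le> g x"
    and fg: "\<And>x. f x * g x = 0" and x: "x \<in> carrier B"
  shows "JR g \<otimes> E (JR f \<otimes> x) = \<zero>"
proof -
  define u where "u = E (JR f \<otimes> x)"
  have u: "u \<in> carrier B" unfolding u_def using f x by simp
  \<comment> \<open>A ramp in the value of \<open>g\<close>, from 0 at 2^-m to 1 at twice that
    value. As the threshold is halved at each step, \<open>h (Suc m)\<close> is 1 wherever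
    \<open>h m\<close> is nonzero.\<close>
  define h where "h m y = max 0 (min 1 (2 ^ m * g y - 1))" for m :: nat and y
  have hc: "continuous_on UNIV (h m)" for m unfolding h_def by (intro continuous_intros g)
  have h0: "JR (h m) \<otimes> u = \<zero>" for m
  proof -
    have "JR (h (0 + m)) \<otimes> E (JR f \<otimes> x) = \<zero>"
    \<comment> \<open>\<open>E_local\<close> concludes for index 0; starting the chain at
      \<open>m\<close> makes that the cut-off \<open>h m\<close>.\<close>
    proof (rule E_local[where h = "\<lambda>n. JR (h (n + m))"])
      show "nrm B (JR (h (n + m))) \<le> 1" for n by (intro JR_nrm hc) (auto simp: h_def)
      have hh: "h k y * h (Suc k) y = h k y" for k y
      proof (cases "2 ^ k * g y \<le> 1")
        case False
        then have "2 ^ Suc k * g y - 1 \<ge> 1" by simp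
        then show ?thesis by (simp add: h_def)
      qed (simp add: h_def)
      show "JR (h (n + m)) \<otimes> JR (h (Suc n + m)) = JR (h (n + m))" for n
        unfolding add_Suc JR_mult[OF hc hc] hh ..
      have fh: "f y * h k y = 0" for y k using fg[of y] by (auto simp: h_def)
      show "adj B (JR f) \<otimes> JR (h (n + m)) = \<zero>" for n
        unfolding JR_adj[OF f] JR_mult[OF f hc] fh by (rule JR_zero)
    qed (use f x hc E_JR_mult in auto)
    then show ?thesis by (simp add: u_def)
  qed
  have bound: "nrm B (JR g \<otimes> u) \<le> 2 * (1/2) ^ m * nrm B u" for m
  proof -
    have "JR g \<otimes> JR (h m) \<otimes> u = \<zero>" using g hc u by (simp add: m_assoc h0)
    then have "JR g \<otimes> u = (JR g \<ominus> JR (\<lambda>y. g y * h m y)) \<otimes> u"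
      using g hc u by (simp add: JR_mult diff_mult_distrib continuous_on_mult)
    also have "JR g \<ominus> JR (\<lambda>y. g y * h m y) = JR (\<lambda>y. g y - g y * h m y)"
      using g hc by (intro JR_diff[symmetric] continuous_intros)
    finally have "nrm B (JR g \<otimes> u) \<le> nrm B (JR (\<lambda>y. g y - g y * h m y)) * nrm B u"
      using g hc u by (auto intro!: nrm_mult JR_closed continuous_intros)
    also have "\<dots> \<le> 2 * (1/2) ^ m * nrm B u"
    proof (intro mult_right_mono JR_nrm continuous_intros g hc nrm_nonneg u)
      \<comment> \<open>Up to the value where the ramp reaches 1 the error is at most
        \<open>g y\<close> itself; beyond it \<open>h m y\<close> is 1 and there is no
        error.\<close>
      show "\<bar>g y - g y * h m y\<bar> \<le> 2 * (1/2) ^ m" for y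
      proof (cases "2 ^ m * g y \<le> 2")
        case True
        have "\<bar>g y - g y * h m y\<bar> = g y * (1 - h m y)"
        proof -
          have "g y - g y * h m y = g y * (1 - h m y)" by (simp add: right_diff_distrib)
          moreover have "h m y \<le> 1" by (simp add: h_def)
          ultimately show ?thesis using g(2)[of y] by (simp add: abs_mult)
        qed
        also have "\<dots> \<le> g y * 1" using g(2)[of y] by (intro mult_left_mono) (auto simp: h_def)
        also have "g y \<le> 2 * (1/2) ^ m" using True by (simp add: field_simps)
        finally show ?thesis by simp
      next
        case False
        then have "h m y = 1" by (simp add: h_def)
        then show ?thesis by simp
      qed
    qed
    finally show ?thesis .
  qed
  have "(\<lambda>m. 2 * (1/2) ^ m * nrm B u) \<longlonglongrightarrow> 2 * 0 * nrm B u"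
    by (intro tendsto_intros LIMSEQ_power_zero) simp
  then have "nrm B (JR g \<otimes> u) \<le> 0" by (intro LIMSEQ_le_const[of _ 0]) (use bound in auto)
  moreover have gu: "JR g \<otimes> u \<in> carrier B" using g u by simp
  ultimately have "JR g \<otimes> u = \<zero>" using nrm_nonneg[OF gu] nrm_eq_0_iff[OF gu] by simp
  then show ?thesis by (simp add: u_def)
qed

abbreviation p :: 'b where "p \<equiv> JR (\<lambda>x. 1)"

lemma p_closed: "p \<in> carrier B"
  by (rule JR_closed) simp

lemma p_mult: "continuous_on UNIV b \<Longrightarrow> p \<otimes> JR b = JR b"
  using JR_mult[of "\<lambda>x. 1" b] by simp

text \<open>The module property for constants, which is not automatic because p = J(1) may differ
  from the unit of \<open>B\<close>. The projections p and 1 - p are orthogonal, so each can serve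
  as a constant chain in \<open>E_local\<close> against the other; this removes the off-diagonal
  corners of \<open>E\<close>.\<close>

lemma E_p_mult:
  assumes x: "x \<in> carrier B"
  shows "E (p \<otimes> x) = p \<otimes> E x" "p \<otimes> E (p \<otimes> x) = E (p \<otimes> x)"
proof -
  define q where "q = \<one> \<ominus> p"
  have q: "q \<in> carrier B" unfolding q_def using p_closed by simp
  have pp: "p \<otimes> p = p" by (rule p_mult) simp
  have pa: "adj B p = p" by (rule JR_adj) simp
  have one_a: "adj B \<one> = \<one>"
    by (metis adj_adj adj_closed adj_mult l_one one_closed r_one)
  have qa: "adj B q = q" unfolding q_def using p_closed pa one_a by (simp add: adj_diff)
  have qp: "q \<otimes> p = \<zero>" "p \<otimes> q = \<zero>" "q \<otimes> q = q"
    unfolding q_def using p_closed pp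
    by (simp_all add: diff_mult_distrib mult_diff_distrib diff_eq_zero_iff)
  have qn: "nrm B q \<le> 1"
  proof -
    have "(nrm B q)\<^sup>2 = nrm B q" using cstar_identity[OF q] qa qp by simp
    then have "nrm B q = 0 \<or> nrm B q = 1" by (simp add: power2_eq_square)
    then show ?thesis by linarith
  qed
  have pn: "nrm B p \<le> 1" by (rule JR_nrm) simp_all
  have Ep: "E (p \<otimes> E y) = p \<otimes> E y" if "y \<in> carrier B" for y
    by (rule E_JR_mult) (use that in simp_all)
  have Eq: "E (q \<otimes> E y) = q \<otimes> E y" if "y \<in> carrier B" for y
  proof -
    have "q \<otimes> E y = E y \<ominus> p \<otimes> E y"
      unfolding q_def using p_closed that by (simp add: diff_mult_distrib)
    then show ?thesis using that p_closed by (simp add: E_diff E_idem Ep)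
  qed
  have 1: "p \<otimes> E (q \<otimes> x) = \<zero>"
    by (rule E_local[where h = "\<lambda>n. p"]) (use p_closed pn pp Ep q qp qa x in auto)
  have 2: "q \<otimes> E (p \<otimes> x) = \<zero>"
    by (rule E_local[where h = "\<lambda>n. q"]) (use p_closed qn qp Eq q pa x in auto)
  have Epx: "E (p \<otimes> x) \<in> carrier B" using p_closed x by simp
  have "q \<otimes> E (p \<otimes> x) = E (p \<otimes> x) \<ominus> p \<otimes> E (p \<otimes> x)"
    unfolding q_def using p_closed Epx by (simp add: diff_mult_distrib)
  then show 3: "p \<otimes> E (p \<otimes> x) = E (p \<otimes> x)"
    using 2 p_closed Epx diff_eq_zero_iff[of "E (p \<otimes> x)" "p \<otimes> E (p \<otimes> x)"] by simp
  have "q \<otimes> x = x \<ominus> p \<otimes> x"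
    unfolding q_def using p_closed x by (simp add: diff_mult_distrib)
  then have "E (q \<otimes> x) = E x \<ominus> E (p \<otimes> x)" using p_closed x by (simp add: E_diff)
  then have "p \<otimes> E x \<ominus> p \<otimes> E (p \<otimes> x) = \<zero>"
    using 1 p_closed Epx x by (simp add: mult_diff_distrib)
  then show "E (p \<otimes> x) = p \<otimes> E x"
    using 3 p_closed Epx x by (simp add: diff_eq_zero_iff)
qed

text \<open>Replace b by b' = max(0, b - d). The function c = min(1, b / d) is 1 where b' is nonzero
  and 0 where a is nonzero, so \<open>E_JR_zero\<close> gives E(b' x) = c E(b' x) and c E(a x) = 0.
  The product with b' in place of b is then exactly zero, and the error is of order d.\<close>

lemma adj_E_mult_E_zero:
  assumes a: "continuous_on UNIV a" and b: "continuous_on UNIV b" "\<And>x. 0 \<le> b x"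
    and ab: "\<And>x. a x * b x = 0" and x: "x \<in> carrier B"
  shows "adj B (E (JR a \<otimes> x)) \<otimes> E (JR b \<otimes> x) = \<zero>"
proof (rule zero_if_nrm_small)
  define u where "u = adj B (E (JR a \<otimes> x))"
  have u: "u \<in> carrier B" unfolding u_def using a x by (simp add: adj_closed)
  show "u \<otimes> E (JR b \<otimes> x) \<in> carrier B" using u b x by simp
  fix e :: real assume "e > 0"
  define d where "d = e / (nrm B u * nrm B x + 1)"
  have "nrm B u * nrm B x \<ge> 0" using u x by (simp add: nrm_nonneg)
  then have d: "d > 0" "nrm B u * nrm B x * d \<le> e"
    using \<open>e > 0\<close> by (auto simp: d_def field_simps add_nonneg_pos)
  define b' where "b' y = max 0 (b y - d)" for y
  define c where "c y = min 1 (b y / d)" for y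
  have b'c: "continuous_on UNIV b'" unfolding b'_def by (intro continuous_intros b)
  have cc: "continuous_on UNIV c" unfolding c_def by (intro continuous_intros b) (use d in auto)
  define v where "v = E (JR b' \<otimes> x)"
  have v: "v \<in> carrier B" unfolding v_def using b'c x by simp
  have "JR (\<lambda>y. 1 - c y) \<otimes> v = \<zero>"
    unfolding v_def
  proof (rule E_JR_zero[OF b'c _ _ _ x])
    show "b' y * (1 - c y) = 0" for y
      using d by (cases "b y \<le> d") (auto simp: b'_def c_def)
  qed (use b d in \<open>auto intro!: continuous_intros cc simp: c_def\<close>)
  moreover have "JR (\<lambda>y. 1 - c y) = p \<ominus> JR c" by (rule JR_diff) (simp_all add: cc)
  ultimately have "p \<otimes> v \<ominus> JR c \<otimes> v = \<zero>"
    using p_closed cc v by (simp add: diff_mult_distrib)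
  then have "p \<otimes> v = JR c \<otimes> v" using p_closed cc v by (simp add: diff_eq_zero_iff)
  \<comment> \<open>Since J(1 - c) is p - J(c) and not 1 - J(c), the identity obtained so far only
    says p v = J(c) v.\<close>
  moreover have "p \<otimes> v = v"
    using E_p_mult(2)[of "JR b' \<otimes> x"] b'c x p_closed p_mult[OF b'c]
    by (simp add: v_def flip: m_assoc)
  ultimately have v_eq: "v = JR c \<otimes> v" by simp
  have "JR c \<otimes> E (JR a \<otimes> x) = \<zero>"
  proof (rule E_JR_zero[OF a cc _ _ x])
    show "0 \<le> c y" for y using b(2)[of y] d by (simp add: c_def)
    show "a y * c y = 0" for y using ab[of y] by (auto simp: c_def)
  qed
  then have "adj B (JR c \<otimes> E (JR a \<otimes> x)) = \<zero>" by simp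
  then have "u \<otimes> JR c = \<zero>" unfolding u_def using a x cc by (simp add: adj_mult JR_adj)
  then have uv: "u \<otimes> v = \<zero>" using u v cc by (subst v_eq) (simp flip: m_assoc)
  have "E (JR b \<otimes> x) \<ominus> v = E (JR (\<lambda>y. b y - b' y) \<otimes> x)"
    unfolding v_def using b b'c x by (simp add: JR_diff diff_mult_distrib E_diff)
  then have "nrm B (E (JR b \<otimes> x) \<ominus> v) \<le> nrm B (JR (\<lambda>y. b y - b' y) \<otimes> x)"
    using E_contr[of "JR (\<lambda>y. b y - b' y) \<otimes> x"] x b b'c by (auto simp: continuous_on_diff)
  also have "\<dots> \<le> nrm B (JR (\<lambda>y. b y - b' y)) * nrm B x"
    using b b'c x by (intro nrm_mult JR_closed continuous_intros)
  also have "\<dots> \<le> d * nrm B x"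
  proof (intro mult_right_mono JR_nrm continuous_intros b b'c nrm_nonneg x)
    show "\<bar>b y - b' y\<bar> \<le> d" for y using b(2)[of y] d by (simp add: b'_def)
  qed
  finally have dist: "nrm B (E (JR b \<otimes> x) \<ominus> v) \<le> d * nrm B x" .
  have "u \<otimes> E (JR b \<otimes> x) = u \<otimes> (E (JR b \<otimes> x) \<ominus> v)"
    using u v uv b x by (simp add: mult_diff_distrib)
  then have "nrm B (u \<otimes> E (JR b \<otimes> x)) \<le> nrm B u * nrm B (E (JR b \<otimes> x) \<ominus> v)"
    using nrm_mult[of u "E (JR b \<otimes> x) \<ominus> v"] u v b x by simp
  also have "\<dots> \<le> nrm B u * (d * nrm B x)" by (intro mult_left_mono dist nrm_nonneg u)
  also have "\<dots> \<le> e" using d(2) by (simp add: mult_ac)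
  finally show "nrm B (u \<otimes> E (JR b \<otimes> x)) \<le> e" .
qed

text \<open>Measures the failure of the left module property. It is additive in \<open>b\<close> and
  zero on constants, so what matters is the oscillation of \<open>b\<close> and not its
  size.\<close>

definition defect :: "('x \<Rightarrow> real) \<Rightarrow> 'b \<Rightarrow> 'b"
  where "defect b x = JR b \<otimes> E x \<ominus> E (JR b \<otimes> x)"

lemma defect_closed: "\<lbrakk>continuous_on UNIV b; x \<in> carrier B\<rbrakk> \<Longrightarrow> defect b x \<in> carrier B"
  by (simp add: defect_def)

lemma defect_diff:
  assumes "continuous_on UNIV a" "continuous_on UNIV b" "x \<in> carrier B"
  shows "defect (\<lambda>y. a y - b y) x = defect a x \<ominus> defect b x"
proof -
  have c: "JR a \<otimes> E x \<in> carrier B" "JR b \<otimes> E x \<in> carrier B"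
    "E (JR a \<otimes> x) \<in> carrier B" "E (JR b \<otimes> x) \<in> carrier B"
    using assms by simp_all
  have "defect (\<lambda>y. a y - b y) x
      = (JR a \<otimes> E x \<ominus> JR b \<otimes> E x) \<ominus> (E (JR a \<otimes> x) \<ominus> E (JR b \<otimes> x))"
    using assms by (simp add: defect_def JR_diff diff_mult_distrib E_diff)
  also have "\<dots> = defect a x \<ominus> defect b x"
    unfolding defect_def using c by algebra
  finally show ?thesis .
qed

lemma defect_const: "x \<in> carrier B \<Longrightarrow> defect (\<lambda>y. c) x = \<zero>"
  using JR_smult[of "\<lambda>x. 1" c] p_closed
  by (simp add: defect_def smult_mult_left E_smult E_p_mult)

lemma defect_nrm:
  assumes b: "continuous_on UNIV b" "\<And>y. \<bar>b y\<bar> \<le> d" and x: "x \<in> carrier B"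
  shows "nrm B (defect b x) \<le> 2 * d * nrm B x"
proof -
  \<comment> \<open>Types are inhabited, so any point, here \<open>undefined\<close>, shows that the
    bound is nonnegative.\<close>
  have d: "d \<ge> 0" using order.trans[OF abs_ge_zero b(2)[of undefined]] .
  have Jb: "nrm B (JR b \<otimes> y) \<le> d * nrm B y" if "y \<in> carrier B" for y
    using nrm_mult[OF JR_closed[OF b(1)] that] mult_right_mono[OF JR_nrm[OF b] nrm_nonneg[OF that]]
    by (rule order.trans)
  have "nrm B (defect b x) \<le> nrm B (JR b \<otimes> E x) + nrm B (E (JR b \<otimes> x))"
    unfolding defect_def using b x by (intro nrm_diff_le) simp_all
  also have "\<dots> \<le> d * nrm B x + d * nrm B x"
  proof (rule add_mono)
    show "nrm B (JR b \<otimes> E x) \<le> d * nrm B x"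
      using Jb[of "E x"] x mult_left_mono[OF E_contr[OF x] d] by simp
    show "nrm B (E (JR b \<otimes> x)) \<le> d * nrm B x"
      using E_contr[of "JR b \<otimes> x"] Jb[OF x] b x by simp
  qed
  finally show ?thesis by simp
qed

text \<open>Expanding the product gives four terms. One vanishes by a b = 0, two by
  \<open>E_JR_zero\<close> (with the roles of a and b exchanged), and the one with two values of
  \<open>E\<close> by \<open>adj_E_mult_E_zero\<close>.\<close>

lemma defect_orthogonal:
  assumes a: "continuous_on UNIV a" "\<And>x. 0 \<le> a x" and b: "continuous_on UNIV b" "\<And>x. 0 \<le> b x"
    and ab: "\<And>x. a x * b x = 0" and x: "x \<in> carrier B"
  shows "adj B (defect a x) \<otimes> defect b x = \<zero>"
proof -
  have ba: "b y * a y = 0" for y using ab[of y] by (simp add: mult.commute)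
  define v w where "v = E (JR a \<otimes> x)" and "w = E (JR b \<otimes> x)"
  have c: "v \<in> carrier B" "w \<in> carrier B" "E x \<in> carrier B" "adj B (E x) \<in> carrier B"
    "adj B v \<in> carrier B" "JR a \<in> carrier B" "JR b \<in> carrier B"
    unfolding v_def w_def using a b x by (simp_all add: adj_closed)
  have 1: "JR a \<otimes> JR b = \<zero>" unfolding JR_mult[OF a(1) b(1)] ab by (rule JR_zero)
  have 2: "JR a \<otimes> w = \<zero>" unfolding w_def by (rule E_JR_zero[OF b(1) a ba x])
  have "JR b \<otimes> v = \<zero>" unfolding v_def by (rule E_JR_zero[OF a(1) b ab x])
  then have "adj B (JR b \<otimes> v) = \<zero>" by simp
  then have 3: "adj B v \<otimes> JR b = \<zero>" using c by (simp add: adj_mult JR_adj b)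
  have 4: "adj B v \<otimes> w = \<zero>" unfolding v_def w_def by (rule adj_E_mult_E_zero[OF a(1) b ab x])
  have "adj B (defect a x) \<otimes> defect b x
      = (adj B (E x) \<otimes> JR a \<ominus> adj B v) \<otimes> (JR b \<otimes> E x \<ominus> w)"
    using c by (simp add: defect_def adj_diff adj_mult JR_adj a flip: v_def w_def)
  also have "\<dots> = adj B (E x) \<otimes> (JR a \<otimes> JR b) \<otimes> E x \<ominus> adj B (E x) \<otimes> (JR a \<otimes> w)
      \<ominus> ((adj B v \<otimes> JR b) \<otimes> E x \<ominus> adj B v \<otimes> w)"
    using c by algebra
  also have "\<dots> = \<zero>" unfolding 1 2 3 4 using c by simp
  finally show ?thesis .
qed

text \<open>
  Splitting \<^term>\<open>b\<close> at the middle of its range yields two functions with orthogonal defects and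
  half the oscillation, so the crude bound improves by a factor of two for the square.
\<close>

lemma defect_nrm_halving:
  assumes "x \<in> carrier B" "continuous_on UNIV b" "\<And>y. \<bar>b y\<bar> \<le> d"
  shows "(nrm B (defect b x))\<^sup>2 \<le> 4 * d\<^sup>2 * (nrm B x)\<^sup>2 / 2 ^ n"
  using assms(2,3)
proof (induction n arbitrary: b d)
  case 0
  have "(nrm B (defect b x))\<^sup>2 \<le> (2 * d * nrm B x)\<^sup>2"
    using defect_nrm[OF 0 assms(1)] defect_closed[OF 0(1) assms(1)] nrm_nonneg
    by (intro power_mono) auto
  then show ?case by (simp add: power_mult_distrib)
next
  case (Suc n)
  \<comment> \<open>\<open>a 1\<close> and \<open>a (-1)\<close> are the positive and the negative
    part of \<open>b\<close>.\<close>
  define a where "a s y = max 0 (s * b y)" for s y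
  have ac: "continuous_on UNIV (a s)" for s unfolding a_def by (intro continuous_intros Suc.prems)
  have half: "(nrm B (defect (a s) x))\<^sup>2 \<le> 4 * (d/2)\<^sup>2 * (nrm B x)\<^sup>2 / 2 ^ n"
    if s: "s = 1 \<or> s = -1" for s
  proof -
    \<comment> \<open>The part takes values in [0, d]. Subtracting the constant d/2 leaves the
      defect unchanged and halves the bound on the absolute value.\<close>
    have "defect (\<lambda>y. a s y - d/2) x = defect (a s) x"
      using defect_diff[OF ac continuous_on_const assms(1), of s "d/2"]
        defect_closed[OF ac assms(1)] by (simp add: defect_const assms(1))
    moreover have "(nrm B (defect (\<lambda>y. a s y - d/2) x))\<^sup>2 \<le> 4 * (d/2)\<^sup>2 * (nrm B x)\<^sup>2 / 2 ^ n"
    proof (rule Suc.IH)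
      show "\<bar>a s y - d/2\<bar> \<le> d/2" for y
      proof -
        have "0 \<le> a s y" "a s y \<le> d"
          using Suc.prems(2)[of y] s by (auto simp: a_def abs_le_iff max_def)
        then show ?thesis by (intro abs_leI) linarith+
      qed
    qed (intro continuous_intros ac)
    ultimately show ?thesis by simp
  qed
  have "(\<lambda>y. a 1 y - a (-1) y) = b" by (auto simp: a_def max_def)
  then have "defect b x = defect (a 1) x \<ominus> defect (a (-1)) x"
    using defect_diff[OF ac ac assms(1), of 1 "-1"] by simp
  also have "\<dots> = defect (a 1) x \<oplus> (-1) \<odot> defect (a (-1)) x"
    using defect_closed[OF ac assms(1)] by (simp add: diff_eq_smult)
  finally have "(nrm B (defect b x))\<^sup>2
      \<le> (nrm B (defect (a 1) x))\<^sup>2 + (nrm B ((-1) \<odot> defect (a (-1)) x))\<^sup>2"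
  proof (elim ssubst, intro nrm_add_orthogonal)
    have "adj B (defect (a 1) x) \<otimes> defect (a (-1)) x = \<zero>"
      by (rule defect_orthogonal[OF ac _ ac _ _ assms(1)]) (auto simp: a_def max_def)
    then show "adj B (defect (a 1) x) \<otimes> ((-1) \<odot> defect (a (-1)) x) = \<zero>"
      using defect_closed[OF ac assms(1)] by (simp add: smult_mult_right adj_closed)
  qed (use defect_closed[OF ac assms(1)] in simp_all)
  also have "(nrm B ((-1) \<odot> defect (a (-1)) x))\<^sup>2 = (nrm B (defect (a (-1)) x))\<^sup>2"
    using defect_closed[OF ac assms(1)] by (simp add: nrm_smult)
  finally have "(nrm B (defect b x))\<^sup>2
      \<le> 4 * (d/2)\<^sup>2 * (nrm B x)\<^sup>2 / 2 ^ n + 4 * (d/2)\<^sup>2 * (nrm B x)\<^sup>2 / 2 ^ n"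
    using half[of 1] half[of "-1"] by linarith
  then show ?case by (simp add: power_divide)
qed

lemma E_mult_JR:
  assumes b: "continuous_on UNIV b" and x: "x \<in> carrier B"
  shows "E (JR b \<otimes> x) = JR b \<otimes> E x"
proof -
  obtain d where d: "\<And>y. \<bar>b y\<bar> \<le> d"
    using C.bounded[of "\<lambda>x. of_real (b x)"] b by (auto simp: continuous_on_of_real)
  have "(\<lambda>n. 4 * d\<^sup>2 * (nrm B x)\<^sup>2 * (1/2) ^ n) \<longlonglongrightarrow> 4 * d\<^sup>2 * (nrm B x)\<^sup>2 * 0"
    by (intro tendsto_intros LIMSEQ_power_zero) simp
  then have "(nrm B (defect b x))\<^sup>2 \<le> 4 * d\<^sup>2 * (nrm B x)\<^sup>2 * 0"
    using defect_nrm_halving[OF x b d]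
    by (intro LIMSEQ_le_const[of _ "4 * d\<^sup>2 * (nrm B x)\<^sup>2 * 0"]) (auto simp: power_divide)
  then have "defect b x = \<zero>" using nrm_eq_0_iff[OF defect_closed[OF b x]] by simp
  then show ?thesis using b x by (simp add: defect_def diff_eq_zero_iff)
qed

lemma E_mult_J:
  assumes a: "continuous_on UNIV a" and x: "x \<in> carrier B"
  shows "E (J a \<otimes> x) = J a \<otimes> E x"
proof -
  have c: "continuous_on UNIV (\<lambda>y. Re (a y))" "continuous_on UNIV (\<lambda>y. Im (a y))"
    using a by (auto intro!: continuous_intros)
  have "J a = J (\<lambda>y. complex_of_real (Re (a y)) + \<i> * complex_of_real (Im (a y)))"
    by (simp flip: complex_eq)
  also have "\<dots> = JR (\<lambda>y. Re (a y)) \<oplus> \<i> \<odot> JR (\<lambda>y. Im (a y))"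
    using c by (simp add: JR_def J_add J_smult continuous_on_of_real continuous_on_mult)
  finally have J: "J a = JR (\<lambda>y. Re (a y)) \<oplus> \<i> \<odot> JR (\<lambda>y. Im (a y))" .
  show ?thesis
    unfolding J using c x by (simp add: l_distr E_add smult_mult_left E_smult E_mult_JR)
qed

end

text \<open>The map sending x to adj(E(adj x)) is again a norm one projection fixing the image of
  \<open>J\<close>. Its left module property, read through the adjoint, is the right module property
  of \<open>E\<close>.\<close>

lemma (in projection_onto_functions) E_J_mult:
  assumes a: "continuous_on UNIV a" and x: "x \<in> carrier B"
  shows "E (x \<otimes> J a) = E x \<otimes> J a"
proof -
  have J_adj: "adj B (J b) = J (\<lambda>x. cnj (b x))" if "continuous_on UNIV b" for b
    using J_hom that by (simp add: cstar_hom_def C_alg_eq)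
  interpret E': projection_onto_functions B "\<lambda>x. adj B (E (adj B x))" J
  proof unfold_locales
    show "(\<lambda>x. adj B (E (adj B x))) \<in> linear_maps B B"
      by (auto simp: linear_maps_def adj_closed adj_add adj_smult E_add E_smult)
    show "nrm B (adj B (E (adj B x))) \<le> nrm B x" if "x \<in> carrier B" for x
      using E_contr[of "adj B x"] that by (simp add: nrm_adj adj_closed)
    show "adj B (E (adj B (adj B (E (adj B x))))) = adj B (E (adj B x))" if "x \<in> carrier B" for x
      using that by (simp add: adj_adj adj_closed E_idem)
    show "adj B (E (adj B (adj B (E (adj B x)) \<otimes> adj B (E (adj B y)))))
        = adj B (E (adj B x)) \<otimes> adj B (E (adj B y))"
      if "x \<in> carrier B" "y \<in> carrier B" for x y
      using that E_range_mult[of "adj B y" "adj B x"] by (simp add: adj_adj adj_closed adj_mult)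
    show "adj B (E (adj B (J b))) = J b" if "continuous_on UNIV b" for b
      using that E_J[of "\<lambda>x. cnj (b x)"] by (simp add: J_adj continuous_on_cnj)
  qed (use X J_hom in auto)
  have ca: "continuous_on UNIV (\<lambda>x. cnj (a x))" by (intro continuous_intros a)
  have Jc: "J a \<in> carrier B" by (rule J_closed[OF a])
  have "adj B (E (adj B (J (\<lambda>x. cnj (a x)) \<otimes> adj B x)))
      = J (\<lambda>x. cnj (a x)) \<otimes> adj B (E (adj B (adj B x)))"
    by (rule E'.E_mult_J[OF ca]) (simp add: x adj_closed)
  then have "adj B (E (x \<otimes> J a)) = adj B (E x \<otimes> J a)"
    using a x Jc by (simp add: adj_mult adj_adj adj_closed flip: J_adj)
  then have "adj B (adj B (E (x \<otimes> J a))) = adj B (adj B (E x \<otimes> J a))" by simp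
  then show ?thesis using x Jc by (simp add: adj_adj)
qed

section \<open>Functions on the projective limit\<close>

lemma continuous_if_local_homeomorphism:
  fixes f :: "'a::t2_space \<Rightarrow> 'b::topological_space"
  assumes "local_homeomorphism f"
  shows "continuous_on UNIV f"
proof -
  have "isCont f x" for x
  proof -
    obtain U where "open U" "x \<in> U" "continuous_on U f"
      using assms unfolding local_homeomorphism_def homeomorphism_def by meson
    then show ?thesis by (simp add: continuous_on_eq_continuous_at)
  qed
  then show ?thesis by (simp add: continuous_at_imp_continuous_on)
qed

lemma compact_UNIV_fun:
  assumes "compact (UNIV :: 'x::topological_space set)"
  shows "compact (UNIV :: ('g \<Rightarrow> 'x) set)"
proof -
  have "compact_space (euclidean :: 'x topology)"
    using assms by (simp add: compact_space_def)
  then have "compact_space (product_topology (\<lambda>_. euclidean :: 'x topology) (UNIV :: 'g set))"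
    by (simp add: compact_space_product_topology)
  then show ?thesis by (simp add: euclidean_product_topology compact_space_def)
qed

text \<open>A modulus of continuity, to carry the square root in \<open>K_sqrt\<close> over from
  approximants to limits: the square root satisfies |sqrt u - sqrt v| <= sqrt |u - v|, and max(0, 1
  - s^2) is 2-Lipschitz for s >= 0.\<close>

lemma sqrt_max_diff_le:
  fixes s t :: real
  assumes "0 \<le> s" "0 \<le> t"
  shows "\<bar>sqrt (max 0 (1 - s\<^sup>2)) - sqrt (max 0 (1 - t\<^sup>2))\<bar> \<le> sqrt (2 * \<bar>s - t\<bar>)"
proof -
  have sqrt_diff: "\<bar>sqrt u - sqrt v\<bar> \<le> sqrt \<bar>u - v\<bar>" if "0 \<le> u" "0 \<le> v" for u v :: real
  proof -
    have *: "sqrt u - sqrt v \<le> sqrt \<bar>u - v\<bar>" if "0 \<le> u" "0 \<le> v" for u v :: real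
    proof -
      have "sqrt u \<le> sqrt (v + \<bar>u - v\<bar>)" by (rule real_sqrt_le_mono) simp
      also have "\<dots> \<le> sqrt v + sqrt \<bar>u - v\<bar>" using that by (intro sqrt_add_le_add_sqrt) auto
      finally show ?thesis by simp
    qed
    show ?thesis using *[OF that] *[OF that(2,1)] by (simp add: abs_le_iff abs_minus_commute)
  qed
  have *: "\<bar>max 0 (1 - s\<^sup>2) - max 0 (1 - t\<^sup>2)\<bar> \<le> 2 * \<bar>s - t\<bar>"
  proof -
    have m: "max 0 (1 - s\<^sup>2) = 1 - (min s 1)\<^sup>2" if "0 \<le> s" for s :: real
    proof (cases "s \<le> 1")
      case True
      then show ?thesis using power_le_one[OF that True, of 2] by simp
    next
      case False
      then show ?thesis using one_le_power[of s 2] by simp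
    qed
    have "(min t 1)\<^sup>2 - (min s 1)\<^sup>2 = (min t 1 - min s 1) * (min t 1 + min s 1)"
      by (simp add: power2_eq_square algebra_simps)
    also have "\<bar>\<dots>\<bar> \<le> \<bar>s - t\<bar> * 2"
      unfolding abs_mult using assms by (intro mult_mono) auto
    finally show ?thesis using assms by (simp add: m)
  qed
  have "\<bar>sqrt (max 0 (1 - s\<^sup>2)) - sqrt (max 0 (1 - t\<^sup>2))\<bar>
      \<le> sqrt \<bar>max 0 (1 - s\<^sup>2) - max 0 (1 - t\<^sup>2)\<bar>" by (rule sqrt_diff) auto
  also have "\<dots> \<le> sqrt (2 * \<bar>s - t\<bar>)" using * by (rule real_sqrt_le_mono)
  finally show ?thesis .
qed

locale exel_renault = group G for G :: "'g monoid" (structure) +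
  fixes P :: "'g set"
    and \<theta> :: "'g \<Rightarrow> 'x::t2_space \<Rightarrow> 'x"
    and V :: "'g \<Rightarrow> ('x \<Rightarrow> complex) \<Rightarrow> ('x \<Rightarrow> complex)"
    and \<omega> :: "'g \<Rightarrow> 'x \<Rightarrow> real"
  assumes X: "compact (UNIV :: 'x set)"
    and P_sub: "P \<subseteq> carrier G"
    and P_one: "\<one> \<in> P"
    and P_mult: "\<lbrakk>r \<in> P; s \<in> P\<rbrakk> \<Longrightarrow> r \<otimes> s \<in> P"
    and P_ore: "\<lbrakk>r \<in> P; s \<in> P\<rbrakk> \<Longrightarrow> \<exists>u\<in>P. \<exists>v\<in>P. u \<otimes> r = v \<otimes> s"
    and P_generates: "g \<in> carrier G \<Longrightarrow> \<exists>r\<in>P. \<exists>s\<in>P. g = inv r \<otimes> s"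
    and \<theta>_one: "\<theta> \<one> x = x"
    and \<theta>_mult: "\<lbrakk>r \<in> P; s \<in> P\<rbrakk> \<Longrightarrow> \<theta> (r \<otimes> s) x = \<theta> s (\<theta> r x)"
    and \<theta>_surj: "t \<in> P \<Longrightarrow> \<exists>z. \<theta> t z = x"
    and \<theta>_cont: "t \<in> P \<Longrightarrow> continuous_on UNIV (\<theta> t)"
    and \<omega>_pos: "t \<in> P \<Longrightarrow> 0 < \<omega> t y"
    and \<omega>_sum: "t \<in> P \<Longrightarrow> (\<Sum>y\<in>\<theta> t -` {x}. \<omega> t y) = 1"
    and V_cont: "\<lbrakk>t \<in> carrier G; continuous_on UNIV a\<rbrakk> \<Longrightarrow> continuous_on UNIV (V t a)"
    and V_formula: "\<lbrakk>r \<in> P; s \<in> P; continuous_on UNIV a\<rbrakk> \<Longrightarrow>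
      V (inv r \<otimes> s) a x = (\<Sum>y\<in>\<theta> r -` {x}. complex_of_real (\<omega> r y) * a (\<theta> s y))"
begin

sublocale C: function_algebra "UNIV :: 'x set" "{a. continuous_on UNIV a}"
  by (rule function_algebra_continuous[OF X])

lemma C_cstar: "unital_cstar_algebra (C_alg :: ('x \<Rightarrow> complex) cstar)"
  unfolding C_alg_eq by (rule C.cstar)

lemma P_carrier [simp]: "p \<in> P \<Longrightarrow> p \<in> carrier G"
  using P_sub by auto

lemma comp_\<theta>_cont [simp]: "\<lbrakk>p \<in> P; continuous_on UNIV a\<rbrakk> \<Longrightarrow> continuous_on UNIV (\<lambda>x. a (\<theta> p x))"
  using continuous_on_compose2[of UNIV a UNIV "\<theta> p"] \<theta>_cont by auto

text \<open>A sum over an infinite set is 0 by convention, so the normalization to 1 forces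
  finiteness.\<close>

lemma fibre_finite: "t \<in> P \<Longrightarrow> finite (\<theta> t -` {x})"
  using \<omega>_sum[of t x] by (metis sum.infinite zero_neq_one)

lemma V_inv_formula:
  assumes "q \<in> P" "continuous_on UNIV a"
  shows "V (inv q) a x = (\<Sum>y\<in>\<theta> q -` {x}. complex_of_real (\<omega> q y) * a y)"
  using V_formula[OF assms(1) P_one assms(2), of x] assms(1) by (simp add: \<theta>_one)

lemma V_inv_mult:
  assumes "q \<in> P" "p \<in> P" "continuous_on UNIV a"
  shows "V (inv q \<otimes> p) a = V (inv q) (\<lambda>x. a (\<theta> p x))"
  using assms by (simp add: fun_eq_iff V_formula V_inv_formula)

lemma V_P:
  assumes "p \<in> P" "continuous_on UNIV a"
  shows "V p a = (\<lambda>x. a (\<theta> p x))"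
proof
  fix x
  have v: "\<theta> \<one> -` {x} = {x}" by (auto simp: \<theta>_one)
  then have "\<omega> \<one> x = 1" using \<omega>_sum[OF P_one, of x] by simp
  then show "V p a x = a (\<theta> p x)"
    using V_formula[OF P_one assms, of x] assms by (simp add: v)
qed

lemma V_inv_nrm:
  assumes q: "q \<in> P" and a: "continuous_on UNIV a" and le: "\<And>x. cmod (a x) \<le> c"
  shows "cmod (V (inv q) a x) \<le> c"
proof -
  have "cmod (V (inv q) a x) \<le> (\<Sum>y\<in>\<theta> q -` {x}. cmod (complex_of_real (\<omega> q y) * a y))"
    unfolding V_inv_formula[OF q a] by (rule norm_sum)
  also have "\<dots> \<le> (\<Sum>y\<in>\<theta> q -` {x}. \<omega> q y * c)"
    using le \<omega>_pos[OF q] by (intro sum_mono) (simp add: norm_mult less_imp_le)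
  also have "\<dots> = c" using \<omega>_sum[OF q] by (simp flip: sum_distrib_right)
  finally show ?thesis .
qed

text \<open>The Ore condition iterated: the levels of the projective limit form a directed
  set.\<close>

lemma common_left_multiple:
  assumes "finite I" "I \<subseteq> P"
  shows "\<exists>k\<in>P. \<forall>i\<in>I. \<exists>p\<in>P. k = p \<otimes> i"
  using assms
proof (induction I)
  case empty
  then show ?case using P_one by blast
next
  case (insert j I)
  then obtain k where k: "k \<in> P" "\<forall>i\<in>I. \<exists>p\<in>P. k = p \<otimes> i" by auto
  obtain u v where uv: "u \<in> P" "v \<in> P" "u \<otimes> k = v \<otimes> j"
    using P_ore[OF k(1), of j] insert.prems by auto
  have "\<exists>p\<in>P. u \<otimes> k = p \<otimes> i" if i: "i \<in> I" for i
  proof -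
    obtain p where p: "p \<in> P" "k = p \<otimes> i" using k i by blast
    have "u \<otimes> k = (u \<otimes> p) \<otimes> i" using p uv i insert.prems by (auto simp: m_assoc)
    then show ?thesis using P_mult uv p by blast
  qed
  moreover have "\<exists>p\<in>P. u \<otimes> k = p \<otimes> j" using uv by blast
  ultimately show ?case using P_mult[OF uv(1) k(1)] by blast
qed

lemma inv_cancel:
  "\<lbrakk>x \<in> carrier G; y \<in> carrier G\<rbrakk> \<Longrightarrow> inv x \<otimes> (x \<otimes> y) = y"
  "\<lbrakk>x \<in> carrier G; y \<in> carrier G\<rbrakk> \<Longrightarrow> x \<otimes> (inv x \<otimes> y) = y"
  by (simp_all add: m_assoc[symmetric])

text \<open>The coordinate at inv(q) is the position in copy number q of X; the one at inv(r) s is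
  its image under \<theta>_s from copy r. These redundant coordinates let every element of
  \<open>G\<close> act by translation. Prescribing \<open>undefined\<close> off \<open>G\<close>
  makes points that agree on \<open>G\<close> equal.\<close>

definition Y :: "('g \<Rightarrow> 'x) set"
  where "Y = {y. (\<forall>g\<in>carrier G. \<forall>t\<in>P. y (g \<otimes> t) = \<theta> t (y g)) \<and>
    (\<forall>g. g \<notin> carrier G \<longrightarrow> y g = undefined)}"

lemma Y_mult: "\<lbrakk>y \<in> Y; g \<in> carrier G; t \<in> P\<rbrakk> \<Longrightarrow> y (g \<otimes> t) = \<theta> t (y g)"
  by (simp add: Y_def)

text \<open>Tychonoff and the finite intersection property: finitely many compatibility conditions
  involve one common level only, and there surjectivity of a single \<theta> provides a
  solution.\<close>

lemma Y_surj:
  assumes q: "q \<in> P"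
  obtains y where "y \<in> Y" "y (inv q) = x"
proof -
  \<comment> \<open>The conditions on the coset inv(k) P alone, together with the prescribed
    coordinate. The cosets exhaust \<open>G\<close>, so a point in all \<open>Z k\<close> lies in
    \<open>Y\<close>.\<close>
  define Z where "Z k = {y. (\<forall>p\<in>P. \<forall>t\<in>P. y (inv k \<otimes> p \<otimes> t) = \<theta> t (y (inv k \<otimes> p))) \<and>
    y (inv q) = x \<and> (\<forall>g\<in>-carrier G. y g = undefined)}" for k
  have "UNIV \<inter> \<Inter>(Z ` P) \<noteq> {}"
  proof (rule compact_imp_fip_image[OF compact_UNIV_fun[OF X]])
    fix k assume k: "k \<in> P"
    have 1: "closed {y. y (inv k \<otimes> p \<otimes> t) = \<theta> t (y (inv k \<otimes> p))}" if "t \<in> P" for p t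
      by (rule closed_Collect_eq[OF continuous_on_product_coordinates
            continuous_on_compose2[OF \<theta>_cont[OF that] continuous_on_product_coordinates]]) simp
    have 2: "closed {y. y g = c}" for g :: 'g and c :: 'x
      by (rule closed_Collect_eq[OF continuous_on_product_coordinates continuous_on_const])
    have "Z k = (\<Inter>p\<in>P. \<Inter>t\<in>P. {y. y (inv k \<otimes> p \<otimes> t) = \<theta> t (y (inv k \<otimes> p))}) \<inter>
        {y. y (inv q) = x} \<inter> (\<Inter>g\<in>-carrier G. {y. y g = undefined})"
      by (auto simp: Z_def)
    also have "closed \<dots>"
      by (intro closed_Int closed_INT ballI 1 2)
    finally show "closed (Z k)" .
  next
    fix I assume I: "finite I" "I \<subseteq> P"
    then obtain k where k: "k \<in> P" "\<forall>i\<in>insert q I. \<exists>p\<in>P. k = p \<otimes> i"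
      using common_left_multiple[of "insert q I"] q by auto
    then obtain p0 where p0: "p0 \<in> P" "k = p0 \<otimes> q" by auto
    obtain z where z: "\<theta> p0 z = x" using \<theta>_surj[OF p0(1)] by blast
    \<comment> \<open>The point \<open>z\<close> at level \<open>k\<close> determines all
      coordinates in inv(k) P, which contains inv(i) P for every i in \<open>I\<close>. The other
      coordinates in \<open>G\<close> are unconstrained here; off \<open>G\<close> the value
      \<open>undefined\<close> is required.\<close>
    define y where "y g = (if g \<in> carrier G \<and> k \<otimes> g \<in> P then \<theta> (k \<otimes> g) z else undefined)" for g
    have y: "y (inv k \<otimes> p) = \<theta> p z" if "p \<in> P" for p
      using that k(1) by (simp add: y_def inv_cancel)
    have "y \<in> Z i" if i: "i \<in> I" for i
    proof -
      obtain p1 where p1: "p1 \<in> P" "k = p1 \<otimes> i" using k(2) i by blast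
      have "i \<in> P" using i I by blast
      then have inv_i: "inv i \<otimes> p = inv k \<otimes> (p1 \<otimes> p)" if "p \<in> P" for p
        using p1 that by (simp add: inv_mult_group m_assoc inv_cancel)
      have "inv q = inv k \<otimes> p0"
        using p0 q by (simp add: inv_mult_group m_assoc inv_cancel)
      then have "y (inv q) = x" using y[OF p0(1)] z by simp
      moreover have "y (inv i \<otimes> p \<otimes> t) = \<theta> t (y (inv i \<otimes> p))" if "p \<in> P" "t \<in> P" for p t
      proof -
        have "inv i \<otimes> p \<otimes> t = inv k \<otimes> (p1 \<otimes> p \<otimes> t)"
          using inv_i[of "p \<otimes> t"] that p1 \<open>i \<in> P\<close> by (simp add: P_mult m_assoc)
        then show ?thesis
          unfolding inv_i[OF that(1)] using that p1(1) by (simp add: y P_mult \<theta>_mult)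
      qed
      ultimately show ?thesis by (simp add: Z_def y_def)
    qed
    then show "UNIV \<inter> \<Inter>(Z ` I) \<noteq> {}" by blast
  qed
  then obtain y where y: "\<And>k. k \<in> P \<Longrightarrow> y \<in> Z k" by blast
  have "y \<in> Y"
    unfolding Y_def
  proof (intro CollectI conjI ballI allI impI)
    fix g t assume g: "g \<in> carrier G" and t: "t \<in> P"
    obtain r s where rs: "r \<in> P" "s \<in> P" "g = inv r \<otimes> s" using P_generates[OF g] by blast
    show "y (g \<otimes> t) = \<theta> t (y g)" using y[OF rs(1)] rs t by (simp add: Z_def)
  qed (use y[OF q] in \<open>simp add: Z_def\<close>)
  moreover have "y (inv q) = x" using y[OF q] by (simp add: Z_def)
  ultimately show ?thesis using that by blast
qed

section \<open>Cylinder functions and their uniform closure\<close>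

definition gcyl :: "'g \<Rightarrow> ('x \<Rightarrow> complex) \<Rightarrow> ('g \<Rightarrow> 'x) \<Rightarrow> complex"
  where "gcyl g a y = (if y \<in> Y then a (y g) else 0)"

abbreviation cyl :: "'g \<Rightarrow> ('x \<Rightarrow> complex) \<Rightarrow> ('g \<Rightarrow> 'x) \<Rightarrow> complex"
  where "cyl q \<equiv> gcyl (inv q)"

lemma gcyl_mult: "\<lbrakk>g \<in> carrier G; p \<in> P\<rbrakk> \<Longrightarrow> gcyl (g \<otimes> p) a = gcyl g (\<lambda>x. a (\<theta> p x))"
  by (auto simp: gcyl_def Y_mult fun_eq_iff)

lemma cyl_shift:
  assumes "p \<in> P" "q \<in> P"
  shows "cyl q a = cyl (p \<otimes> q) (\<lambda>x. a (\<theta> p x))"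
  using assms gcyl_mult[of "inv (p \<otimes> q)" p a] by (simp add: inv_mult_group m_assoc)

lemma gcyl_eq_cyl:
  assumes "g \<in> carrier G" "continuous_on UNIV a"
  obtains r s where "r \<in> P" "s \<in> P" "g = inv r \<otimes> s" "gcyl g a = cyl r (\<lambda>x. a (\<theta> s x))"
proof -
  obtain r s where "r \<in> P" "s \<in> P" "g = inv r \<otimes> s" using P_generates[OF assms(1)] by blast
  then show ?thesis using that gcyl_mult by simp
qed

text \<open>The Ore condition lifts two levels to a common one, where sums and products of cylinder
  functions are those of C(X).\<close>

lemma cyl_common:
  assumes "q \<in> P" "continuous_on UNIV a" "q' \<in> P" "continuous_on UNIV a'"
  obtains k u v where "k \<in> P" "u \<in> P" "v \<in> P" "k = u \<otimes> q" "k = v \<otimes> q'"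
    "cyl q a = cyl k (\<lambda>x. a (\<theta> u x))" "cyl q' a' = cyl k (\<lambda>x. a' (\<theta> v x))"
proof -
  obtain u v where uv: "u \<in> P" "v \<in> P" "u \<otimes> q = v \<otimes> q'" using P_ore assms by blast
  show ?thesis
    using that[of "u \<otimes> q" u v] uv cyl_shift[of u q a] cyl_shift[of v q' a'] assms P_mult by auto
qed

definition K :: "(('g \<Rightarrow> 'x) \<Rightarrow> complex) set"
  where "K = {f. \<forall>e>0. \<exists>q\<in>P. \<exists>a. continuous_on UNIV a \<and> (\<forall>y. cmod (f y - cyl q a y) \<le> e)}"

lemma KE:
  assumes "f \<in> K" "e > 0"
  obtains q a where "q \<in> P" "continuous_on UNIV a" "\<And>y. cmod (f y - cyl q a y) \<le> e"
  using assms by (auto simp: K_def)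

lemma cyl_in_K [simp]: "\<lbrakk>q \<in> P; continuous_on UNIV a\<rbrakk> \<Longrightarrow> cyl q a \<in> K"
  unfolding K_def by force

lemma gcyl_in_K [simp]:
  assumes "g \<in> carrier G" "continuous_on UNIV a"
  shows "gcyl g a \<in> K"
  using gcyl_eq_cyl[OF assms] assms(2) by (metis cyl_in_K comp_\<theta>_cont)

lemma K_vanish:
  assumes "f \<in> K" "y \<notin> Y"
  shows "f y = 0"
proof -
  have "cmod (f y) \<le> 0 + e" if "e > 0" for e
  proof -
    obtain q a where "\<And>y. cmod (f y - cyl q a y) \<le> e" using KE[OF assms(1) \<open>e > 0\<close>] by blast
    from this[of y] show ?thesis using assms(2) by (simp add: gcyl_def)
  qed
  then have "cmod (f y) \<le> 0" by (rule field_le_epsilon)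
  then show ?thesis by simp
qed

lemma cyl_bounded:
  assumes "continuous_on UNIV a"
  shows "\<exists>M\<ge>0. \<forall>y. cmod (gcyl q a y) \<le> M"
proof -
  obtain M where "\<forall>x. cmod (a x) \<le> M" using C.bounded assms by blast
  then show ?thesis by (intro exI[of _ "max M 0"]) (auto simp: gcyl_def le_max_iff_disj)
qed

lemma K_bounded:
  assumes "f \<in> K"
  shows "\<exists>M\<ge>0. \<forall>y. cmod (f y) \<le> M"
proof -
  obtain q a where qa: "q \<in> P" "continuous_on UNIV a" "\<And>y. cmod (f y - cyl q a y) \<le> 1"
    using KE[OF assms, of 1] by auto
  obtain M where M: "M \<ge> 0" "\<And>y. cmod (cyl q a y) \<le> M" using cyl_bounded[OF qa(2)] by blast
  have "cmod (f y) \<le> M + 1" for y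
    using norm_triangle_ineq[of "cyl q a y" "f y - cyl q a y"] M(2)[of y] qa(3)[of y] by simp
  then show ?thesis using M by (intro exI[of _ "M + 1"]) auto
qed

sublocale Y: function_algebra Y K
proof
  show "Y \<noteq> {}" using Y_surj[OF P_one, of undefined] by blast
  show "f y = 0" if "f \<in> K" "y \<notin> Y" for f y using K_vanish that .
  show "\<exists>M. \<forall>x. cmod (f x) \<le> M" if "f \<in> K" for f using K_bounded[OF that] by blast
  have "(\<lambda>x. of_bool (x \<in> Y)) = cyl \<one> (\<lambda>x. 1)" by (auto simp: gcyl_def)
  then show "(\<lambda>x. of_bool (x \<in> Y)) \<in> K" using P_one by simp
next
  fix f f' assume f: "f \<in> K" and f': "f' \<in> K"
  show "(\<lambda>x. f x + f' x) \<in> K"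
    unfolding K_def
  proof (intro CollectI allI impI)
    fix e :: real assume "e > 0"
    obtain q a where qa: "q \<in> P" "continuous_on UNIV a" "\<And>y. cmod (f y - cyl q a y) \<le> e/2"
      using KE[OF f, of "e/2"] \<open>e > 0\<close> by auto
    obtain q' a' where qa': "q' \<in> P" "continuous_on UNIV a'" "\<And>y. cmod (f' y - cyl q' a' y) \<le> e/2"
      using KE[OF f', of "e/2"] \<open>e > 0\<close> by auto
    obtain k u v where k: "k \<in> P" "u \<in> P" "v \<in> P" "k = u \<otimes> q" "k = v \<otimes> q'"
      "cyl q a = cyl k (\<lambda>x. a (\<theta> u x))" "cyl q' a' = cyl k (\<lambda>x. a' (\<theta> v x))"
      by (rule cyl_common[OF qa(1,2) qa'(1,2)])
    have eq: "cyl k (\<lambda>x. a (\<theta> u x) + a' (\<theta> v x)) y = cyl q a y + cyl q' a' y" for y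
      unfolding k(6,7) by (simp add: gcyl_def)
    have "cmod (f y + f' y - (cyl q a y + cyl q' a' y)) \<le> e" for y
      using norm_triangle_ineq[of "f y - cyl q a y" "f' y - cyl q' a' y"] qa(3)[of y] qa'(3)[of y]
      by (simp add: algebra_simps)
    then show "\<exists>q\<in>P. \<exists>b. continuous_on UNIV b \<and> (\<forall>y. cmod (f y + f' y - cyl q b y) \<le> e)"
      using k(1-3) qa(2) qa'(2) by (intro bexI[of _ k] exI[of _ "\<lambda>x. a (\<theta> u x) + a' (\<theta> v x)"])
        (auto simp: eq intro!: continuous_on_add)
  qed
  show "(\<lambda>x. f x * f' x) \<in> K"
    unfolding K_def
  proof (intro CollectI allI impI)
    fix e :: real assume "e > 0"
    obtain M where M: "M \<ge> 0" "\<And>y. cmod (f y) \<le> M" using K_bounded[OF f] by blast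
    have e': "e / (2 * (M + 1)) > 0" using \<open>e > 0\<close> M by simp
    obtain q' a' where qa': "q' \<in> P" "continuous_on UNIV a'"
      "\<And>y. cmod (f' y - cyl q' a' y) \<le> e / (2 * (M + 1))"
      using KE[OF f' e'] by auto
    \<comment> \<open>The order matters: the tolerance for \<open>f\<close> depends on a bound for
      the approximant of \<open>f'\<close>, which must therefore be chosen first.\<close>
    obtain M' where M': "M' \<ge> 0" "\<And>y. cmod (cyl q' a' y) \<le> M'" using cyl_bounded[OF qa'(2)] by blast
    have e'': "e / (2 * (M' + 1)) > 0" using \<open>e > 0\<close> M' by simp
    obtain q a where qa: "q \<in> P" "continuous_on UNIV a"
      "\<And>y. cmod (f y - cyl q a y) \<le> e / (2 * (M' + 1))"
      using KE[OF f e''] by auto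
    obtain k u v where k: "k \<in> P" "u \<in> P" "v \<in> P" "k = u \<otimes> q" "k = v \<otimes> q'"
      "cyl q a = cyl k (\<lambda>x. a (\<theta> u x))" "cyl q' a' = cyl k (\<lambda>x. a' (\<theta> v x))"
      by (rule cyl_common[OF qa(1,2) qa'(1,2)])
    have eq: "cyl k (\<lambda>x. a (\<theta> u x) * a' (\<theta> v x)) y = cyl q a y * cyl q' a' y" for y
      unfolding k(6,7) by (simp add: gcyl_def)
    have "cmod (f y * f' y - cyl q a y * cyl q' a' y) \<le> e" for y
    proof -
      have eq': "f y * f' y - cyl q a y * cyl q' a' y
          = f y * (f' y - cyl q' a' y) + cyl q' a' y * (f y - cyl q a y)" by (simp add: algebra_simps)
      have "cmod (f y * f' y - cyl q a y * cyl q' a' y) \<le> cmod (f y) * cmod (f' y - cyl q' a' y) + cmod (cyl q' a' y) * cmod (f y - cyl q a y)"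
        unfolding eq' norm_mult[symmetric] by (rule norm_triangle_ineq)
      also have "\<dots> \<le> M * (e / (2 * (M + 1))) + M' * (e / (2 * (M' + 1)))"
        by (rule add_mono[OF mult_mono[OF M(2) qa'(3) M(1) norm_ge_zero]
              mult_mono[OF M'(2) qa(3) M'(1) norm_ge_zero]])
      also have "\<dots> \<le> e / 2 + e / 2"
      proof -
        have "N * (e / (2 * (N + 1))) \<le> e / 2" if "N \<ge> 0" for N :: real
        proof -
          have "N * (e / (2 * (N + 1))) = (N / (N + 1)) * (e / 2)" by simp
          also have "\<dots> \<le> 1 * (e / 2)"
            using that \<open>e > 0\<close> by (intro mult_right_mono) auto
          finally show ?thesis by simp
        qed
        then show ?thesis using M(1) M'(1) by (intro add_mono)
      qed
      finally show ?thesis by simp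
    qed
    then show "\<exists>q\<in>P. \<exists>b. continuous_on UNIV b \<and> (\<forall>y. cmod (f y * f' y - cyl q b y) \<le> e)"
      using k(1-3) qa(2) qa'(2) by (intro bexI[of _ k] exI[of _ "\<lambda>x. a (\<theta> u x) * a' (\<theta> v x)"])
        (auto simp: eq intro!: continuous_on_mult)
  qed
next
  fix f assume f: "f \<in> K"
  show "(\<lambda>x. cnj (f x)) \<in> K"
    unfolding K_def
  proof (intro CollectI allI impI)
    fix e :: real assume "e > 0"
    obtain q a where qa: "q \<in> P" "continuous_on UNIV a" "\<And>y. cmod (f y - cyl q a y) \<le> e"
      using KE[OF f \<open>e > 0\<close>] by auto
    have "cmod (cnj (f y) - cyl q (\<lambda>x. cnj (a x)) y) \<le> e" for y
    proof -
      have "cnj (f y) - cyl q (\<lambda>x. cnj (a x)) y = cnj (f y - cyl q a y)" by (simp add: gcyl_def)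
      then show ?thesis using qa(3)[of y] by (simp only: complex_mod_cnj)
    qed
    then show "\<exists>q\<in>P. \<exists>b. continuous_on UNIV b \<and> (\<forall>y. cmod (cnj (f y) - cyl q b y) \<le> e)"
      using qa by (intro bexI[of _ q] exI[of _ "\<lambda>x. cnj (a x)"]) (auto intro: continuous_on_cnj)
  qed
  show "(\<lambda>x. c * f x) \<in> K" for c
    unfolding K_def
  proof (intro CollectI allI impI)
    fix e :: real assume "e > 0"
    have c1: "cmod c + 1 > 0" by (simp add: add_nonneg_pos)
    obtain q a where qa: "q \<in> P" "continuous_on UNIV a" "\<And>y. cmod (f y - cyl q a y) \<le> e / (cmod c + 1)"
      using KE[OF f, of "e / (cmod c + 1)"] \<open>e > 0\<close> c1 by auto
    have "cmod (c * f y - cyl q (\<lambda>x. c * a x) y) \<le> e" for y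
    proof -
      have "c * f y - cyl q (\<lambda>x. c * a x) y = c * (f y - cyl q a y)"
        by (simp add: gcyl_def algebra_simps)
      then have "cmod (c * f y - cyl q (\<lambda>x. c * a x) y) = cmod c * cmod (f y - cyl q a y)"
        by (simp add: norm_mult)
      also have "\<dots> \<le> (cmod c + 1) * (e / (cmod c + 1))"
        using qa(3) c1 by (intro mult_mono) auto
      finally show ?thesis using c1 by simp
    qed
    then show "\<exists>q\<in>P. \<exists>b. continuous_on UNIV b \<and> (\<forall>y. cmod (c * f y - cyl q b y) \<le> e)"
      using qa by (intro bexI[of _ q] exI[of _ "\<lambda>x. c * a x"]) (auto intro!: continuous_intros)
  qed
  show "(\<lambda>x. complex_of_real (of_bool (x \<in> Y) * sqrt (max 0 (1 - (cmod (f x))\<^sup>2)))) \<in> K"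
    unfolding K_def
  proof (intro CollectI allI impI)
    fix e :: real assume "e > 0"
    \<comment> \<open>\<open>sqrt_max_diff_le\<close> turns an error e^2 / 2 into sqrt(e^2) =
      e.\<close>
    obtain q a where qa: "q \<in> P" "continuous_on UNIV a" "\<And>y. cmod (f y - cyl q a y) \<le> e\<^sup>2 / 2"
      using KE[OF f, of "e\<^sup>2 / 2"] \<open>e > 0\<close> by auto
    define b where "b x = complex_of_real (sqrt (max 0 (1 - (cmod (a x))\<^sup>2)))" for x
    have bc: "continuous_on UNIV b" unfolding b_def by (intro continuous_intros qa)
    have "cmod (complex_of_real (of_bool (y \<in> Y) * sqrt (max 0 (1 - (cmod (f y))\<^sup>2))) - cyl q b y) \<le> e" for y
    proof (cases "y \<in> Y")
      case True
      have "\<bar>sqrt (max 0 (1 - (cmod (f y))\<^sup>2)) - sqrt (max 0 (1 - (cmod (cyl q a y))\<^sup>2))\<bar>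
          \<le> sqrt (2 * \<bar>cmod (f y) - cmod (cyl q a y)\<bar>)" by (rule sqrt_max_diff_le) auto
      also have "\<dots> \<le> sqrt (e\<^sup>2)"
        using norm_triangle_ineq3[of "f y" "cyl q a y"] qa(3)[of y] by (intro real_sqrt_le_mono) simp
      also have "\<dots> = e" using \<open>e > 0\<close> by simp
      finally show ?thesis using True
        by (simp add: gcyl_def b_def flip: of_real_diff)
    qed (use \<open>e > 0\<close> in \<open>simp add: gcyl_def\<close>)
    then show "\<exists>q\<in>P. \<exists>b. continuous_on UNIV b \<and>
        (\<forall>y. cmod (complex_of_real (of_bool (y \<in> Y) * sqrt (max 0 (1 - (cmod (f y))\<^sup>2))) - cyl q b y) \<le> e)"
      using qa bc by blast
  qed
next
  fix f assume *: "\<And>e. 0 < e \<Longrightarrow> \<exists>g\<in>K. \<forall>x. cmod (f x - g x) \<le> e"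
  show "f \<in> K"
    unfolding K_def
  proof (intro CollectI allI impI)
    fix e :: real assume "e > 0"
    obtain g where g: "g \<in> K" "\<And>x. cmod (f x - g x) \<le> e/2" using *[of "e/2"] \<open>e > 0\<close> by auto
    obtain q a where qa: "q \<in> P" "continuous_on UNIV a" "\<And>y. cmod (g y - cyl q a y) \<le> e/2"
      using KE[OF g(1), of "e/2"] \<open>e > 0\<close> by auto
    have "cmod (f y - cyl q a y) \<le> e" for y
      using norm_triangle_ineq[of "f y - g y" "g y - cyl q a y"] g(2)[of y] qa(3)[of y] by simp
    then show "\<exists>q\<in>P. \<exists>a. continuous_on UNIV a \<and> (\<forall>y. cmod (f y - cyl q a y) \<le> e)"
      using qa by blast
  qed
qed

end

section \<open>The canonical dilation\<close>

lemma contractive_bounded: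
  assumes "T \<in> linear_maps B C" "\<And>x. x \<in> carrier B \<Longrightarrow> nrm C (T x) \<le> nrm B x"
  shows "T \<in> bounded_linear_maps B C"
  unfolding bounded_linear_maps_def using assms by (auto intro!: exI[of _ 1])

context exel_renault
begin

abbreviation B0 :: "(('g \<Rightarrow> 'x) \<Rightarrow> complex) cstar"
  where "B0 \<equiv> fun_cstar Y K"

lemma gcyl_add: "(\<lambda>y. gcyl g a y + gcyl g b y) = gcyl g (\<lambda>x. a x + b x)"
  and gcyl_times: "(\<lambda>y. gcyl g a y * gcyl g b y) = gcyl g (\<lambda>x. a x * b x)"
  and gcyl_smult: "(\<lambda>y. c * gcyl g a y) = gcyl g (\<lambda>x. c * a x)"
  and gcyl_cnj: "(\<lambda>y. cnj (gcyl g a y)) = gcyl g (\<lambda>x. cnj (a x))"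
  by (auto simp: gcyl_def)

text \<open>By \<open>Y_surj\<close> no value of \<open>a\<close> is lost in passing to the
  coordinate at inv(q). So every level is an isometric copy of C(X) inside
  \<open>B0\<close>.\<close>

lemma nrm_cyl:
  assumes q: "q \<in> P" and a: "continuous_on UNIV a"
  shows "nrm B0 (cyl q a) = nrm C_alg a"
  unfolding C_alg_eq fun_cstar_simps
proof (rule antisym)
  have a': "a \<in> {a. continuous_on UNIV a}" using a by simp
  show "(SUP y. cmod (cyl q a y)) \<le> (SUP x. cmod (a x))"
    by (rule Y.nrm_le) (simp add: gcyl_def C.cmod_le_nrm[OF a'] C.nrm_ge_0[OF a'])
  show "(SUP x. cmod (a x)) \<le> (SUP y. cmod (cyl q a y))"
  proof (rule C.nrm_le)
    fix x
    obtain y where "y \<in> Y" "y (inv q) = x" using Y_surj[OF q] by blast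
    then show "cmod (a x) \<le> (SUP y. cmod (cyl q a y))"
      using Y.cmod_le_nrm[OF cyl_in_K[OF q a], of y] by (simp add: gcyl_def)
  qed
qed

definition cyls :: "(('g \<Rightarrow> 'x) \<Rightarrow> complex) set"
  where "cyls = {cyl q a | q a. q \<in> P \<and> continuous_on UNIV a}"

lemma cyls_K: "cyls \<subseteq> K"
  by (auto simp: cyls_def)

lemma cyls_dense: "cstar_closure B0 cyls = carrier B0"
proof -
  have "f \<in> cstar_closure B0 cyls" if f: "f \<in> K" for f
    unfolding cstar_closure_def
  proof (intro CollectI conjI allI impI)
    fix e :: real assume "e > 0"
    then obtain q a where qa: "q \<in> P" "continuous_on UNIV a" "\<And>y. cmod (f y - cyl q a y) \<le> e/2"
      using KE[OF f, of "e/2"] by auto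
    have "nrm B0 (f \<ominus>\<^bsub>B0\<^esub> cyl q a) \<le> e/2"
      unfolding Y.minus_eq[OF f cyl_in_K[OF qa(1,2)]] fun_cstar_simps by (rule Y.nrm_le[OF qa(3)])
    moreover have "cyl q a \<in> cyls" using qa by (auto simp: cyls_def)
    ultimately show "\<exists>s\<in>cyls. nrm B0 (f \<ominus>\<^bsub>B0\<^esub> s) < e"
      using \<open>e > 0\<close> by (intro bexI[of _ "cyl q a"]) linarith+
  qed (use f in simp)
  then show ?thesis by (auto simp: cstar_closure_def)
qed

lemma maps_agree:
  assumes "unital_cstar_algebra C"
    and "T \<in> bounded_linear_maps B0 C" "T' \<in> bounded_linear_maps B0 C"
    and "\<And>q a. \<lbrakk>q \<in> P; continuous_on UNIV a\<rbrakk> \<Longrightarrow> T (cyl q a) = T' (cyl q a)"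
    and "f \<in> K"
  shows "T f = T' f"
  by (rule bounded_linear_maps_agree[OF Y.cstar assms(1-3) _ cyls_dense])
    (use assms(4,5) cyls_K in \<open>auto simp: cyls_def\<close>)

text \<open>The universal property of \<open>B0\<close> as direct limit of copies of C(X) along
  composition with the maps \<theta>_p. It produces both the expectation \<open>E\<close> and the
  comparison map into another dilation.\<close>

lemma cyl_extend:
  assumes C: "unital_cstar_algebra C"
    and lin: "\<And>q. q \<in> P \<Longrightarrow> \<Lambda> q \<in> linear_maps C_alg C"
    and contr: "\<And>q a. \<lbrakk>q \<in> P; continuous_on UNIV a\<rbrakk> \<Longrightarrow> nrm C (\<Lambda> q a) \<le> nrm C_alg a"
    and compat: "\<And>p q a. \<lbrakk>p \<in> P; q \<in> P; continuous_on UNIV a\<rbrakk>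
      \<Longrightarrow> \<Lambda> (p \<otimes> q) (\<lambda>x. a (\<theta> p x)) = \<Lambda> q a"
  obtains T where "T \<in> linear_maps B0 C" "\<And>f. f \<in> K \<Longrightarrow> nrm C (T f) \<le> nrm B0 f"
    "\<And>q a. \<lbrakk>q \<in> P; continuous_on UNIV a\<rbrakk> \<Longrightarrow> T (cyl q a) = \<Lambda> q a"
proof -
  define R where "R = {(cyl q a, \<Lambda> q a) | q a. q \<in> P \<and> continuous_on UNIV a}"
  have \<Lambda>_add: "\<Lambda> q (\<lambda>x. a x + b x) = \<Lambda> q a \<oplus>\<^bsub>C\<^esub> \<Lambda> q b"
    if "q \<in> P" "continuous_on UNIV a" "continuous_on UNIV b" for q a b
    using linear_mapsD(2)[OF lin[OF that(1)], of a b] that by (simp add: C_alg_eq)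
  have \<Lambda>_smult: "\<Lambda> q (\<lambda>x. c * a x) = c \<odot>\<^bsub>C\<^esub> \<Lambda> q a"
    if "q \<in> P" "continuous_on UNIV a" for q a c
    using linear_mapsD(3)[OF lin[OF that(1)], of a c] that by (simp add: C_alg_eq)
  obtain T where T: "T \<in> linear_maps B0 C" "\<And>f. f \<in> carrier B0 \<Longrightarrow> nrm C (T f) \<le> nrm B0 f"
    "\<And>f c. (f, c) \<in> R \<Longrightarrow> T f = c"
  proof (rule contractive_relation_extend[OF Y.cstar C])
    show "R \<subseteq> carrier B0 \<times> carrier C"
      using linear_mapsD(1)[OF lin] by (auto simp: R_def C_alg_eq)
    show "(f \<oplus>\<^bsub>B0\<^esub> f', c \<oplus>\<^bsub>C\<^esub> c') \<in> R" if fc: "(f, c) \<in> R" "(f', c') \<in> R" for f c f' c'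
    proof -
      obtain q a where 1: "f = cyl q a" "c = \<Lambda> q a" "q \<in> P" "continuous_on UNIV a"
        using fc(1) by (auto simp: R_def)
      obtain q' a' where 2: "f' = cyl q' a'" "c' = \<Lambda> q' a'" "q' \<in> P" "continuous_on UNIV a'"
        using fc(2) by (auto simp: R_def)
      obtain k u v where k: "k \<in> P" "u \<in> P" "v \<in> P" "k = u \<otimes> q" "k = v \<otimes> q'"
        "cyl q a = cyl k (\<lambda>x. a (\<theta> u x))" "cyl q' a' = cyl k (\<lambda>x. a' (\<theta> v x))"
        by (rule cyl_common[OF 1(3,4) 2(3,4)])
      define b where "b x = a (\<theta> u x) + a' (\<theta> v x)" for x
      have bc: "continuous_on UNIV b" unfolding b_def using k 1 2 by (intro continuous_on_add) auto
      have "c = \<Lambda> k (\<lambda>x. a (\<theta> u x))" using compat[OF k(2) 1(3,4)] 1 k by simp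
      moreover have "c' = \<Lambda> k (\<lambda>x. a' (\<theta> v x))" using compat[OF k(3) 2(3,4)] 2 k by simp
      ultimately have "c \<oplus>\<^bsub>C\<^esub> c' = \<Lambda> k b"
        unfolding b_def using k 1 2 by (simp add: \<Lambda>_add)
      moreover have "f \<oplus>\<^bsub>B0\<^esub> f' = cyl k b"
        unfolding 1 2 k(6,7) b_def by (simp add: gcyl_add)
      ultimately show ?thesis unfolding R_def using k bc by blast
    qed
    show "(c \<odot>\<^bsub>B0\<^esub> f, c \<odot>\<^bsub>C\<^esub> z) \<in> R" if fz: "(f, z) \<in> R" for f z c
    proof -
      obtain q a where 1: "f = cyl q a" "z = \<Lambda> q a" "q \<in> P" "continuous_on UNIV a"
        using fz by (auto simp: R_def)
      have "c \<odot>\<^bsub>B0\<^esub> f = cyl q (\<lambda>x. c * a x)" "c \<odot>\<^bsub>C\<^esub> z = \<Lambda> q (\<lambda>x. c * a x)"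
        unfolding 1 using 1 by (simp_all add: gcyl_smult \<Lambda>_smult)
      moreover have "continuous_on UNIV (\<lambda>x. c * a x)" using 1 by (intro continuous_intros)
      ultimately show ?thesis unfolding R_def using 1 by blast
    qed
    show "nrm C z \<le> nrm B0 f" if "(f, z) \<in> R" for f z
    proof -
      obtain q a where 1: "f = cyl q a" "z = \<Lambda> q a" "q \<in> P" "continuous_on UNIV a"
        using \<open>(f, z) \<in> R\<close> by (auto simp: R_def)
      show ?thesis unfolding 1(1,2) nrm_cyl[OF 1(3,4)] by (rule contr[OF 1(3,4)])
    qed
    have "Domain R = cyls" by (auto simp: R_def cyls_def)
    then show "cstar_closure B0 (Domain R) = carrier B0" using cyls_dense by simp
  qed blast
  show ?thesis
  proof (rule that[OF T(1)])
    show "nrm C (T f) \<le> nrm B0 f" if "f \<in> K" for f using T(2)[of f] that by simp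
    show "T (cyl q a) = \<Lambda> q a" if "q \<in> P" "continuous_on UNIV a" for q a
      by (rule T(3)) (use that in \<open>auto simp: R_def\<close>)
  qed
qed

lemma V_inv_linear:
  assumes q: "q \<in> P"
  shows "V (inv q) \<in> linear_maps C_alg C_alg"
  unfolding linear_maps_def C_alg_eq
proof (intro CollectI conjI ballI allI Pi_I)
  fix a b :: "'x \<Rightarrow> complex" and c
  assume a: "a \<in> carrier (fun_cstar UNIV {a. continuous_on UNIV a})"
    and b: "b \<in> carrier (fun_cstar UNIV {a. continuous_on UNIV a})"
  show "V (inv q) (a \<oplus>\<^bsub>fun_cstar UNIV {a. continuous_on UNIV a}\<^esub> b) =
      V (inv q) a \<oplus>\<^bsub>fun_cstar UNIV {a. continuous_on UNIV a}\<^esub> V (inv q) b"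
    using a b q by (simp add: fun_eq_iff V_inv_formula continuous_on_add sum.distrib algebra_simps)
  show "V (inv q) (c \<odot>\<^bsub>fun_cstar UNIV {a. continuous_on UNIV a}\<^esub> a) =
      c \<odot>\<^bsub>fun_cstar UNIV {a. continuous_on UNIV a}\<^esub> V (inv q) a"
    using a q by (simp add: fun_eq_iff V_inv_formula continuous_on_mult sum_distrib_left algebra_simps)
qed (use q V_cont in simp)

text \<open>
  \<open>E\<close> is the conditional expectation of \<^term>\<open>B0\<close> onto the image of $C(X)$, with values read
  in $C(X)$.
\<close>

definition E :: "(('g \<Rightarrow> 'x) \<Rightarrow> complex) \<Rightarrow> ('x \<Rightarrow> complex)"
  where "E = (SOME T. T \<in> linear_maps B0 C_alg \<and> (\<forall>f\<in>K. nrm C_alg (T f) \<le> nrm B0 f) \<and>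
    (\<forall>q\<in>P. \<forall>a. continuous_on UNIV a \<longrightarrow> T (cyl q a) = V (inv q) a))"

lemma E_ex: "\<exists>T. T \<in> linear_maps B0 C_alg \<and> (\<forall>f\<in>K. nrm C_alg (T f) \<le> nrm B0 f) \<and>
    (\<forall>q\<in>P. \<forall>a. continuous_on UNIV a \<longrightarrow> T (cyl q a) = V (inv q) a)"
proof -
  have compat: "V (inv (p \<otimes> q)) (\<lambda>x. a (\<theta> p x)) = V (inv q) a"
    if "p \<in> P" "q \<in> P" "continuous_on UNIV a" for p q a
  proof -
    have "inv (p \<otimes> q) \<otimes> p = inv q" using that by (simp add: inv_mult_group m_assoc)
    then show ?thesis using V_inv_mult[of "p \<otimes> q" p a] that P_mult by simp
  qed
  have contr: "nrm C_alg (V (inv q) a) \<le> nrm C_alg a" if "q \<in> P" "continuous_on UNIV a" for q a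
    unfolding C_alg_eq fun_cstar_simps
    by (rule C.nrm_le, rule V_inv_nrm[OF that], rule C.cmod_le_nrm) (use that in simp)
  obtain T where "T \<in> linear_maps B0 C_alg" "\<And>f. f \<in> K \<Longrightarrow> nrm C_alg (T f) \<le> nrm B0 f"
    "\<And>q a. \<lbrakk>q \<in> P; continuous_on UNIV a\<rbrakk> \<Longrightarrow> T (cyl q a) = V (inv q) a"
    using cyl_extend[OF C_cstar V_inv_linear contr compat] by blast
  then show ?thesis by blast
qed

lemma E_linear: "E \<in> linear_maps B0 C_alg"
  and E_contr: "f \<in> K \<Longrightarrow> nrm C_alg (E f) \<le> nrm B0 f"
  and E_cyl: "\<lbrakk>q \<in> P; continuous_on UNIV a\<rbrakk> \<Longrightarrow> E (cyl q a) = V (inv q) a"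
  using someI_ex[OF E_ex] unfolding E_def[symmetric] by blast+

lemma E_cont: "f \<in> K \<Longrightarrow> continuous_on UNIV (E f)"
  using linear_mapsD(1)[OF E_linear] by (simp add: C_alg_eq)

lemma E_diff: "\<lbrakk>f \<in> K; g \<in> K\<rbrakk> \<Longrightarrow> E (\<lambda>y. f y - g y) = (\<lambda>x. E f x - E g x)"
  using linear_maps_diff[OF Y.cstar C_cstar E_linear, of f g]
    C.minus_eq[of "E f" "E g"] by (simp add: Y.minus_eq E_cont C_alg_eq)

lemma E_pointwise_le:
  assumes "f \<in> K" "\<And>y. cmod (f y) \<le> c"
  shows "cmod (E f x) \<le> c"
proof -
  have "cmod (E f x) \<le> nrm C_alg (E f)"
    using C.cmod_le_nrm[of "E f" x] E_cont[OF assms(1)] by (simp add: C_alg_eq)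
  also have "\<dots> \<le> nrm B0 f" by (rule E_contr[OF assms(1)])
  also have "\<dots> \<le> c" using assms(2) by (simp add: Y.nrm_le)
  finally show ?thesis .
qed

text \<open>Checked on an approximating cylinder function: by \<open>Y_surj\<close> its values on
  all of X are values on \<open>Y\<close>, so its real part is at least -e/2 there, and averages
  with weights \<omega> inherit the lower bound.\<close>

lemma E_nonneg:
  assumes f: "f \<in> K" and nonneg: "\<And>y. 0 \<le> Re (f y)"
  shows "0 \<le> Re (E f x)"
proof -
  have "- Re (E f x) \<le> 0 + e" if "e > 0" for e
  proof -
    obtain q a where qa: "q \<in> P" "continuous_on UNIV a" "\<And>y. cmod (f y - cyl q a y) \<le> e/2"
      using KE[OF f, of "e/2"] \<open>e > 0\<close> by auto
    have a: "- (e/2) \<le> Re (a z)" for z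
    proof -
      obtain y where "y \<in> Y" "y (inv q) = z" using Y_surj[OF qa(1)] by blast
      then show ?thesis
        using qa(3)[of y] abs_Re_le_cmod[of "f y - cyl q a y"] nonneg[of y] by (simp add: gcyl_def)
    qed
    have "- (e/2) = (\<Sum>y\<in>\<theta> q -` {x}. \<omega> q y * (- (e/2)))"
      unfolding sum_distrib_right[symmetric] \<omega>_sum[OF qa(1)] by simp
    also have "\<dots> \<le> (\<Sum>y\<in>\<theta> q -` {x}. \<omega> q y * Re (a y))"
      using \<omega>_pos[OF qa(1)] a by (intro sum_mono mult_left_mono) (auto simp: less_imp_le)
    also have "\<dots> = Re (E (cyl q a) x)" using qa by (simp add: E_cyl V_inv_formula)
    finally have "- (e/2) \<le> Re (E (cyl q a) x)" .
    moreover have "cmod (E f x - E (cyl q a) x) \<le> e/2"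
      using E_pointwise_le[of "\<lambda>y. f y - cyl q a y" "e/2" x] qa f
      by (simp add: E_diff Y.K_diff)
    ultimately show ?thesis using abs_Re_le_cmod[of "E f x - E (cyl q a) x"] by simp
  qed
  then have "- Re (E f x) \<le> 0" by (rule field_le_epsilon)
  then show ?thesis by simp
qed

text \<open>Below |f|^2 there is a nonnegative cylinder function that is positive at a point where f
  is nonzero. Its expectation is a sum over a fibre of nonnegative terms, one of them positive
  because \<omega> is, while by \<open>E_nonneg\<close> it is at most E(|f|^2) = 0.\<close>

lemma E_faithful:
  assumes f: "f \<in> K" and zero: "E (\<lambda>y. cnj (f y) * f y) = (\<lambda>x. 0)"
  shows "f = (\<lambda>y. 0)"
proof (rule ccontr)
  assume "f \<noteq> (\<lambda>y. 0)"
  then obtain y0 where y0: "f y0 \<noteq> 0" by auto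
  then have y0_Y: "y0 \<in> Y" using K_vanish[OF f] by blast
  define g where "g y = cnj (f y) * f y" for y
  have g: "g \<in> K" unfolding g_def by (intro Y.K_mult Y.K_cnj f)
  have Re_g: "Re (g y) = (cmod (f y))\<^sup>2" for y
    unfolding cmod_power2 g_def by (simp add: power2_eq_square)
  \<comment> \<open>One third of the value at \<open>y0\<close> may be lost in approximating and one
    third in truncating; one third stays positive.\<close>
  define d where "d = (cmod (f y0))\<^sup>2 / 3"
  have d: "d > 0" using y0 by (simp add: d_def)
  obtain q a where qa: "q \<in> P" "continuous_on UNIV a" "\<And>y. cmod (g y - cyl q a y) \<le> d"
    using KE[OF g d] by auto
  have close: "\<bar>Re (g y) - Re (cyl q a y)\<bar> \<le> d" for y
    using qa(3)[of y] abs_Re_le_cmod[of "g y - cyl q a y"] by simp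
  \<comment> \<open>Lowering by the approximation error \<open>d\<close> and truncating at 0 makes
    the cylinder function a minorant of \<open>g\<close>.\<close>
  define b where "b x = complex_of_real (max 0 (Re (a x) - d))" for x
  have bc: "continuous_on UNIV b" unfolding b_def by (intro continuous_intros qa)
  have gb: "(\<lambda>y. g y - cyl q b y) \<in> K" using g qa bc by (intro Y.K_diff) auto
  \<comment> \<open>Chosen so that the coordinate of \<open>y0\<close> belongs to the fibre over
    which E(cyl q b) is averaged.\<close>
  define x0 where "x0 = \<theta> q (y0 (inv q))"
  have "0 \<le> Re (E (\<lambda>y. g y - cyl q b y) x0)"
  proof (rule E_nonneg[OF gb])
    fix y
    show "0 \<le> Re (g y - cyl q b y)"
      using close[of y] Re_g[of y] by (auto simp: gcyl_def b_def max_def)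
  qed
  then have "Re (E (cyl q b) x0) \<le> 0"
    using E_diff[OF g cyl_in_K[OF qa(1) bc]] zero unfolding g_def[symmetric] by simp
  also have "Re (E (cyl q b) x0) = (\<Sum>y\<in>\<theta> q -` {x0}. \<omega> q y * Re (b y))"
    using qa bc by (simp add: E_cyl V_inv_formula)
  finally have "(\<Sum>y\<in>\<theta> q -` {x0}. \<omega> q y * Re (b y)) \<le> 0" .
  moreover have "\<omega> q (y0 (inv q)) * Re (b (y0 (inv q))) \<le> (\<Sum>y\<in>\<theta> q -` {x0}. \<omega> q y * Re (b y))"
    using \<omega>_pos[OF qa(1)]
    by (intro member_le_sum fibre_finite qa) (auto simp: x0_def b_def less_imp_le)
  moreover have "0 < Re (b (y0 (inv q)))"
  proof -
    have "Re (g y0) = 3 * d" by (simp add: Re_g d_def)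
    then have "d < Re (a (y0 (inv q)))" using close[of y0] y0_Y d by (simp add: gcyl_def)
    then show ?thesis by (simp add: b_def)
  qed
  ultimately show False using \<omega>_pos[OF qa(1), of "y0 (inv q)"] by (smt (verit) mult_pos_pos)
qed

section \<open>The action by translation and the conditional expectation\<close>

definition shift :: "'g \<Rightarrow> ('g \<Rightarrow> 'x) \<Rightarrow> 'g \<Rightarrow> 'x"
  where "shift t y g = (if g \<in> carrier G then y (t \<otimes> g) else undefined)"

lemma shift_Y: "\<lbrakk>t \<in> carrier G; y \<in> Y\<rbrakk> \<Longrightarrow> shift t y \<in> Y"
  by (simp add: Y_def shift_def flip: m_assoc)

lemma shift_shift: "\<lbrakk>s \<in> carrier G; t \<in> carrier G\<rbrakk> \<Longrightarrow> shift t (shift s y) = shift (s \<otimes> t) y"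
  by (auto simp: shift_def m_assoc)

lemma shift_one: "y \<in> Y \<Longrightarrow> shift \<one> y = y"
  by (auto simp: shift_def Y_def)

text \<open>Translations compose as a right action on \<open>Y\<close> (\<open>shift_shift\<close>),
  so composing functions with them gives a left action.\<close>

definition \<beta>0 :: "'g \<Rightarrow> (('g \<Rightarrow> 'x) \<Rightarrow> complex) \<Rightarrow> ('g \<Rightarrow> 'x) \<Rightarrow> complex"
  where "\<beta>0 t f y = (if y \<in> Y then f (shift t y) else 0)"

lemma \<beta>0_gcyl:
  assumes "t \<in> carrier G" "g \<in> carrier G"
  shows "\<beta>0 t (gcyl g a) = gcyl (t \<otimes> g) a"
proof
  have "shift t y g = y (t \<otimes> g)" for y using assms by (simp add: shift_def)
  then show "\<beta>0 t (gcyl g a) y = gcyl (t \<otimes> g) a y" for y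
    using assms by (simp add: \<beta>0_def gcyl_def shift_Y)
qed

lemma \<beta>0_K:
  assumes t: "t \<in> carrier G" and f: "f \<in> K"
  shows "\<beta>0 t f \<in> K"
proof (rule Y.K_limit)
  fix e :: real assume "e > 0"
  obtain q a where qa: "q \<in> P" "continuous_on UNIV a" "\<And>y. cmod (f y - cyl q a y) \<le> e"
    using KE[OF f \<open>e > 0\<close>] by auto
  show "\<exists>g\<in>K. \<forall>y. cmod (\<beta>0 t f y - g y) \<le> e"
  proof (intro bexI allI)
    show "\<beta>0 t (cyl q a) \<in> K" using t qa by (simp add: \<beta>0_gcyl)
    show "cmod (\<beta>0 t f y - \<beta>0 t (cyl q a) y) \<le> e" for y
      using qa(3) \<open>e > 0\<close> by (simp add: \<beta>0_def)
  qed
qed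

lemma \<beta>0_mult:
  assumes "s \<in> carrier G" "t \<in> carrier G"
  shows "\<beta>0 (s \<otimes> t) f = \<beta>0 s (\<beta>0 t f)"
  using assms by (auto simp: \<beta>0_def shift_shift shift_Y)

lemma \<beta>0_one: "f \<in> K \<Longrightarrow> \<beta>0 \<one> f = f"
  by (auto simp: \<beta>0_def shift_one K_vanish)

lemma \<beta>0_hom: "t \<in> carrier G \<Longrightarrow> \<beta>0 t \<in> cstar_hom B0 B0"
  by (auto simp: cstar_hom_def linear_maps_def \<beta>0_K) (auto simp: \<beta>0_def)

lemma \<beta>0_action: "cstar_action G B0 \<beta>0"
  unfolding cstar_action_def
proof (intro conjI ballI)
  fix t assume t: "t \<in> carrier G"
  have "bij_betw (\<beta>0 t) K K"
    by (rule bij_betw_byWitness[where f' = "\<beta>0 (inv t)"])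
      (use t in \<open>auto simp: \<beta>0_K \<beta>0_one simp flip: \<beta>0_mult\<close>)
  then show "\<beta>0 t \<in> cstar_iso B0 B0" using \<beta>0_hom[OF t] by (simp add: cstar_iso_def)
qed (simp_all add: \<beta>0_one \<beta>0_mult)

definition i0 :: "('x \<Rightarrow> complex) \<Rightarrow> ('g \<Rightarrow> 'x) \<Rightarrow> complex"
  where "i0 a = cyl \<one> a"

lemma i0_K [simp]: "continuous_on UNIV a \<Longrightarrow> i0 a \<in> K"
  using P_one by (simp add: i0_def)

lemma i0_hom: "i0 \<in> cstar_hom C_alg B0"
  using P_one by (auto simp: cstar_hom_def linear_maps_def C_alg_eq i0_def gcyl_add gcyl_times gcyl_smult gcyl_cnj)

lemma E_i0: "continuous_on UNIV a \<Longrightarrow> E (i0 a) = a"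
  using P_one V_P[OF P_one, of a] by (simp add: i0_def E_cyl[OF P_one, simplified] \<theta>_one)

definition F0 :: "(('g \<Rightarrow> 'x) \<Rightarrow> complex) \<Rightarrow> ('g \<Rightarrow> 'x) \<Rightarrow> complex"
  where "F0 f = i0 (E f)"

lemma F0_i0: "continuous_on UNIV a \<Longrightarrow> F0 (i0 a) = i0 a"
  by (simp add: F0_def E_i0)

lemma F0_K: "f \<in> K \<Longrightarrow> F0 f \<in> K"
  by (simp add: F0_def E_cont)

lemma F0_linear: "F0 \<in> linear_maps B0 B0"
proof -
  have i0: "i0 \<in> linear_maps C_alg B0" using i0_hom by (simp add: cstar_hom_def)
  show ?thesis
    unfolding linear_maps_def F0_def
    by (intro CollectI conjI ballI allI Pi_I)
      (simp_all only: linear_mapsD[OF E_linear] linear_mapsD[OF i0])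
qed

lemma F0_contr: "f \<in> K \<Longrightarrow> nrm B0 (F0 f) \<le> nrm B0 f"
  unfolding F0_def i0_def by (simp only: nrm_cyl[OF P_one E_cont] E_contr)

text \<open>The range is the set of fixed points of the contraction \<open>F0\<close>, hence closed,
  and the operator norm 1 is attained at the image of the constant function 1.\<close>

lemma F0_expectation: "conditional_expectation B0 F0"
proof -
  define S where "S = i0 ` {a. continuous_on UNIV a}"
  have range: "F0 ` carrier B0 = S"
  proof
    show "F0 ` carrier B0 \<subseteq> S" by (auto simp: S_def F0_def E_cont)
    show "S \<subseteq> F0 ` carrier B0"
    proof
      fix s assume "s \<in> S"
      then obtain a where "s = i0 a" "continuous_on UNIV a" by (auto simp: S_def)
      then have "s = F0 (i0 a)" "i0 a \<in> carrier B0" by (simp_all add: F0_i0)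
      then show "s \<in> F0 ` carrier B0" by blast
    qed
  qed
  have S_fix: "F0 s = s" if "s \<in> S" for s using that by (auto simp: S_def F0_i0)
  have SK: "S \<subseteq> K" by (auto simp: S_def)
  have SI: "i0 a \<in> S" if "continuous_on UNIV a" for a using that by (simp add: S_def)
  have S_ops: "(\<lambda>y. f y + g y) \<in> S" "(\<lambda>y. f y * g y) \<in> S" "(\<lambda>y. cnj (f y)) \<in> S"
    "(\<lambda>y. c * f y) \<in> S" if fg: "f \<in> S" "g \<in> S" for f g c
  proof -
    obtain a b where ab: "f = i0 a" "continuous_on UNIV a" "g = i0 b" "continuous_on UNIV b"
      using fg by (auto simp: S_def)
    show "(\<lambda>y. f y + g y) \<in> S" "(\<lambda>y. f y * g y) \<in> S" "(\<lambda>y. cnj (f y)) \<in> S"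
      "(\<lambda>y. c * f y) \<in> S"
      unfolding ab(1,3) i0_def gcyl_add gcyl_times gcyl_cnj gcyl_smult
      unfolding i0_def[symmetric]
      by (intro SI continuous_intros ab(2,4))+
  qed
  interpret B0: unital_cstar_algebra B0 by (rule Y.cstar)
  have "submodule S complex_ring B0"
  proof (rule B0.M.submoduleI)
    show "S \<subseteq> carrier B0" using SK by simp
    have "i0 (\<lambda>x. 0) = (\<lambda>y. 0)" by (auto simp: i0_def gcyl_def)
    then show "\<zero>\<^bsub>B0\<^esub> \<in> S" using SI[of "\<lambda>x. 0"] by simp
    show "\<ominus>\<^bsub>B0\<^esub> f \<in> S" if "f \<in> S" for f
    proof -
      have "\<ominus>\<^bsub>B0\<^esub> f = (-1) \<odot>\<^bsub>B0\<^esub> f"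
        using SK that by (intro B0.smult_minus_1[symmetric]) auto
      then show ?thesis using S_ops(4)[OF that that, of "-1"] by simp
    qed
  qed (use S_ops in auto)
  moreover have "cstar_closure B0 S \<subseteq> S"
  proof
    fix f assume "f \<in> cstar_closure B0 S"
    then have f: "f \<in> K" and cl: "\<And>e. e > 0 \<Longrightarrow> \<exists>s\<in>S. nrm B0 (f \<ominus>\<^bsub>B0\<^esub> s) < e"
      by (simp_all add: cstar_closure_def del: fun_cstar_simps(8))
    have "f = F0 f"
    proof (rule B0.eq_if_nrm_small)
      fix e :: real assume "e > 0"
      then obtain s where s: "s \<in> S" "nrm B0 (f \<ominus>\<^bsub>B0\<^esub> s) < e/2" using cl[of "e/2"] by auto
      have c: "f \<in> carrier B0" "s \<in> carrier B0" "F0 f \<in> carrier B0"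
        using f s SK F0_K by auto
      have "nrm B0 (s \<ominus>\<^bsub>B0\<^esub> F0 f) = nrm B0 (F0 (f \<ominus>\<^bsub>B0\<^esub> s))"
        using linear_maps_diff[OF Y.cstar Y.cstar F0_linear c(1,2)] S_fix[OF s(1)]
          B0.nrm_diff_commute[OF c(2,3)] by simp
      also have "\<dots> \<le> nrm B0 (f \<ominus>\<^bsub>B0\<^esub> s)"
        using F0_contr B0.diff_closed[OF c(1,2)] by simp
      finally show "nrm B0 (f \<ominus>\<^bsub>B0\<^esub> F0 f) \<le> e"
        using B0.nrm_diff_triangle[OF c] s(2) by simp
    qed (use f F0_K in simp_all)
    then have "f \<in> F0 ` carrier B0" using f by (intro image_eqI[where x = f]) simp_all
    then show "f \<in> S" unfolding range .
  qed
  ultimately have sub: "cstar_subalgebra S B0"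
    using S_ops by (simp add: cstar_subalgebra_def)
  \<comment> \<open>For an element of norm 0 the quotient is 0 / 0, which is 0 by
    convention.\<close>
  have quot_le: "nrm B0 (F0 f) / nrm B0 f \<le> 1" if "f \<in> carrier B0" for f
  proof (cases "nrm B0 f = 0")
    case False
    then have "nrm B0 f > 0" using B0.nrm_nonneg[OF that] by linarith
    then show ?thesis using F0_contr[of f] that by (simp add: divide_le_eq_1_pos del: fun_cstar_simps(8))
  qed (simp only: div_by_0 zero_le_one)
  have norm: "op_norm B0 B0 F0 = 1"
    unfolding op_norm_def
  proof (rule antisym)
    show "(SUP f\<in>carrier B0. nrm B0 (F0 f) / nrm B0 f) \<le> 1"
      using B0.one_closed by (intro cSUP_least) (use quot_le in blast)+
    have one: "i0 (\<lambda>x. 1) \<in> carrier B0" by simp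
    have "nrm B0 (i0 (\<lambda>x. 1)) = 1"
      unfolding i0_def nrm_cyl[OF P_one continuous_on_const] by (simp add: C_alg_eq)
    then have "1 = nrm B0 (F0 (i0 (\<lambda>x. 1))) / nrm B0 (i0 (\<lambda>x. 1))"
      by (simp add: F0_i0 del: fun_cstar_simps(8))
    also have "\<dots> \<le> (SUP f\<in>carrier B0. nrm B0 (F0 f) / nrm B0 f)"
      by (rule cSUP_upper[OF one]) (use quot_le in \<open>unfold bdd_above_def, blast\<close>)
    finally show "1 \<le> (SUP f\<in>carrier B0. nrm B0 (F0 f) / nrm B0 f)" .
  qed
  show ?thesis
    unfolding conditional_expectation_def range
  proof (intro conjI ballI sub norm contractive_bounded[OF F0_linear])
    show "nrm B0 (F0 f) \<le> nrm B0 f" if "f \<in> carrier B0" for f using F0_contr that by simp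
    show "F0 (F0 f) = F0 f" if "f \<in> carrier B0" for f using S_fix range that by blast
  qed
qed

text \<open>Applying \<beta>0_t to the image of a gives the function of the coordinate at t. For t =
  inv(q) these are the cylinder functions, whence minimality; for t = inv(r) s it is a cylinder
  function at level r, and its expectation is given by the formula for \<open>V\<close>.\<close>

lemma canonical_dilation: "minimal_faithful_dilation G C_alg V (i0, B0, \<beta>0, F0)"
  unfolding minimal_faithful_dilation_def
proof (intro conjI)
  have "i0 (V t a) = F0 (\<beta>0 t (i0 a))" if t: "t \<in> carrier G" and a: "continuous_on UNIV a" for t a
  proof -
    obtain r s where rs: "r \<in> P" "s \<in> P" "t = inv r \<otimes> s" "gcyl t a = cyl r (\<lambda>x. a (\<theta> s x))"
      using gcyl_eq_cyl[OF t a] .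
    have "\<beta>0 t (i0 a) = cyl r (\<lambda>x. a (\<theta> s x))"
      using \<beta>0_gcyl[OF t, of "inv \<one>" a] t rs(4) by (simp add: i0_def)
    then show ?thesis using rs a by (simp add: F0_def E_cyl V_inv_mult)
  qed
  moreover have "inj_on i0 {a. continuous_on UNIV a}"
    by (rule inj_onI) (metis E_i0 mem_Collect_eq)
  ultimately show "is_dilation G C_alg V (i0, B0, \<beta>0, F0)"
    using Y.cstar \<beta>0_action F0_expectation i0_hom by (simp add: C_alg_eq)
  define S where "S = {\<beta>0 t (i0 a) | a t. a \<in> carrier C_alg \<and> t \<in> carrier G}"
  have "cyls \<subseteq> S"
  proof
    fix f assume "f \<in> cyls"
    then obtain q a where qa: "f = cyl q a" "q \<in> P" "continuous_on UNIV a" by (auto simp: cyls_def)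
    then have "f = \<beta>0 (inv q) (i0 a)" using \<beta>0_gcyl[of "inv q" "inv \<one>" a] by (simp add: i0_def)
    moreover have "a \<in> carrier C_alg" "inv q \<in> carrier G" using qa by (simp_all add: C_alg_eq)
    ultimately show "f \<in> S" unfolding S_def by blast
  qed
  also have "S \<subseteq> cstar_span B0 S" unfolding cstar_span_def by (rule hull_subset)
  finally have "cyls \<subseteq> cstar_span B0 S" .
  then have "cstar_closure B0 cyls \<subseteq> cstar_closure B0 (cstar_span B0 S)"
    unfolding cstar_closure_def by blast
  then show "minimal_dilation G C_alg (i0, B0, \<beta>0, F0)"
    unfolding cyls_dense S_def[symmetric] by (auto simp: S_def cstar_closure_def)
  show "faithful_dilation (i0, B0, \<beta>0, F0)"
    unfolding faithful_dilation.simps faithful_map_def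
  proof (intro ballI impI notI)
    fix f assume f: "f \<in> carrier B0" "f \<noteq> \<zero>\<^bsub>B0\<^esub>" and "F0 (adj B0 f \<otimes>\<^bsub>B0\<^esub> f) = \<zero>\<^bsub>B0\<^esub>"
    \<comment> \<open>\<open>E\<close> is a left inverse of \<open>i0\<close>, so the vanishing of
      \<open>F0\<close> passes to \<open>E\<close>, for which faithfulness is known.\<close>
    have "E (F0 (\<lambda>y. cnj (f y) * f y)) = E (\<lambda>y. cnj (f y) * f y)"
      using f by (simp add: F0_def E_i0 E_cont Y.K_mult Y.K_cnj)
    moreover have "F0 (\<lambda>y. cnj (f y) * f y) = i0 (\<lambda>x. 0)"
      using \<open>F0 _ = _\<close> by (simp add: i0_def gcyl_def fun_eq_iff)
    ultimately have "E (\<lambda>y. cnj (f y) * f y) = (\<lambda>x. 0)" by (simp add: E_i0)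
    then show False using E_faithful f by simp
  qed
qed

end

section \<open>Uniqueness\<close>

lemma cstar_homD:
  assumes "h \<in> cstar_hom B C"
  shows "h \<in> linear_maps B C"
    and "\<lbrakk>x \<in> carrier B; y \<in> carrier B\<rbrakk> \<Longrightarrow> h (x \<otimes>\<^bsub>B\<^esub> y) = h x \<otimes>\<^bsub>C\<^esub> h y"
    and "x \<in> carrier B \<Longrightarrow> h (adj B x) = adj C (h x)"
  using assms by (auto simp: cstar_hom_def)

lemma cstar_hom_comp:
  assumes h: "h \<in> cstar_hom B C" and k: "k \<in> cstar_hom C D"
  shows "(\<lambda>x. k (h x)) \<in> cstar_hom B D"
proof -
  have h_closed: "h x \<in> carrier C" if "x \<in> carrier B" for x
    by (rule linear_mapsD(1)[OF cstar_homD(1)[OF h] that])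
  have k_closed: "k x \<in> carrier D" if "x \<in> carrier C" for x
    by (rule linear_mapsD(1)[OF cstar_homD(1)[OF k] that])
  show ?thesis
    unfolding cstar_hom_def linear_maps_def
    by (intro CollectI conjI ballI allI Pi_I)
      (simp_all only: h_closed k_closed linear_mapsD(2,3)[OF cstar_homD(1)[OF h]]
        linear_mapsD(2,3)[OF cstar_homD(1)[OF k]] cstar_homD(2,3)[OF h] cstar_homD(2,3)[OF k])
qed

text \<open>\<open>op_norm\<close> is a supremum of reals and bounds the quotients only once they
  are known to be bounded above. The constant from \<open>bounded_linear_maps\<close> supplies that,
  and also settles the elements of norm 0, where the quotient carries no information.\<close>

lemma conditional_expectation_contractive:
  assumes B: "unital_cstar_algebra B" and F: "conditional_expectation B F" and x: "x \<in> carrier B"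
  shows "nrm B (F x) \<le> nrm B x"
proof -
  interpret B: unital_cstar_algebra B by fact
  obtain c where c: "\<And>x. x \<in> carrier B \<Longrightarrow> nrm B (F x) \<le> c * nrm B x"
    using F by (auto simp: conditional_expectation_def bounded_linear_maps_def)
  have "bdd_above ((\<lambda>x. nrm B (F x) / nrm B x) ` carrier B)"
    unfolding bdd_above_def
  proof (intro exI ballI)
    fix r assume "r \<in> (\<lambda>x. nrm B (F x) / nrm B x) ` carrier B"
    then obtain y where y: "y \<in> carrier B" "r = nrm B (F y) / nrm B y" by blast
    show "r \<le> \<bar>c\<bar>"
    proof (cases "nrm B y = 0")
      case False
      then have "nrm B y > 0" using B.nrm_nonneg[OF y(1)] by linarith
      then have "r \<le> c" using c[OF y(1)] unfolding y(2) by (simp only: pos_divide_le_eq)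
      then show ?thesis by linarith
    qed (simp add: y(2))
  qed
  then have "nrm B (F x) / nrm B x \<le> op_norm B B F"
    unfolding op_norm_def by (rule cSUP_upper[OF x])
  also have "\<dots> = 1" using F by (simp add: conditional_expectation_def)
  finally have le: "nrm B (F x) / nrm B x \<le> 1" .
  show ?thesis
  proof (cases "nrm B x = 0")
    case True
    then show ?thesis using c[OF x] by simp
  next
    case False
    then have "nrm B x > 0" using B.nrm_nonneg[OF x] by linarith
    then show ?thesis using le by (simp only: divide_le_eq_1_pos)
  qed
qed

locale er_dilation = exel_renault G P \<theta> V \<omega>
  for G :: "'g monoid" (structure) and P and \<theta> :: "'g \<Rightarrow> 'x::t2_space \<Rightarrow> 'x" and V \<omega> +
  fixes i :: "('x \<Rightarrow> complex) \<Rightarrow> 'b" and B :: "'b cstar" and \<beta> :: "'g \<Rightarrow> 'b \<Rightarrow> 'b" and F :: "'b \<Rightarrow> 'b"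
  assumes D: "minimal_faithful_dilation G C_alg V (i, B, \<beta>, F)"
begin

lemma B_cstar: "unital_cstar_algebra B"
  and \<beta>_action: "cstar_action G B \<beta>"
  and F_expectation: "conditional_expectation B F"
  and i_hom: "i \<in> cstar_hom C_alg B"
  and i_inj: "inj_on i (carrier C_alg)"
  and F_\<beta>: "\<lbrakk>t \<in> carrier G; a \<in> carrier C_alg\<rbrakk> \<Longrightarrow> i (V t a) = F (\<beta> t (i a))"
  and minimal: "carrier B =
    cstar_closure B (cstar_span B {\<beta> t (i a) | a t. a \<in> carrier C_alg \<and> t \<in> carrier G})"
  and faithful: "faithful_map B F"
  using D by (simp_all add: minimal_faithful_dilation_def)

sublocale B: unital_cstar_algebra B
  by (rule B_cstar)

lemma cont_carrier: "continuous_on UNIV a \<longleftrightarrow> a \<in> carrier C_alg"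
  by (simp add: C_alg_eq)

lemma i_closed: "continuous_on UNIV a \<Longrightarrow> i a \<in> carrier B"
  using linear_mapsD(1)[OF cstar_homD(1)[OF i_hom]] by (simp add: cont_carrier)

lemma \<beta>_hom: "t \<in> carrier G \<Longrightarrow> \<beta> t \<in> cstar_hom B B"
  and \<beta>_bij: "t \<in> carrier G \<Longrightarrow> bij_betw (\<beta> t) (carrier B) (carrier B)"
  and \<beta>_one: "b \<in> carrier B \<Longrightarrow> \<beta> \<one> b = b"
  and \<beta>_mult: "\<lbrakk>s \<in> carrier G; t \<in> carrier G; b \<in> carrier B\<rbrakk> \<Longrightarrow> \<beta> (s \<otimes> t) b = \<beta> s (\<beta> t b)"
  using \<beta>_action by (simp_all add: cstar_action_def cstar_iso_def)

lemma \<beta>_closed: "\<lbrakk>t \<in> carrier G; b \<in> carrier B\<rbrakk> \<Longrightarrow> \<beta> t b \<in> carrier B"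
  by (rule linear_mapsD(1)[OF cstar_homD(1)[OF \<beta>_hom]])

lemma \<beta>i_hom: "t \<in> carrier G \<Longrightarrow> (\<lambda>a. \<beta> t (i a)) \<in> cstar_hom C_alg B"
  by (rule cstar_hom_comp[OF i_hom \<beta>_hom])

lemma \<beta>i_nrm:
  assumes t: "t \<in> carrier G" and a: "continuous_on UNIV a"
  shows "nrm B (\<beta> t (i a)) = nrm C_alg a"
proof (rule C_alg_hom_isometric[OF X B_cstar \<beta>i_hom[OF t] _ a])
  show "inj_on (\<lambda>a. \<beta> t (i a)) (carrier C_alg)"
  proof (rule inj_onI)
    fix a b assume ab: "a \<in> carrier C_alg" "b \<in> carrier C_alg" "\<beta> t (i a) = \<beta> t (i b)"
    then have "i a = i b"
      using inj_onD[OF bij_betw_imp_inj_on[OF \<beta>_bij[OF t]]] i_closed by (simp add: cont_carrier)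
    then show "a = b" using inj_onD[OF i_inj] ab by blast
  qed
qed

sublocale F: projection_onto_functions B F i
proof (intro projection_onto_functions.intro norm_one_projection.intro
    norm_one_projection_axioms.intro projection_onto_functions_axioms.intro B_cstar X i_hom)
  show "F \<in> linear_maps B B"
    using F_expectation by (simp add: conditional_expectation_def bounded_linear_maps_def)
  show "nrm B (F x) \<le> nrm B x" if "x \<in> carrier B" for x
    by (rule conditional_expectation_contractive[OF B_cstar F_expectation that])
  show idem: "F (F x) = F x" if "x \<in> carrier B" for x
    using F_expectation that by (simp add: conditional_expectation_def)
  show "F (F x \<otimes>\<^bsub>B\<^esub> F y) = F x \<otimes>\<^bsub>B\<^esub> F y" if "x \<in> carrier B" "y \<in> carrier B" for x y
  proof -
    have "F x \<otimes>\<^bsub>B\<^esub> F y \<in> F ` carrier B"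
      using F_expectation that by (simp add: conditional_expectation_def cstar_subalgebra_def)
    then show ?thesis using idem by auto
  qed
  show "F (i a) = i a" if "continuous_on UNIV a" for a
  proof -
    have "V \<one> a = a" using V_P[OF P_one that] by (simp only: \<theta>_one)
    then show ?thesis
      using F_\<beta>[OF one_closed, of a] that \<beta>_one[OF i_closed[OF that]] unfolding cont_carrier by (simp only:)
  qed
qed

text \<open>
  The defect of covariance is killed by \<^term>\<open>F\<close> because \<^term>\<open>F\<close> is a module map.
\<close>

lemma covariance:
  assumes t: "t \<in> P" and a: "continuous_on UNIV a"
  shows "\<beta> t (i a) = i (\<lambda>x. a (\<theta> t x))"
proof -
  define n where "n b = i (\<lambda>x. b (\<theta> t x))" for b :: "'x \<Rightarrow> complex"
  define m where "m b = \<beta> t (i b)" for b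
  have tG: "t \<in> carrier G" using t by simp
  have nc: "n b \<in> carrier B" and mc: "m b \<in> carrier B" if "continuous_on UNIV b" for b
    unfolding n_def m_def using that t by (simp_all add: i_closed \<beta>_closed)
  have Fm: "F (m b) = n b" if "continuous_on UNIV b" for b
    using F_\<beta>[OF tG, of b] that V_P[OF t that] by (simp add: n_def m_def cont_carrier)
  have Fn: "F (n b) = n b" if "continuous_on UNIV b" for b
    unfolding n_def by (rule F.E_J) (use t that in simp)
  define a' where "a' x = cnj (a x)" for x
  have a'c: "continuous_on UNIV a'" unfolding a'_def by (intro continuous_intros a)
  have aa: "continuous_on UNIV (\<lambda>x. a' x * a x)" by (intro continuous_intros a a'c)
  have adj_m: "adj B (m a) = m a'"
    using cstar_homD(3)[OF \<beta>i_hom[OF tG], of a] a by (simp add: m_def a'_def[abs_def] C_alg_eq)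
  have adj_n: "adj B (n a) = n a'"
    using cstar_homD(3)[OF i_hom, of "\<lambda>x. a (\<theta> t x)"] a t by (simp add: n_def a'_def[abs_def] C_alg_eq)
  have mm: "m a' \<otimes>\<^bsub>B\<^esub> m a = m (\<lambda>x. a' x * a x)"
    using cstar_homD(2)[OF \<beta>i_hom[OF tG], of a' a] a a'c by (simp add: m_def C_alg_eq)
  have nn: "n a' \<otimes>\<^bsub>B\<^esub> n a = n (\<lambda>x. a' x * a x)"
    using cstar_homD(2)[OF i_hom, of "\<lambda>x. a' (\<theta> t x)" "\<lambda>x. a (\<theta> t x)"] a a'c t
    by (simp add: n_def C_alg_eq)
  have mod_l: "F (n b \<otimes>\<^bsub>B\<^esub> x) = n b \<otimes>\<^bsub>B\<^esub> F x" if "continuous_on UNIV b" "x \<in> carrier B" for b x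
    unfolding n_def by (rule F.E_mult_J) (use t that in simp_all)
  have mod_r: "F (x \<otimes>\<^bsub>B\<^esub> n b) = F x \<otimes>\<^bsub>B\<^esub> n b" if "continuous_on UNIV b" "x \<in> carrier B" for b x
    unfolding n_def by (rule F.E_J_mult) (use t that in simp_all)
  define c where "c = m a \<ominus>\<^bsub>B\<^esub> n a"
  have cc: "c \<in> carrier B" unfolding c_def using mc nc a by simp
  have "adj B c \<otimes>\<^bsub>B\<^esub> c = (m a' \<ominus>\<^bsub>B\<^esub> n a') \<otimes>\<^bsub>B\<^esub> (m a \<ominus>\<^bsub>B\<^esub> n a)"
    unfolding c_def using mc nc a by (simp add: B.adj_diff adj_m adj_n)
  also have "\<dots> = (m a' \<otimes>\<^bsub>B\<^esub> m a \<ominus>\<^bsub>B\<^esub> m a' \<otimes>\<^bsub>B\<^esub> n a)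
      \<ominus>\<^bsub>B\<^esub> (n a' \<otimes>\<^bsub>B\<^esub> m a \<ominus>\<^bsub>B\<^esub> n a' \<otimes>\<^bsub>B\<^esub> n a)"
    using mc[OF a] nc[OF a] mc[OF a'c] nc[OF a'c]
    by (subst B.diff_mult_distrib) (simp_all add: B.mult_diff_distrib)
  finally have "F (adj B c \<otimes>\<^bsub>B\<^esub> c) = (F (m a' \<otimes>\<^bsub>B\<^esub> m a) \<ominus>\<^bsub>B\<^esub> F (m a' \<otimes>\<^bsub>B\<^esub> n a))
      \<ominus>\<^bsub>B\<^esub> (F (n a' \<otimes>\<^bsub>B\<^esub> m a) \<ominus>\<^bsub>B\<^esub> F (n a' \<otimes>\<^bsub>B\<^esub> n a))"
    using mc nc a a'c by (simp add: F.E_diff)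
  \<comment> \<open>All four terms equal n(a' a): \<open>F\<close> sends m to n, fixes n, and lets
    factors n out on either side.\<close>
  also have "\<dots> = \<zero>\<^bsub>B\<^esub>"
    using mc nc a a'c aa nc[OF aa] by (simp add: mod_l mod_r Fm Fn mm nn)
  finally have "c = \<zero>\<^bsub>B\<^esub>" using faithful cc by (auto simp: faithful_map_def)
  then show ?thesis using mc nc a by (simp add: c_def B.diff_eq_zero_iff m_def n_def)
qed

lemma \<beta>i_mult:
  assumes g: "g \<in> carrier G" and p: "p \<in> P" and a: "continuous_on UNIV a"
  shows "\<beta> (g \<otimes> p) (i a) = \<beta> g (i (\<lambda>x. a (\<theta> p x)))"
  using g p a by (simp add: \<beta>_mult i_closed covariance)

section \<open>The dense union of copies of C(X) in a dilation, and the comparison map\<close>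

definition gens :: "'b set"
  where "gens = {\<beta> (inv q) (i a) | q a. q \<in> P \<and> continuous_on UNIV a}"

lemma gensI: "\<lbrakk>q \<in> P; continuous_on UNIV a\<rbrakk> \<Longrightarrow> \<beta> (inv q) (i a) \<in> gens"
  by (auto simp: gens_def)

lemma gens_common:
  assumes "x \<in> gens" "y \<in> gens"
  obtains q a b where "q \<in> P" "continuous_on UNIV a" "continuous_on UNIV b"
    "x = \<beta> (inv q) (i a)" "y = \<beta> (inv q) (i b)"
proof -
  obtain q a q' a' where x: "q \<in> P" "continuous_on UNIV a" "x = \<beta> (inv q) (i a)"
    and y: "q' \<in> P" "continuous_on UNIV a'" "y = \<beta> (inv q') (i a')"
    using assms by (auto simp: gens_def)
  obtain u v where uv: "u \<in> P" "v \<in> P" "u \<otimes> q = v \<otimes> q'" using P_ore[OF x(1) y(1)] by blast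
  have shift: "\<beta> (inv r) (i b) = \<beta> (inv (w \<otimes> r)) (i (\<lambda>x. b (\<theta> w x)))"
    if "r \<in> P" "w \<in> P" "continuous_on UNIV b" for r w b
  proof -
    have "inv (w \<otimes> r) \<otimes> w = inv r" using that by (simp add: inv_mult_group m_assoc)
    then show ?thesis using \<beta>i_mult[of "inv (w \<otimes> r)" w b] that P_mult by simp
  qed
  show ?thesis
  proof (rule that)
    show "x = \<beta> (inv (u \<otimes> q)) (i (\<lambda>x. a (\<theta> u x)))" unfolding x(3) by (rule shift[OF x(1) uv(1) x(2)])
    show "y = \<beta> (inv (u \<otimes> q)) (i (\<lambda>x. a' (\<theta> v x)))"
      unfolding y(3) uv(3) by (rule shift[OF y(1) uv(2) y(2)])
  qed (use uv x y P_mult in simp_all)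
qed

text \<open>Two generators lie in one copy of C(X) by \<open>gens_common\<close>, so the union of
  the copies is already a subspace.\<close>

lemma gens_submodule: "submodule gens complex_ring B"
proof (rule B.M.submoduleI)
  have lin: "(\<lambda>a. \<beta> (inv q) (i a)) \<in> linear_maps C_alg B" if "q \<in> P" for q
    using cstar_homD(1)[OF \<beta>i_hom[of "inv q"]] that by simp
  show sub: "gens \<subseteq> carrier B" by (auto simp: gens_def \<beta>_closed i_closed)
  show smult: "c \<odot>\<^bsub>B\<^esub> x \<in> gens" if x: "x \<in> gens" for c x
  proof -
    obtain q a where qa: "q \<in> P" "continuous_on UNIV a" "x = \<beta> (inv q) (i a)"
      using x by (auto simp: gens_def)
    have "c \<odot>\<^bsub>B\<^esub> x = \<beta> (inv q) (i (\<lambda>x. c * a x))"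
      using linear_mapsD(3)[OF lin[OF qa(1)], of a c] qa by (simp add: C_alg_eq)
    then show ?thesis using gensI[OF qa(1), of "\<lambda>x. c * a x"] qa(2)
      by (simp add: continuous_on_mult)
  qed
  show "x \<oplus>\<^bsub>B\<^esub> y \<in> gens" if xy: "x \<in> gens" "y \<in> gens" for x y
  proof -
    obtain q a b where q: "q \<in> P" "continuous_on UNIV a" "continuous_on UNIV b"
      "x = \<beta> (inv q) (i a)" "y = \<beta> (inv q) (i b)" using gens_common[OF xy] .
    have "x \<oplus>\<^bsub>B\<^esub> y = \<beta> (inv q) (i (\<lambda>x. a x + b x))"
      using linear_mapsD(2)[OF lin[OF q(1)], of a b] q by (simp add: C_alg_eq)
    then show ?thesis using gensI[OF q(1), of "\<lambda>x. a x + b x"] q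
      by (simp add: continuous_on_add)
  qed
  have g: "\<beta> (inv \<one>) (i (\<lambda>x. 0)) \<in> gens" by (rule gensI[OF P_one]) simp
  show "\<zero>\<^bsub>B\<^esub> \<in> gens"
    using smult[OF g, of 0] B.smult_0[OF subsetD[OF sub g]] by simp
  show "\<ominus>\<^bsub>B\<^esub> x \<in> gens" if "x \<in> gens" for x
    using smult[OF that, of "-1"] B.smult_minus_1[OF subsetD[OF sub that]] by simp
qed

text \<open>For t = inv(r) s, covariance moves s into the function, so every \<beta>_t(i(a)) is a
  generator at level r; the span in the definition of minimality thus stays inside
  \<open>gens\<close>.\<close>

lemma gens_dense: "cstar_closure B gens = carrier B"
proof -
  define S where "S = {\<beta> t (i a) | a t. a \<in> carrier C_alg \<and> t \<in> carrier G}"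
  have "S \<subseteq> gens"
  proof
    fix x assume "x \<in> S"
    then obtain a t where x: "x = \<beta> t (i a)" "continuous_on UNIV a" "t \<in> carrier G"
      by (auto simp: S_def cont_carrier)
    obtain r s where rs: "r \<in> P" "s \<in> P" "t = inv r \<otimes> s" using P_generates[OF x(3)] by blast
    have "x = \<beta> (inv r) (i (\<lambda>x. a (\<theta> s x)))"
      unfolding x(1) rs(3) using rs x(2) by (simp add: \<beta>i_mult)
    then show "x \<in> gens" using gensI[OF rs(1), of "\<lambda>x. a (\<theta> s x)"] rs x by simp
  qed
  then have "cstar_span B S \<subseteq> gens"
    unfolding cstar_span_def by (rule hull_minimal) (rule gens_submodule)
  then have "cstar_closure B (cstar_span B S) \<subseteq> cstar_closure B gens"
    unfolding cstar_closure_def by blast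
  then show ?thesis unfolding minimal[folded S_def, symmetric] by (auto simp: cstar_closure_def)
qed

text \<open>Surjectivity comes from an explicit inverse, the extension of the relation of all
  (\<phi> f, f) with f a cylinder function. This relation is contractive because both algebras give
  a cylinder function the norm of its symbol in C(X) (\<open>nrm_cyl\<close>,
  \<open>\<beta>i_nrm\<close>).\<close>

lemma ex_isometry:
  obtains \<phi> \<psi> where "\<phi> \<in> bounded_linear_maps B0 B" "\<psi> \<in> bounded_linear_maps B B0"
    "\<And>q a. \<lbrakk>q \<in> P; continuous_on UNIV a\<rbrakk> \<Longrightarrow> \<phi> (cyl q a) = \<beta> (inv q) (i a)"
    "\<And>f. f \<in> K \<Longrightarrow> \<psi> (\<phi> f) = f" "\<And>b. b \<in> carrier B \<Longrightarrow> \<phi> (\<psi> b) = b"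
    "\<And>f. f \<in> K \<Longrightarrow> nrm B (\<phi> f) \<le> nrm B0 f"
proof -
  have lin: "(\<lambda>a. \<beta> (inv q) (i a)) \<in> linear_maps C_alg B" if "q \<in> P" for q
    using cstar_homD(1)[OF \<beta>i_hom[of "inv q"]] that by simp
  have contr: "nrm B (\<beta> (inv q) (i a)) \<le> nrm C_alg a" if "q \<in> P" "continuous_on UNIV a" for q a
    using \<beta>i_nrm[of "inv q" a] that by simp
  have compat: "\<beta> (inv (p \<otimes> q)) (i (\<lambda>x. a (\<theta> p x))) = \<beta> (inv q) (i a)"
    if "p \<in> P" "q \<in> P" "continuous_on UNIV a" for p q a
  proof -
    have "inv (p \<otimes> q) \<otimes> p = inv q" using that by (simp add: inv_mult_group m_assoc)
    then show ?thesis using \<beta>i_mult[of "inv (p \<otimes> q)" p a] that P_mult by simp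
  qed
  obtain \<phi> where \<phi>: "\<phi> \<in> linear_maps B0 B" "\<And>f. f \<in> K \<Longrightarrow> nrm B (\<phi> f) \<le> nrm B0 f"
    "\<And>q a. \<lbrakk>q \<in> P; continuous_on UNIV a\<rbrakk> \<Longrightarrow> \<phi> (cyl q a) = \<beta> (inv q) (i a)"
    by (rule cyl_extend[OF B_cstar, of "\<lambda>q a. \<beta> (inv q) (i a)", OF lin contr compat]) auto
  have \<phi>_nrm: "nrm B (\<phi> f) = nrm B0 f" if f: "f \<in> cyls" for f
  proof -
    obtain q a where qa: "f = cyl q a" "q \<in> P" "continuous_on UNIV a" using f by (auto simp: cyls_def)
    show ?thesis
      unfolding qa(1) nrm_cyl[OF qa(2,3)] \<phi>(3)[OF qa(2,3)] by (rule \<beta>i_nrm) (use qa in simp_all)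
  qed
  define R where "R = {(\<phi> f, f) | f. f \<in> cyls}"
  have cyls_add: "(\<lambda>y. f y + g y) \<in> cyls" if fg: "f \<in> cyls" "g \<in> cyls" for f g
  proof -
    obtain q a q' a' where 1: "f = cyl q a" "q \<in> P" "continuous_on UNIV a"
      and 2: "g = cyl q' a'" "q' \<in> P" "continuous_on UNIV a'" using fg by (auto simp: cyls_def)
    obtain k u v where k: "k \<in> P" "u \<in> P" "v \<in> P" "k = u \<otimes> q" "k = v \<otimes> q'"
      "cyl q a = cyl k (\<lambda>x. a (\<theta> u x))" "cyl q' a' = cyl k (\<lambda>x. a' (\<theta> v x))"
      by (rule cyl_common[OF 1(2,3) 2(2,3)])
    have "(\<lambda>y. f y + g y) = cyl k (\<lambda>x. a (\<theta> u x) + a' (\<theta> v x))"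
      unfolding 1 2 k(6,7) gcyl_add ..
    moreover have "continuous_on UNIV (\<lambda>x. a (\<theta> u x) + a' (\<theta> v x))"
      using k 1 2 by (intro continuous_on_add) simp_all
    ultimately show ?thesis unfolding cyls_def using k(1) by blast
  qed
  have cyls_smult: "(\<lambda>y. c * f y) \<in> cyls" if f: "f \<in> cyls" for f c
  proof -
    obtain q a where qa: "f = cyl q a" "q \<in> P" "continuous_on UNIV a" using f by (auto simp: cyls_def)
    have "(\<lambda>y. c * f y) = cyl q (\<lambda>x. c * a x)" unfolding qa gcyl_smult ..
    moreover have "continuous_on UNIV (\<lambda>x. c * a x)" using qa by (intro continuous_intros)
    ultimately show ?thesis unfolding cyls_def using qa(2) by blast
  qed
  obtain \<psi> where \<psi>: "\<psi> \<in> linear_maps B B0" "\<And>b. b \<in> carrier B \<Longrightarrow> nrm B0 (\<psi> b) \<le> nrm B b"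
    "\<And>b f. (b, f) \<in> R \<Longrightarrow> \<psi> b = f"
  proof (rule contractive_relation_extend[OF B_cstar Y.cstar])
    show "R \<subseteq> carrier B \<times> carrier B0"
      using linear_mapsD(1)[OF \<phi>(1)] cyls_K by (auto simp: R_def)
    show "(b \<oplus>\<^bsub>B\<^esub> b', f \<oplus>\<^bsub>B0\<^esub> f') \<in> R" if bf: "(b, f) \<in> R" "(b', f') \<in> R" for b b' f f'
    proof -
      have c: "f \<in> cyls" "f' \<in> cyls" "b = \<phi> f" "b' = \<phi> f'" using bf by (auto simp: R_def)
      have "b \<oplus>\<^bsub>B\<^esub> b' = \<phi> (f \<oplus>\<^bsub>B0\<^esub> f')"
        unfolding c(3,4) using c(1,2) cyls_K by (intro linear_mapsD(2)[OF \<phi>(1), symmetric]) auto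
      then show ?thesis using cyls_add[OF c(1,2)] by (auto simp: R_def)
    qed
    show "(c \<odot>\<^bsub>B\<^esub> b, c \<odot>\<^bsub>B0\<^esub> f) \<in> R" if bf: "(b, f) \<in> R" for b f c
    proof -
      have c: "f \<in> cyls" "b = \<phi> f" using bf by (auto simp: R_def)
      have "c \<odot>\<^bsub>B\<^esub> b = \<phi> (c \<odot>\<^bsub>B0\<^esub> f)"
        unfolding c(2) using c(1) cyls_K by (intro linear_mapsD(3)[OF \<phi>(1), symmetric]) auto
      then show ?thesis using cyls_smult[OF c(1)] by (auto simp: R_def)
    qed
    show "nrm B0 f \<le> nrm B b" if bf: "(b, f) \<in> R" for b f
    proof -
      have c: "f \<in> cyls" "b = \<phi> f" using bf by (auto simp: R_def)
      show ?thesis unfolding c(2) \<phi>_nrm[OF c(1)] by (rule order.refl)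
    qed
    have "Domain R = gens"
    proof (intro equalityI subsetI)
      fix b assume "b \<in> Domain R"
      then obtain q a where "b = \<phi> (cyl q a)" "q \<in> P" "continuous_on UNIV a"
        by (auto simp: R_def cyls_def)
      then show "b \<in> gens" by (simp add: \<phi>(3) gensI)
    next
      fix b assume "b \<in> gens"
      then obtain q a where "b = \<beta> (inv q) (i a)" "q \<in> P" "continuous_on UNIV a"
        by (auto simp: gens_def)
      then have "b = \<phi> (cyl q a)" "cyl q a \<in> cyls" by (auto simp: \<phi>(3) cyls_def)
      then show "b \<in> Domain R" by (auto simp: R_def)
    qed
    then show "cstar_closure B (Domain R) = carrier B" using gens_dense by simp
  qed blast
  have \<phi>_c: "\<phi> f \<in> carrier B" if "f \<in> K" for f using linear_mapsD(1)[OF \<phi>(1)] that by simp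
  have \<psi>_c: "\<psi> b \<in> K" if "b \<in> carrier B" for b using linear_mapsD(1)[OF \<psi>(1) that] by simp
  have \<phi>_b: "\<phi> \<in> bounded_linear_maps B0 B" by (rule contractive_bounded[OF \<phi>(1)]) (use \<phi>(2) in simp)
  have \<psi>_b: "\<psi> \<in> bounded_linear_maps B B0" by (rule contractive_bounded[OF \<psi>(1,2)])
  have \<psi>\<phi>_cyl: "\<psi> (\<phi> f) = f" if "f \<in> cyls" for f by (rule \<psi>(3)) (use that in \<open>auto simp: R_def\<close>)
  have id0: "(\<lambda>f. f) \<in> bounded_linear_maps B0 B0" and id: "(\<lambda>b. b) \<in> bounded_linear_maps B B"
    by (rule contractive_bounded; simp add: linear_maps_def)+
  have comp0: "(\<lambda>f. \<psi> (\<phi> f)) \<in> bounded_linear_maps B0 B0"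
  proof (rule contractive_bounded)
    show "(\<lambda>f. \<psi> (\<phi> f)) \<in> linear_maps B0 B0"
      unfolding linear_maps_def
      by (intro CollectI conjI ballI allI Pi_I) (simp_all only: linear_mapsD[OF \<phi>(1)] linear_mapsD[OF \<psi>(1)])
    show "nrm B0 (\<psi> (\<phi> f)) \<le> nrm B0 f" if f: "f \<in> carrier B0" for f
    proof (rule order.trans[OF \<psi>(2)])
      show "\<phi> f \<in> carrier B" using \<phi>_c f by simp
      show "nrm B (\<phi> f) \<le> nrm B0 f" by (rule \<phi>(2)) (use f in simp)
    qed
  qed
  have comp: "(\<lambda>b. \<phi> (\<psi> b)) \<in> bounded_linear_maps B B"
  proof (rule contractive_bounded)
    show "(\<lambda>b. \<phi> (\<psi> b)) \<in> linear_maps B B"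
      unfolding linear_maps_def
      by (intro CollectI conjI ballI allI Pi_I) (simp_all only: linear_mapsD[OF \<phi>(1)] linear_mapsD[OF \<psi>(1)])
    show "nrm B (\<phi> (\<psi> b)) \<le> nrm B b" if b: "b \<in> carrier B" for b
      by (rule order.trans[OF \<phi>(2)[OF \<psi>_c[OF b]] \<psi>(2)[OF b]])
  qed
  show ?thesis
  proof (rule that[OF \<phi>_b \<psi>_b \<phi>(3) _ _ \<phi>(2)])
    show "\<psi> (\<phi> f) = f" if "f \<in> K" for f
      by (rule maps_agree[OF Y.cstar comp0 id0 _ that]) (rule \<psi>\<phi>_cyl, auto simp: cyls_def)
    show "\<phi> (\<psi> b) = b" if b: "b \<in> carrier B" for b
    proof (rule bounded_linear_maps_agree[OF B_cstar B_cstar comp id _ gens_dense _ b])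
      show "gens \<subseteq> carrier B" by (auto simp: gens_def \<beta>_closed i_closed)
      fix s assume "s \<in> gens"
      then obtain q a where "s = \<beta> (inv q) (i a)" "q \<in> P" "continuous_on UNIV a"
        by (auto simp: gens_def)
      then have "s = \<phi> (cyl q a)" "cyl q a \<in> cyls" by (auto simp: \<phi>(3) cyls_def)
      then show "\<phi> (\<psi> s) = s" using \<psi>\<phi>_cyl by simp
    qed
  qed
qed

end

section \<open>Comparing dilations through the canonical one\<close>

lemma cstar_iso_inv_into:
  assumes B: "unital_cstar_algebra B" and h: "h \<in> cstar_iso B C"
  shows "inv_into (carrier B) h \<in> cstar_iso C B"
proof -
  interpret B: unital_cstar_algebra B by fact
  define k where "k = inv_into (carrier B) h"
  have hom: "h \<in> cstar_hom B C" and bij: "bij_betw h (carrier B) (carrier C)"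
    using h by (simp_all add: cstar_iso_def)
  note lin = cstar_homD(1)[OF hom]
  have hk: "h (k y) = y" and kc: "k y \<in> carrier B" if "y \<in> carrier C" for y
    using that bij unfolding k_def
    by (simp_all add: bij_betw_inv_into_right inv_into_into bij_betw_imp_surj_on)
  have kh: "k (h x) = x" if "x \<in> carrier B" for x
    unfolding k_def by (rule bij_betw_inv_into_left[OF bij that])
  have kI: "k y = x" if "y = h x" "x \<in> carrier B" for x y using kh that by simp
  have "k \<in> cstar_hom C B"
    unfolding cstar_hom_def linear_maps_def
  proof (intro CollectI conjI ballI allI Pi_I)
    fix x y c assume x: "x \<in> carrier C" and y: "y \<in> carrier C"
    show "k x \<in> carrier B" by (rule kc[OF x])
    show "k (x \<oplus>\<^bsub>C\<^esub> y) = k x \<oplus>\<^bsub>B\<^esub> k y"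
      by (rule kI) (simp_all add: linear_mapsD(2)[OF lin] kc hk x y)
    show "k (x \<otimes>\<^bsub>C\<^esub> y) = k x \<otimes>\<^bsub>B\<^esub> k y"
      by (rule kI) (simp_all add: cstar_homD(2)[OF hom] kc hk x y)
    show "k (c \<odot>\<^bsub>C\<^esub> x) = c \<odot>\<^bsub>B\<^esub> k x"
      by (rule kI) (simp_all add: linear_mapsD(3)[OF lin] kc hk x)
    show "k (adj C x) = adj B (k x)"
      by (rule kI) (simp_all add: cstar_homD(3)[OF hom] kc hk x B.adj_closed)
  qed
  then show ?thesis
    unfolding cstar_iso_def using bij_betw_inv_into[OF bij] by (simp add: k_def)
qed

text \<open>The isomorphism is k after the inverse of h. That inverse cancels h only on the carrier
  of \<open>B\<close>, and the hypothesis that the source is a dilation puts \<open>F b\<close>,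
  \<open>\<beta> t b\<close> and \<open>i a\<close> there.\<close>

lemma isomorphic_dilations_if_common:
  assumes dil: "is_dilation G A V (i, B, \<beta>, F)"
    and iso1: "isomorphic_dilations G A (i, B, \<beta>, F) (i1, B1, \<beta>1, F1)"
    and iso2: "isomorphic_dilations G A (i, B, \<beta>, F) (i2, B2, \<beta>2, F2)"
  shows "isomorphic_dilations G A (i1, B1, \<beta>1, F1) (i2, B2, \<beta>2, F2)"
proof -
  obtain h where h: "h \<in> cstar_iso B B1" "\<forall>b\<in>carrier B. h (F b) = F1 (h b)"
    "\<forall>t\<in>carrier G. \<forall>b\<in>carrier B. h (\<beta> t b) = \<beta>1 t (h b)" "\<forall>a\<in>carrier A. h (i a) = i1 a"
    using iso1 by auto
  obtain k where k: "k \<in> cstar_iso B B2" "\<forall>b\<in>carrier B. k (F b) = F2 (k b)"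
    "\<forall>t\<in>carrier G. \<forall>b\<in>carrier B. k (\<beta> t b) = \<beta>2 t (k b)" "\<forall>a\<in>carrier A. k (i a) = i2 a"
    using iso2 by auto
  have B: "unital_cstar_algebra B" using dil by simp
  have Fc: "F b \<in> carrier B" if "b \<in> carrier B" for b
    using dil that linear_mapsD(1) by (auto simp: conditional_expectation_def bounded_linear_maps_def)
  have \<beta>c: "\<beta> t b \<in> carrier B" if "t \<in> carrier G" "b \<in> carrier B" for t b
    using dil that by (auto simp: cstar_action_def cstar_iso_def dest: bij_betwE)
  have ic: "i a \<in> carrier B" if "a \<in> carrier A" for a
  proof -
    have "i \<in> cstar_hom A B" using dil by simp
    from linear_mapsD(1)[OF cstar_homD(1)[OF this] that] show ?thesis .
  qed
  define l where "l = inv_into (carrier B) h"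
  have bij: "bij_betw h (carrier B) (carrier B1)" using h(1) by (simp add: cstar_iso_def)
  have l: "l \<in> cstar_iso B1 B" unfolding l_def by (rule cstar_iso_inv_into[OF B h(1)])
  have lh: "l (h b) = b" if "b \<in> carrier B" for b
    unfolding l_def by (rule bij_betw_inv_into_left[OF bij that])
  have ex: "\<exists>x\<in>carrier B. y = h x" if "y \<in> carrier B1" for y
    using bij_betw_imp_surj_on[OF bij] that by blast
  have "(\<lambda>x. k (l x)) \<in> cstar_iso B1 B2"
    using cstar_hom_comp[of l B1 B k B2] bij_betw_trans[of l "carrier B1" "carrier B" k "carrier B2"] l k(1)
    by (simp add: cstar_iso_def comp_def)
  moreover have "k (l (F1 b)) = F2 (k (l b))" if b: "b \<in> carrier B1" for b
  proof -
    obtain x where x: "x \<in> carrier B" "b = h x" using ex[OF b] by blast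
    have "F1 b = h (F x)" using h(2) x by simp
    then show ?thesis using k(2) x Fc by (simp add: lh)
  qed
  moreover have "k (l (\<beta>1 t b)) = \<beta>2 t (k (l b))" if t: "t \<in> carrier G" and b: "b \<in> carrier B1" for t b
  proof -
    obtain x where x: "x \<in> carrier B" "b = h x" using ex[OF b] by blast
    have "\<beta>1 t b = h (\<beta> t x)" using h(3) x t by simp
    then show ?thesis using k(3) x t \<beta>c by (simp add: lh)
  qed
  moreover have "k (l (i1 a)) = i2 a" if a: "a \<in> carrier A" for a
  proof -
    have "i1 a = h (i a)" using h(4) a by simp
    then show ?thesis using k(4) a ic by (simp add: lh)
  qed
  ultimately show ?thesis by (auto intro!: bexI[of _ "\<lambda>x. k (l x)"])
qed

context er_dilation
begin

text \<open>Each identity compares two bounded linear maps on \<open>B0\<close>, so cylinder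
  functions suffice. Multiplicativity is bilinear and is extended one factor at a time:
  \<open>mult_cyl\<close>, then \<open>mult1\<close>, then \<open>mult\<close>.\<close>

lemma isomorphic_to_canonical:
  "isomorphic_dilations G C_alg (i0, B0, \<beta>0, F0) (i, B, \<beta>, F)"
proof -
  obtain \<phi> \<psi> where \<phi>: "\<phi> \<in> bounded_linear_maps B0 B" and "\<psi> \<in> bounded_linear_maps B B0"
    and \<phi>_cyl: "\<And>q a. \<lbrakk>q \<in> P; continuous_on UNIV a\<rbrakk> \<Longrightarrow> \<phi> (cyl q a) = \<beta> (inv q) (i a)"
    and \<psi>\<phi>: "\<And>f. f \<in> K \<Longrightarrow> \<psi> (\<phi> f) = f" and \<phi>\<psi>: "\<And>b. b \<in> carrier B \<Longrightarrow> \<phi> (\<psi> b) = b"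
    and \<phi>_nrm: "\<And>f. f \<in> K \<Longrightarrow> nrm B (\<phi> f) \<le> nrm B0 f"
    by (rule ex_isometry) blast
  have \<phi>L: "\<phi> \<in> linear_maps B0 B" and \<psi>L: "\<psi> \<in> linear_maps B B0"
    using \<phi> \<open>\<psi> \<in> _\<close> by (simp_all add: bounded_linear_maps_def)
  have \<phi>c: "\<phi> f \<in> carrier B" if "f \<in> K" for f using linear_mapsD(1)[OF \<phi>L] that by simp
  have \<psi>c: "\<psi> b \<in> K" if "b \<in> carrier B" for b using linear_mapsD(1)[OF \<psi>L that] by simp
  have \<phi>_add: "\<phi> (\<lambda>y. f y + g y) = \<phi> f \<oplus>\<^bsub>B\<^esub> \<phi> g" if "f \<in> K" "g \<in> K" for f g
    using linear_mapsD(2)[OF \<phi>L, of f g] that by simp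
  have \<phi>_smult: "\<phi> (\<lambda>y. c * f y) = c \<odot>\<^bsub>B\<^esub> \<phi> f" if "f \<in> K" for f c
    using linear_mapsD(3)[OF \<phi>L, of f c] that by simp
  interpret B0: unital_cstar_algebra B0 by (rule Y.cstar)
  have B0_mult: "nrm B0 (\<lambda>y. f y * g y) \<le> nrm B0 f * nrm B0 g" if "f \<in> K" "g \<in> K" for f g
    using B0.nrm_mult[of f g] that by simp
  have mult_bounded: "(\<lambda>f. \<phi> (\<lambda>y. f y * g y)) \<in> bounded_linear_maps B0 B" if g: "g \<in> K" for g
    unfolding bounded_linear_maps_def linear_maps_def
  proof (intro CollectI conjI ballI allI Pi_I exI[of _ "nrm B0 g"])
    fix f f' c assume "f \<in> carrier B0" and "f' \<in> carrier B0"
    then have f: "f \<in> K" "f' \<in> K" by simp_all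
    note fg = Y.K_mult[OF f(1) g] Y.K_mult[OF f(2) g]
    show "\<phi> (\<lambda>y. f y * g y) \<in> carrier B" by (rule \<phi>c[OF fg(1)])
    show "\<phi> (\<lambda>y. (f \<oplus>\<^bsub>B0\<^esub> f') y * g y) = \<phi> (\<lambda>y. f y * g y) \<oplus>\<^bsub>B\<^esub> \<phi> (\<lambda>y. f' y * g y)"
      unfolding \<phi>_add[OF fg, symmetric] by (simp add: distrib_right)
    show "\<phi> (\<lambda>y. (c \<odot>\<^bsub>B0\<^esub> f) y * g y) = c \<odot>\<^bsub>B\<^esub> \<phi> (\<lambda>y. f y * g y)"
      unfolding \<phi>_smult[OF fg(1), symmetric] by (simp add: mult.assoc)
    show "nrm B (\<phi> (\<lambda>y. f y * g y)) \<le> nrm B0 g * nrm B0 f"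
      using \<phi>_nrm[OF fg(1)] B0_mult[OF f(1) g] by (simp only: mult.commute)
  qed
  have right_bounded: "(\<lambda>f. \<phi> f \<otimes>\<^bsub>B\<^esub> b) \<in> bounded_linear_maps B0 B"
    and left_bounded: "(\<lambda>f. b \<otimes>\<^bsub>B\<^esub> \<phi> f) \<in> bounded_linear_maps B0 B" if b: "b \<in> carrier B" for b
  proof -
    have nb: "nrm B b * nrm B (\<phi> f) \<le> nrm B b * nrm B0 f" if "f \<in> K" for f
      by (rule mult_left_mono[OF \<phi>_nrm[OF that] B.nrm_nonneg[OF b]])
    have n1: "nrm B (\<phi> f \<otimes>\<^bsub>B\<^esub> b) \<le> nrm B b * nrm B0 f" if "f \<in> K" for f
      using B.nrm_mult[OF \<phi>c[OF that] b] nb[OF that] by (simp only: mult.commute)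
    have n2: "nrm B (b \<otimes>\<^bsub>B\<^esub> \<phi> f) \<le> nrm B b * nrm B0 f" if "f \<in> K" for f
      by (rule order.trans[OF B.nrm_mult[OF b \<phi>c[OF that]] nb[OF that]])
    show "(\<lambda>f. \<phi> f \<otimes>\<^bsub>B\<^esub> b) \<in> bounded_linear_maps B0 B"
      unfolding bounded_linear_maps_def linear_maps_def
      by (intro CollectI conjI ballI allI Pi_I exI[of _ "nrm B b"] n1)
        (simp_all add: \<phi>c \<phi>_add \<phi>_smult b B.l_distr B.smult_mult_left)
    show "(\<lambda>f. b \<otimes>\<^bsub>B\<^esub> \<phi> f) \<in> bounded_linear_maps B0 B"
      unfolding bounded_linear_maps_def linear_maps_def
      by (intro CollectI conjI ballI allI Pi_I exI[of _ "nrm B b"] n2)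
        (simp_all add: \<phi>c \<phi>_add \<phi>_smult b B.r_distr B.smult_mult_right)
  qed
  have mult_cyl: "\<phi> (\<lambda>y. cyl q a y * cyl q' a' y) = \<phi> (cyl q a) \<otimes>\<^bsub>B\<^esub> \<phi> (cyl q' a')"
    if qa: "q \<in> P" "continuous_on UNIV a" "q' \<in> P" "continuous_on UNIV a'" for q a q' a'
  proof -
    obtain k u v where k: "k \<in> P" "u \<in> P" "v \<in> P" "k = u \<otimes> q" "k = v \<otimes> q'"
      "cyl q a = cyl k (\<lambda>x. a (\<theta> u x))" "cyl q' a' = cyl k (\<lambda>x. a' (\<theta> v x))"
      by (rule cyl_common[OF qa])
    have c: "continuous_on UNIV (\<lambda>x. a (\<theta> u x))" "continuous_on UNIV (\<lambda>x. a' (\<theta> v x))"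
      using k qa by simp_all
    have "\<beta> (inv k) (i (\<lambda>x. a (\<theta> u x) * a' (\<theta> v x)))
        = \<beta> (inv k) (i (\<lambda>x. a (\<theta> u x))) \<otimes>\<^bsub>B\<^esub> \<beta> (inv k) (i (\<lambda>x. a' (\<theta> v x)))"
      using cstar_homD(2)[OF \<beta>i_hom[of "inv k"], of "\<lambda>x. a (\<theta> u x)" "\<lambda>x. a' (\<theta> v x)"] k(1) c
      by (simp add: C_alg_eq)
    then show ?thesis
      unfolding k(6,7) gcyl_times using k(1) c by (simp add: \<phi>_cyl continuous_on_mult)
  qed
  have mult1: "\<phi> (\<lambda>y. f y * cyl q a y) = \<phi> f \<otimes>\<^bsub>B\<^esub> \<phi> (cyl q a)"
    if "f \<in> K" and q: "q \<in> P" and a: "continuous_on UNIV a" for f q a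
    by (rule maps_agree[OF B_cstar mult_bounded[OF cyl_in_K[OF q a]]
          right_bounded[OF \<phi>c[OF cyl_in_K[OF q a]]] mult_cyl[OF _ _ q a] that(1)])
  have mult: "\<phi> (\<lambda>y. f y * g y) = \<phi> f \<otimes>\<^bsub>B\<^esub> \<phi> g" if f: "f \<in> K" and g: "g \<in> K" for f g
  proof -
    have "\<phi> (\<lambda>y. g y * f y) = \<phi> f \<otimes>\<^bsub>B\<^esub> \<phi> g"
      by (rule maps_agree[OF B_cstar mult_bounded[OF f] left_bounded[OF \<phi>c[OF f]] _ g])
        (use mult1[OF f] in \<open>simp add: mult.commute\<close>)
    then show ?thesis by (simp add: mult.commute)
  qed
  have adj': "adj B (\<phi> (\<lambda>y. cnj (f y))) = \<phi> f" if f: "f \<in> K" for f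
  proof (rule maps_agree[OF B_cstar _ \<phi> _ f])
    show "(\<lambda>f. adj B (\<phi> (\<lambda>y. cnj (f y)))) \<in> bounded_linear_maps B0 B"
    proof (rule contractive_bounded)
      show "(\<lambda>f. adj B (\<phi> (\<lambda>y. cnj (f y)))) \<in> linear_maps B0 B"
        unfolding linear_maps_def
        by (intro CollectI conjI ballI allI Pi_I)
          (simp_all add: B.adj_closed \<phi>c Y.K_cnj \<phi>_add \<phi>_smult B.adj_add B.adj_smult)
      fix g assume "g \<in> carrier B0"
      then have g: "g \<in> K" by simp
      have "nrm B (adj B (\<phi> (\<lambda>y. cnj (g y)))) = nrm B (\<phi> (\<lambda>y. cnj (g y)))"
        by (rule B.nrm_adj[OF \<phi>c[OF Y.K_cnj[OF g]]])
      also have "\<dots> \<le> nrm B0 (\<lambda>y. cnj (g y))" by (rule \<phi>_nrm[OF Y.K_cnj[OF g]])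
      also have "\<dots> = nrm B0 g" by simp
      finally show "nrm B (adj B (\<phi> (\<lambda>y. cnj (g y)))) \<le> nrm B0 g" .
    qed
    fix q a assume q: "q \<in> P" and a: "continuous_on UNIV (a :: 'x \<Rightarrow> complex)"
    have "\<beta> (inv q) (i (\<lambda>x. cnj (a x))) = adj B (\<beta> (inv q) (i a))"
      using cstar_homD(3)[OF \<beta>i_hom[of "inv q"], of a] q a by (simp add: C_alg_eq)
    then show "adj B (\<phi> (\<lambda>y. cnj (cyl q a y))) = \<phi> (cyl q a)"
      using q a \<phi>c[OF cyl_in_K[OF q a]]
      by (simp add: gcyl_cnj \<phi>_cyl continuous_on_cnj B.adj_adj)
  qed
  have hom: "\<phi> \<in> cstar_hom B0 B"
    unfolding cstar_hom_def
  proof (intro CollectI conjI ballI \<phi>L)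
    fix f g assume "f \<in> carrier B0" "g \<in> carrier B0"
    then have f: "f \<in> K" and g: "g \<in> K" by simp_all
    show "\<phi> (f \<otimes>\<^bsub>B0\<^esub> g) = \<phi> f \<otimes>\<^bsub>B\<^esub> \<phi> g" using mult[OF f g] by simp
    show "\<phi> (adj B0 f) = adj B (\<phi> f)"
      unfolding adj'[OF f, symmetric] using \<phi>c[OF Y.K_cnj[OF f]] by (simp add: B.adj_adj)
  qed
  have "bij_betw \<phi> K (carrier B)"
    by (rule bij_betw_byWitness[where f' = \<psi>]) (use \<psi>\<phi> \<phi>\<psi> \<phi>c \<psi>c in auto)
  then have "\<phi> \<in> cstar_iso B0 B" using hom by (simp add: cstar_iso_def)
  moreover have "\<phi> (F0 f) = F (\<phi> f)" if f: "f \<in> K" for f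
  proof (rule maps_agree[OF B_cstar _ _ _ f])
    show "(\<lambda>f. \<phi> (F0 f)) \<in> bounded_linear_maps B0 B"
    proof (rule contractive_bounded)
      show "(\<lambda>f. \<phi> (F0 f)) \<in> linear_maps B0 B"
        unfolding linear_maps_def
        by (intro CollectI conjI ballI allI Pi_I)
          (simp_all only: linear_mapsD[OF F0_linear] linear_mapsD[OF \<phi>L])
      fix g assume "g \<in> carrier B0"
      then have g: "g \<in> K" by simp
      show "nrm B (\<phi> (F0 g)) \<le> nrm B0 g"
        by (rule order.trans[OF \<phi>_nrm[OF F0_K[OF g]] F0_contr[OF g]])
    qed
    show "(\<lambda>f. F (\<phi> f)) \<in> bounded_linear_maps B0 B"
    proof (rule contractive_bounded)
      show "(\<lambda>f. F (\<phi> f)) \<in> linear_maps B0 B"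
        unfolding linear_maps_def
        by (intro CollectI conjI ballI allI Pi_I)
          (simp_all only: linear_mapsD[OF F.E_linear] linear_mapsD[OF \<phi>L])
      fix g assume "g \<in> carrier B0"
      then have g: "g \<in> K" by simp
      show "nrm B (F (\<phi> g)) \<le> nrm B0 g"
        by (rule order.trans[OF F.E_contr[OF \<phi>c[OF g]] \<phi>_nrm[OF g]])
    qed
    fix q a assume q: "q \<in> P" and a: "continuous_on UNIV (a :: 'x \<Rightarrow> complex)"
    have V: "continuous_on UNIV (V (inv q) a)" using q a V_cont by simp
    \<comment> \<open>The value of \<open>F0\<close> is a cylinder function at level one, where
      \<beta> acts trivially; the dilation identity at inv(q) then finishes the comparison.\<close>
    have "\<phi> (F0 (cyl q a)) = \<beta> (inv \<one>) (i (V (inv q) a))"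
      unfolding F0_def E_cyl[OF q a] i0_def using \<phi>_cyl[OF P_one V] by simp
    also have "\<dots> = i (V (inv q) a)" using \<beta>_one[OF i_closed[OF V]] by simp
    also have "\<dots> = F (\<beta> (inv q) (i a))" using F_\<beta>[of "inv q" a] q a by (simp add: C_alg_eq)
    finally show "\<phi> (F0 (cyl q a)) = F (\<phi> (cyl q a))" by (simp add: \<phi>_cyl[OF q a])
  qed
  moreover have "\<phi> (\<beta>0 t f) = \<beta> t (\<phi> f)" if t: "t \<in> carrier G" and f: "f \<in> K" for t f
  proof -
    \<comment> \<open>Homomorphisms out of \<open>B0\<close> are automatically contractive, so both
      composites qualify for the density argument.\<close>
    have bounded: "h \<in> bounded_linear_maps B0 B" if "h \<in> cstar_hom B0 B" for h
      by (rule contractive_bounded[OF cstar_homD(1)[OF that]])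
        (rule Y.hom_contractive[OF B_cstar that], simp)
    show ?thesis
    proof (rule maps_agree[OF B_cstar bounded[OF cstar_hom_comp[OF \<beta>0_hom[OF t] hom]]
          bounded[OF cstar_hom_comp[OF hom \<beta>_hom[OF t]]] _ f])
      fix q a assume q: "q \<in> P" and a: "continuous_on UNIV (a :: 'x \<Rightarrow> complex)"
      have tq: "t \<otimes> inv q \<in> carrier G" using t q by simp
      obtain r s where rs: "r \<in> P" "s \<in> P" "t \<otimes> inv q = inv r \<otimes> s"
        "gcyl (t \<otimes> inv q) a = cyl r (\<lambda>x. a (\<theta> s x))"
        by (rule gcyl_eq_cyl[OF tq a])
      have "\<phi> (\<beta>0 t (cyl q a)) = \<beta> (inv r) (i (\<lambda>x. a (\<theta> s x)))"
        using \<beta>0_gcyl[OF t, of "inv q" a] q a rs by (simp add: \<phi>_cyl)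
      also have "\<dots> = \<beta> (t \<otimes> inv q) (i a)"
        unfolding rs(3) using \<beta>i_mult[of "inv r" s a] rs a by simp
      also have "\<dots> = \<beta> t (\<beta> (inv q) (i a))" using t q a by (simp add: \<beta>_mult i_closed)
      finally show "\<phi> (\<beta>0 t (cyl q a)) = \<beta> t (\<phi> (cyl q a))" by (simp add: \<phi>_cyl[OF q a])
    qed
  qed
  moreover have "\<phi> (i0 a) = i a" if a: "continuous_on UNIV a" for a
    unfolding i0_def using \<phi>_cyl[OF P_one a] \<beta>_one[OF i_closed[OF a]] by simp
  ultimately show ?thesis by (auto simp: C_alg_eq intro!: bexI[of _ \<phi>])
qed

end

text \<open>Stated outside \<open>er_dilation\<close>, so that it can be applied to two dilations
  with different element types.\<close>

lemma (in exel_renault) canonical_isomorphic: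
  assumes "minimal_faithful_dilation G C_alg V (i, B, \<beta>, F)"
  shows "isomorphic_dilations G C_alg (i0, B0, \<beta>0, F0) (i, B, \<beta>, F)"
proof -
  interpret er_dilation G P \<theta> V \<omega> i B \<beta> F by unfold_locales (rule assms)
  show ?thesis by (rule isomorphic_to_canonical)
qed

theorem theorem3p11:
  fixes G :: "'g monoid"
    and P :: "'g set"
    and \<theta> :: "'g \<Rightarrow> 'x::t2_space \<Rightarrow> 'x"
    and V :: "'g \<Rightarrow> ('x \<Rightarrow> complex) \<Rightarrow> ('x \<Rightarrow> complex)"
  assumes "ore_semigroup (G\<lparr>carrier := P\<rparr>)"
    and "enveloping_group G P"
    and "compact (UNIV :: 'x set)"
    and "covering_action (G\<lparr>carrier := P\<rparr>) \<theta>"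
    and "exel_renault_interaction_group G P \<theta> V"
  shows "(\<exists>D :: ('x \<Rightarrow> complex, 'g, ('g \<Rightarrow> 'x) \<Rightarrow> complex) dilation.
            minimal_faithful_dilation G C_alg V D) \<and>
         (\<forall>(D :: ('x \<Rightarrow> complex, 'g, 'b) dilation) (D' :: ('x \<Rightarrow> complex, 'g, 'c) dilation).
            minimal_faithful_dilation G C_alg V D \<longrightarrow>
            minimal_faithful_dilation G C_alg V D' \<longrightarrow>
            isomorphic_dilations G C_alg D D')"
proof -
  obtain \<omega> where \<omega>: "normalized_coherent_cocycle (G\<lparr>carrier := P\<rparr>) \<theta> \<omega>"
    and V: "\<And>r s a x. \<lbrakk>r \<in> P; s \<in> P; a \<in> carrier C_alg\<rbrakk> \<Longrightarrow>
      V (inv\<^bsub>G\<^esub> r \<otimes>\<^bsub>G\<^esub> s) a x = (\<Sum>y\<in>\<theta> r -` {x}. complex_of_real (\<omega> r y) * a (\<theta> s y))"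
    using assms(5) unfolding exel_renault_interaction_group_def by blast
  have G: "Group.group G" and P: "submonoid P G" and GP: "carrier G = set_inv\<^bsub>G\<^esub> P <#>\<^bsub>G\<^esub> P"
    using assms(2) by (simp_all add: enveloping_group_def)
  interpret exel_renault G P \<theta> V \<omega>
  proof (rule exel_renault.intro[OF G exel_renault_axioms.intro])
    show "compact (UNIV :: 'x set)" by fact
    show "P \<subseteq> carrier G" "\<one>\<^bsub>G\<^esub> \<in> P" "\<And>r s. \<lbrakk>r \<in> P; s \<in> P\<rbrakk> \<Longrightarrow> r \<otimes>\<^bsub>G\<^esub> s \<in> P"
      using P by (simp_all add: submonoid.subset submonoid.one_closed submonoid.m_closed)
    show "\<exists>u\<in>P. \<exists>v\<in>P. u \<otimes>\<^bsub>G\<^esub> r = v \<otimes>\<^bsub>G\<^esub> s" if "r \<in> P" "s \<in> P" for r s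
    proof -
      have "(P #>\<^bsub>G\<lparr>carrier := P\<rparr>\<^esub> r) \<inter> (P #>\<^bsub>G\<lparr>carrier := P\<rparr>\<^esub> s) \<noteq> {}"
        using assms(1) that by (simp add: ore_semigroup_def)
      then show ?thesis by (auto simp: r_coset_def)
    qed
    show "\<exists>r\<in>P. \<exists>s\<in>P. g = inv\<^bsub>G\<^esub> r \<otimes>\<^bsub>G\<^esub> s" if "g \<in> carrier G" for g
      using that unfolding GP by (auto simp: set_mult_def SET_INV_def)
    show "\<theta> \<one>\<^bsub>G\<^esub> x = x" "\<And>r s. \<lbrakk>r \<in> P; s \<in> P\<rbrakk> \<Longrightarrow> \<theta> (r \<otimes>\<^bsub>G\<^esub> s) x = \<theta> s (\<theta> r x)" for x
      using assms(4) by (simp_all add: covering_action_def)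
    show "\<exists>z. \<theta> t z = x" "continuous_on UNIV (\<theta> t)" if "t \<in> P" for t x
    proof -
      have "surj (\<theta> t)" "local_homeomorphism (\<theta> t)"
        using assms(4) that by (simp_all add: covering_action_def)
      then show "\<exists>z. \<theta> t z = x" "continuous_on UNIV (\<theta> t)"
        by (metis surjD, blast intro: continuous_if_local_homeomorphism)
    qed
    show "0 < \<omega> t y" "(\<Sum>y\<in>\<theta> t -` {x}. \<omega> t y) = 1" if "t \<in> P" for t x y
      using \<omega> that by (simp_all add: normalized_coherent_cocycle_def)
    show "continuous_on UNIV (V t a)" if "t \<in> carrier G" "continuous_on UNIV a" for t a
    proof -
      have "V t \<in> linear_maps C_alg C_alg"
        using assms(5) that
        by (simp add: exel_renault_interaction_group_def interaction_group_def bounded_linear_maps_def)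
      then show ?thesis using linear_mapsD(1) that by (force simp: C_alg_eq)
    qed
    show "V (inv\<^bsub>G\<^esub> r \<otimes>\<^bsub>G\<^esub> s) a x = (\<Sum>y\<in>\<theta> r -` {x}. complex_of_real (\<omega> r y) * a (\<theta> s y))"
      if "r \<in> P" "s \<in> P" "continuous_on UNIV a" for r s a x
      by (rule V) (use that in \<open>simp_all add: C_alg_eq\<close>)
  qed
  have "isomorphic_dilations G C_alg (i, B, \<beta>, F) (i', B', \<beta>', F')"
    if "minimal_faithful_dilation G C_alg V (i, B, \<beta>, F)"
      "minimal_faithful_dilation G C_alg V (i', B', \<beta>', F')"
    for i i' and B :: "'b cstar" and B' :: "'c cstar" and \<beta> \<beta>' F F'
    by (rule isomorphic_dilations_if_common[OF _ canonical_isomorphic[OF that(1)]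
          canonical_isomorphic[OF that(2)], where V = V])
      (use canonical_dilation in \<open>simp only: minimal_faithful_dilation_def\<close>)
  then show ?thesis
    using canonical_dilation by (metis prod_cases4)
qed

end
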